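(* Let $\mathfrak g$ be a complex semisimple Lie algebra, $Z\subset\mathbb P(\mathfrak g)$ a nilpotent orbit with its contact structure $D\subset T_Z$, and $z\in Z$ a point. If $F(\overline Z,z)$ is nonempty, then $F(\overline Z,z)$ is contained in the contact hyperplane $\mathbb P(D_z)\subset\mathbb P(T_{Z,z})$, and it is an integral subvariety of $\mathbb P(D_z)$, where $\mathbb P(D_z)$ is equipped with the contact structure arising from the Levi tensor of $D$ at $z$.
   Context: Work over $\mathbb C$; varieties are reduced separated schemes of finite type over $\mathbb C$, not necessarily irreducible; $\mathbb P(V)=(V\setminus 0)/\mathbb C^\times$. Contact structures. A corank-one subbundle $D\subset T_Y$ of the tangent bundle of a complex manifold $Y$ is a contact structure if for each $y\in Y$ the Levi tensor $\mathrm{Levi}_{D,y}:\bigwedge^2 D_y\to T_{Y,y}/D_y$, $v\wedge w\mapsto[\tilde v,\tilde w](y)\bmod D_y$ ($\tilde v,\tilde w$ local sections of $D$ extending $v,w$) is nondegenerate (a symplectic form on $D_y$). A submanifold $X\subset Y$ is integral if $T_{X,x}\subset D_x$ for all $x\in X$. A subvariety of a smooth variety with a contact structure is integral if its smooth locus is an integral submanifold. If $(V,\omega)$ is a symplectic vector space (with $\omega$ possibly defined only up to scale), $\mathbb P(V)$ has the contact structure whose hyperplane at $[v]$ is $(\{w\in V:\omega(v,w)=0\}/\mathbb Cv)\otimes(\mathbb Cv)^\vee\subset (V/\mathbb Cv)\otimes(\mathbb Cv)^\vee=T_{\mathbb P(V),[v]}$; this is applied to $V=D_z$ with $\omega=\mathrm{Levi}_{D,z}$.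 Nilpotent orbits. Let $G$ be the simply connected group with Lie algebra $\mathfrak g$ and $\kappa$ the Killing form. A nilpotent orbit in $\mathbb P(\mathfrak g)$ is an adjoint orbit $Z=\mathrm{Ad}_G([v])$ with $v\ne0$ nilpotent (i.e. $\mathrm{ad}_v$ nilpotent); $\overline Z$ is its closure in $\mathbb P(\mathfrak g)$. The contact structure $D$ of $Z$ is the kernel of the $G$-equivariant contact form $\theta_{KKS}:T_Z\to\mathcal O_{\mathbb P(\mathfrak g)}(1)|_Z$ given at $z=[v]$ by $T_{Z,z}=\mathfrak g/\mathrm{Lie}(\mathrm{Stab}_G([v]))\to(\mathbb Cv)^\vee$, $w\mapsto\kappa(\,\cdot\,,w)|_{\mathbb Cv}$. $F(\overline Z,z):=\{[T_{l,z}]\in\mathbb P(T_{Z,z}): l \text{ is a line of } \mathbb P(\mathfrak g) \text{ contained in } \overline Z \text{ and passing through } z\}$, a closed subvariety of $\mathbb P(T_{Z,z})$ (with reduced structure). *)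

theory Defs
  imports "HOL-Analysis.Analysis"
begin

text \<open>A complex Lie algebra is a bracket on \<open>complex ^ 'n\<close>, so a basis has been chosen; the
  \<^emph>\<open>complex\<close> linear notions are those of \<^term>\<open>(*s)\<close>, i.e. \<^const>\<open>vec.subspace\<close>,
  \<^const>\<open>vec.span\<close>, \<^const>\<open>vec.dim\<close>.\<close>

section \<open>Lie algebras\<close>

definition lie_algebra :: "(complex^'n \<Rightarrow> complex^'n \<Rightarrow> complex^'n) \<Rightarrow> bool" where
  "lie_algebra br \<longleftrightarrow>
     (\<forall>x. Vector_Spaces.linear (*s) (*s) (br x)) \<and>
     (\<forall>y. Vector_Spaces.linear (*s) (*s) (\<lambda>x. br x y)) \<and>
     (\<forall>x. br x x = 0) \<and>
     (\<forall>x y z. br x (br y z) + br y (br z x) + br z (br x y) = 0)"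

definition lie_ideal :: "(complex^'n \<Rightarrow> complex^'n \<Rightarrow> complex^'n) \<Rightarrow> (complex^'n) set \<Rightarrow> bool" where
  "lie_ideal br I \<longleftrightarrow> vec.subspace I \<and> (\<forall>x. \<forall>y\<in>I. br x y \<in> I)"

definition derived :: "(complex^'n \<Rightarrow> complex^'n \<Rightarrow> complex^'n) \<Rightarrow> (complex^'n) set \<Rightarrow> (complex^'n) set" where
  "derived br I = vec.span {br x y | x y. x \<in> I \<and> y \<in> I}"

definition lie_solvable :: "(complex^'n \<Rightarrow> complex^'n \<Rightarrow> complex^'n) \<Rightarrow> (complex^'n) set \<Rightarrow> bool" where
  "lie_solvable br I \<longleftrightarrow> (\<exists>k. (derived br ^^ k) I = {0})"

definition semisimple_lie_algebra :: "(complex^'n \<Rightarrow> complex^'n \<Rightarrow> complex^'n) \<Rightarrow> bool" where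
  "semisimple_lie_algebra br \<longleftrightarrow>
     lie_algebra br \<and> (\<forall>I. lie_ideal br I \<and> lie_solvable br I \<longrightarrow> I = {0})"

definition killing :: "(complex^'n \<Rightarrow> complex^'n \<Rightarrow> complex^'n) \<Rightarrow> complex^'n \<Rightarrow> complex^'n \<Rightarrow> complex" where
  "killing br x y = trace (matrix (\<lambda>u. br x (br y u)))"

definition ad_nilpotent :: "(complex^'n \<Rightarrow> complex^'n \<Rightarrow> complex^'n) \<Rightarrow> complex^'n \<Rightarrow> bool" where
  "ad_nilpotent br v \<longleftrightarrow> (\<exists>k. \<forall>u. (br v ^^ k) u = 0)"

definition exp_ad :: "(complex^'n \<Rightarrow> complex^'n \<Rightarrow> complex^'n) \<Rightarrow> complex^'n \<Rightarrow> complex^'n \<Rightarrow> complex^'n" where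
  "exp_ad br x y = (\<Sum>k. (1 / fact k) *s (br x ^^ k) y)"

text \<open>The image of \<open>Ad\<close>: a connected group with Lie algebra \<open>\<gg>\<close> is generated by the
  exponentials of elements of \<open>\<gg>\<close>, and \<open>Ad (exp x) = exp (ad x)\<close>. Inverses are generated
  too, since \<open>exp (ad x)\<close> has inverse \<open>exp (ad (- x))\<close>.\<close>

inductive_set Ad_group :: "(complex^'n \<Rightarrow> complex^'n \<Rightarrow> complex^'n) \<Rightarrow> (complex^'n \<Rightarrow> complex^'n) set"
  for br where
  Ad_id: "id \<in> Ad_group br"
| Ad_step: "g \<in> Ad_group br \<Longrightarrow> exp_ad br x \<circ> g \<in> Ad_group br"

section \<open>Projective spaces of subquotients\<close>

text \<open>For subspaces \<open>B \<subseteq> A\<close>, the point of \<open>\<PP>(A/B)\<close> given by the class of \<open>a \<in> A - B\<close> is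
  represented by the preimage in \<open>A\<close> of the line that it spans in \<open>A/B\<close>, i.e. by the subspace
  \<open>B + \<complex>a\<close>. For \<open>B = 0\<close> it is the line \<open>\<complex>a\<close> itself.\<close>

definition ppt :: "(complex^'n) set \<Rightarrow> complex^'n \<Rightarrow> (complex^'n) set" where
  "ppt B a = vec.span (insert a B)"

definition proj_space :: "(complex^'n) set \<Rightarrow> (complex^'n) set \<Rightarrow> (complex^'n) set set" where
  "proj_space A B = {ppt B a | a. a \<in> A - B}"

definition homogeneous_poly :: "(complex^'n \<Rightarrow> complex) \<Rightarrow> bool" where
  "homogeneous_poly p \<longleftrightarrow> (\<exists>d c. p = (\<lambda>x.
     \<Sum>\<alpha> \<in> {\<alpha> :: 'n \<Rightarrow> nat. (\<Sum>i\<in>UNIV. \<alpha> i) = d}. c \<alpha> * (\<Prod>i\<in>UNIV. (x $ i) ^ \<alpha> i)))"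

text \<open>Homogeneous polynomials on \<open>A/B\<close> are the restrictions to \<open>A\<close> of homogeneous polynomials
  on the ambient space that are, on \<open>A\<close>, invariant under translation by \<open>B\<close>.\<close>

definition zariski_closed :: "(complex^'n) set \<Rightarrow> (complex^'n) set \<Rightarrow> (complex^'n) set set \<Rightarrow> bool" where
  "zariski_closed A B X \<longleftrightarrow> (\<exists>S.
     (\<forall>p\<in>S. homogeneous_poly p \<and> (\<forall>a\<in>A. \<forall>b\<in>B. p (a + b) = p a)) \<and>
     X = {ppt B a | a. a \<in> A - B \<and> (\<forall>p\<in>S. p a = 0)})"

definition zariski_closure :: "(complex^'n) set \<Rightarrow> (complex^'n) set \<Rightarrow> (complex^'n) set set \<Rightarrow> (complex^'n) set set" where
  "zariski_closure A B X = \<Inter>{Y. zariski_closed A B Y \<and> X \<subseteq> Y}"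

section \<open>Complex submanifolds and smooth loci\<close>

definition cholomorphic_on :: "(complex^'n \<Rightarrow> complex^'n) \<Rightarrow> (complex^'n) set \<Rightarrow> bool" where
  "cholomorphic_on f U \<longleftrightarrow>
     (\<forall>x\<in>U. \<exists>f'. (f has_derivative f') (at x) \<and> Vector_Spaces.linear (*s) (*s) f')"

definition submanifold_at :: "(complex^'n) set \<Rightarrow> complex^'n \<Rightarrow> bool" where
  "submanifold_at M a \<longleftrightarrow> a \<in> M \<and> (\<exists>U W \<Phi> \<Psi> E.
     open U \<and> a \<in> U \<and> open W \<and> \<Phi> ` U = W \<and> \<Psi> ` W = U \<and>
     (\<forall>x\<in>U. \<Psi> (\<Phi> x) = x) \<and> (\<forall>y\<in>W. \<Phi> (\<Psi> y) = y) \<and>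
     cholomorphic_on \<Phi> U \<and> cholomorphic_on \<Psi> W \<and>
     vec.subspace E \<and> \<Phi> ` (M \<inter> U) = W \<inter> E)"

text \<open>Velocities at \<open>a\<close> of holomorphic discs in \<open>M\<close>; used where \<open>M\<close> is a submanifold near \<open>a\<close>.\<close>

definition tangent_space :: "(complex^'n) set \<Rightarrow> complex^'n \<Rightarrow> (complex^'n) set" where
  "tangent_space M a = {(\<chi> i. deriv (\<lambda>s. \<gamma> s $ i) 0) | \<gamma>. \<exists>r>0.
     (\<forall>i. (\<lambda>s. \<gamma> s $ i) holomorphic_on ball 0 r) \<and> \<gamma> ` ball 0 r \<subseteq> M \<and> \<gamma> 0 = a}"

text \<open>The affine charts of \<open>\<PP>(A/B)\<close> centred at the point \<open>L\<close> are the maps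
  \<open>N \<rightarrow> \<PP>(A/B), n \<mapsto> [a + n]\<close>, where \<open>a\<close> represents \<open>L\<close> and \<open>N\<close> is a complement of \<open>L\<close>
  in \<open>A\<close>.\<close>

definition is_chart :: "(complex^'n) set \<Rightarrow> (complex^'n) set \<Rightarrow> (complex^'n) set \<Rightarrow>
    complex^'n \<Rightarrow> (complex^'n) set \<Rightarrow> bool" where
  "is_chart A B L a N \<longleftrightarrow>
     a \<in> L - B \<and> vec.subspace N \<and> N \<inter> L = {0} \<and> {n + l | n l. n \<in> N \<and> l \<in> L} = A"

definition in_chart :: "(complex^'n) set \<Rightarrow> complex^'n \<Rightarrow> (complex^'n) set \<Rightarrow>
    (complex^'n) set set \<Rightarrow> (complex^'n) set" where
  "in_chart B a N X = {n \<in> N. ppt B (a + n) \<in> X}"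

definition smooth_locus :: "(complex^'n) set \<Rightarrow> (complex^'n) set \<Rightarrow> (complex^'n) set set \<Rightarrow> (complex^'n) set set" where
  "smooth_locus A B X =
     {L \<in> X. \<exists>a N. is_chart A B L a N \<and> submanifold_at (in_chart B a N X) 0}"

text \<open>\<open>T\<^bsub>\<PP>(A/B),L\<^esub> = (A/L) \<otimes> (L/B)\<^sup>\<or>\<close> with \<open>L/B\<close> one-dimensional, so a subspace of it is the
  same as a subspace of \<open>A\<close> containing \<open>L\<close>; independent of the choice of \<open>a\<close> and \<open>N\<close>.\<close>

definition proj_tangent_space :: "(complex^'n) set \<Rightarrow> (complex^'n) set \<Rightarrow> (complex^'n) set set \<Rightarrow>
    (complex^'n) set \<Rightarrow> (complex^'n) set" where
  "proj_tangent_space A B X L =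
     {u + l | u l. l \<in> L \<and> (\<exists>a N. is_chart A B L a N \<and> u \<in> tangent_space (in_chart B a N X) 0)}"

text \<open>\<open>H L\<close> is the preimage in \<open>A\<close>, in the sense just explained, of the hyperplane of a
  distribution on \<open>\<PP>(A/B)\<close> at \<open>L\<close>.\<close>

definition integral_subvariety :: "(complex^'n) set \<Rightarrow> (complex^'n) set \<Rightarrow>
    ((complex^'n) set \<Rightarrow> (complex^'n) set) \<Rightarrow> (complex^'n) set set \<Rightarrow> bool" where
  "integral_subvariety A B H X \<longleftrightarrow> zariski_closed A B X \<and>
     (\<forall>L \<in> smooth_locus A B X. proj_tangent_space A B X L \<subseteq> H L)"

section \<open>The Levi tensor\<close>

definition local_section :: "(complex^'n) set \<Rightarrow> (complex^'n \<Rightarrow> (complex^'n) set) \<Rightarrow>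
    (complex^'n) set \<Rightarrow> (complex^'n \<Rightarrow> complex^'n) \<Rightarrow> bool" where
  "local_section Y D U \<xi> \<longleftrightarrow> open U \<and> cholomorphic_on \<xi> U \<and> (\<forall>x \<in> Y \<inter> U. \<xi> x \<in> D x)"

text \<open>For a submanifold \<open>Y\<close> of the ambient vector space and a distribution \<open>D\<close> on it, sections
  are taken as restrictions to \<open>Y\<close> of ambient holomorphic vector fields. The value is an element
  of \<open>T\<^bsub>Y,y\<^esub> / D\<^sub>y\<close>, i.e. a coset of \<open>D y\<close>, namely that of
  \<open>[\<xi>, \<eta>](y) = d\<eta>\<^sub>y(\<xi>(y)) - d\<xi>\<^sub>y(\<eta>(y))\<close>.\<close>

definition levi_affine :: "(complex^'n) set \<Rightarrow> (complex^'n \<Rightarrow> (complex^'n) set) \<Rightarrow>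
    complex^'n \<Rightarrow> complex^'n \<Rightarrow> complex^'n \<Rightarrow> (complex^'n) set" where
  "levi_affine Y D y u v = {t. \<exists>U \<xi> \<eta> \<xi>' \<eta>'. y \<in> U \<and>
     local_section Y D U \<xi> \<and> local_section Y D U \<eta> \<and> \<xi> y = u \<and> \<eta> y = v \<and>
     (\<xi> has_derivative \<xi>') (at y) \<and> (\<eta> has_derivative \<eta>') (at y) \<and>
     t - (\<eta>' u - \<xi>' v) \<in> D y}"

section \<open>Nilpotent orbits and their contact structure\<close>

definition nilpotent_orbit :: "(complex^'n \<Rightarrow> complex^'n \<Rightarrow> complex^'n) \<Rightarrow> (complex^'n) set set \<Rightarrow> bool" where
  "nilpotent_orbit br Z \<longleftrightarrow>
     (\<exists>v. v \<noteq> 0 \<and> ad_nilpotent br v \<and> Z = {ppt {0} (g v) | g. g \<in> Ad_group br})"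

text \<open>For \<open>z \<in> Z\<close>, the tangent space \<open>T\<^bsub>Z,z\<^esub>\<close> is \<open>\<gg> / lie_stab br z\<close>, and \<open>D\<^sub>z\<close> is
  \<open>contact_space br z / lie_stab br z\<close>.\<close>

definition lie_stab :: "(complex^'n \<Rightarrow> complex^'n \<Rightarrow> complex^'n) \<Rightarrow> (complex^'n) set \<Rightarrow> (complex^'n) set" where
  "lie_stab br z = {w. \<forall>x\<in>z. br w x \<in> z}"

definition contact_space :: "(complex^'n \<Rightarrow> complex^'n \<Rightarrow> complex^'n) \<Rightarrow> (complex^'n) set \<Rightarrow> (complex^'n) set" where
  "contact_space br z = {w. \<forall>x\<in>z. killing br x w = 0}"

text \<open>The affine chart \<open>\<phi> \<noteq> 0\<close> of \<open>\<PP>(\<gg>)\<close> is identified with the affine hyperplane \<open>\<phi> = 1\<close>.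
  In it, the tangent vector at \<open>[x]\<close> given by the infinitesimal action of \<open>w \<in> \<gg>\<close> is the
  derivative at \<open>t = 0\<close> of \<open>y(t) / \<phi>(y(t))\<close>, where \<open>y(t) = exp (ad (t w)) x\<close>.\<close>

definition action_in_chart :: "(complex^'n \<Rightarrow> complex^'n \<Rightarrow> complex^'n) \<Rightarrow> (complex^'n \<Rightarrow> complex) \<Rightarrow>
    complex^'n \<Rightarrow> complex^'n \<Rightarrow> complex^'n" where
  "action_in_chart br \<phi> x w = br w x - \<phi> (br w x) *s x"

definition orbit_in_chart :: "(complex^'n \<Rightarrow> complex) \<Rightarrow> (complex^'n) set set \<Rightarrow> (complex^'n) set" where
  "orbit_in_chart \<phi> Z = {x. \<phi> x = 1 \<and> ppt {0} x \<in> Z}"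

definition contact_in_chart :: "(complex^'n \<Rightarrow> complex^'n \<Rightarrow> complex^'n) \<Rightarrow> (complex^'n \<Rightarrow> complex) \<Rightarrow>
    complex^'n \<Rightarrow> (complex^'n) set" where
  "contact_in_chart br \<phi> x = action_in_chart br \<phi> x ` contact_space br (ppt {0} x)"

text \<open>The Levi tensor of \<open>D\<close> at \<open>z\<close>, evaluated on the classes of \<open>w\<^sub>1\<close> and \<open>w\<^sub>2\<close> in \<open>D\<^sub>z\<close>. Its value
  in \<open>T\<^bsub>Z,z\<^esub> / D\<^sub>z = \<gg> / contact_space br z\<close> is a coset of \<^term>\<open>contact_space br z\<close>, so that it
  vanishes iff it is equal to \<^term>\<open>contact_space br z\<close>. It does not depend on \<open>\<phi>\<close>.\<close>

definition levi_tensor :: "(complex^'n \<Rightarrow> complex^'n \<Rightarrow> complex^'n) \<Rightarrow> (complex^'n) set set \<Rightarrow>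
    (complex^'n) set \<Rightarrow> complex^'n \<Rightarrow> complex^'n \<Rightarrow> (complex^'n) set" where
  "levi_tensor br Z z w1 w2 = {w. \<exists>\<phi> v.
     Vector_Spaces.linear (*s) (*) \<phi> \<and> v \<in> z \<and> \<phi> v = 1 \<and>
     action_in_chart br \<phi> v w \<in>
       levi_affine (orbit_in_chart \<phi> Z) (contact_in_chart br \<phi>) v
         (action_in_chart br \<phi> v w1) (action_in_chart br \<phi> v w2)}"

text \<open>The hyperplane at \<open>L\<close> of the contact structure on \<open>\<PP>(D\<^sub>z)\<close>, as a subspace of
  \<^term>\<open>contact_space br z\<close> containing \<open>L\<close>.\<close>

definition levi_hyperplane :: "(complex^'n \<Rightarrow> complex^'n \<Rightarrow> complex^'n) \<Rightarrow> (complex^'n) set set \<Rightarrow>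
    (complex^'n) set \<Rightarrow> (complex^'n) set \<Rightarrow> (complex^'n) set" where
  "levi_hyperplane br Z z L =
     {w \<in> contact_space br z. \<forall>a\<in>L. levi_tensor br Z z a w = contact_space br z}"

section \<open>Lines in the closure of the orbit\<close>

definition is_line :: "(complex^'n) set set \<Rightarrow> (complex^'n) set \<Rightarrow> bool" where
  "is_line l P \<longleftrightarrow> vec.subspace P \<and> vec.dim P = 2 \<and> l = proj_space P {0}"

text \<open>\<open>F X z\<close>, inside \<open>\<PP>(T\<^bsub>Z,z\<^esub>) = proj_space UNIV (lie_stab br z)\<close>. Inside
  \<open>T\<^bsub>\<PP>(\<gg>),z\<^esub> = Hom(z, \<gg>/z)\<close>, the class of \<open>w\<close> in \<open>T\<^bsub>Z,z\<^esub>\<close> is \<open>x \<mapsto> [w, x] mod z\<close> and the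
  tangent space of the line \<open>\<PP>(P)\<close> is \<open>Hom(z, P/z)\<close>; so its preimage in \<open>\<gg>\<close> is the set
  of all \<open>w\<close> with \<open>[w, z] \<subseteq> P\<close>, and it represents a point of \<open>\<PP>(T\<^bsub>Z,z\<^esub>)\<close> iff the line is
  tangent to \<open>Z\<close> at \<open>z\<close>.\<close>

definition line_directions :: "(complex^'n \<Rightarrow> complex^'n \<Rightarrow> complex^'n) \<Rightarrow> (complex^'n) set set \<Rightarrow>
    (complex^'n) set \<Rightarrow> (complex^'n) set set" where
  "line_directions br X z = {T \<in> proj_space UNIV (lie_stab br z).
     \<exists>l P. is_line l P \<and> l \<subseteq> X \<and> z \<in> l \<and> T = {w. \<forall>x\<in>z. br w x \<in> P}}"

end

theory Submission
  imports Defs "HOL-Complex_Analysis.Complex_Analysis" "HOL-Computational_Algebra.Field_as_Ring"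
begin

text \<open>
  Let \<open>y\<close> span \<open>z\<close>, and put \<open>Y = ad y\<close>. The contact form sends the tangent vector \<open>[w, x]\<close> at
  \<open>[x]\<close> to \<open>\<kappa>(x, w)\<close>, with values in \<open>\<O>(1)\<close>. On a line \<open>l\<close> in the closure of \<open>Z\<close> through \<open>z\<close> it
  restricts to a section of \<open>\<Omega>\<^sub>l(1) = \<O>(-1)\<close> with possible poles where \<open>l\<close> leaves \<open>Z\<close>. Once
  poles are excluded the section vanishes, so \<open>l\<close> is tangent to \<open>D\<close>. The lines through \<open>z\<close> of a
  holomorphic disc in \<open>F\<close> sweep out a surface. In the second direction of this surface the form
  gives a section of \<open>\<O>(1)\<close> along each line, which has a double zero at \<open>z\<close>; again it vanishes if it
  has no poles. So the contact form vanishes on the surface, hence so does its differential, and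
  this says that the Levi tensor pairs the line direction \<open>a\<close> with its derivative \<open>a'\<close> along the
  disc to zero.

  The poles are usually excluded by pulling the contact form back to a resolution of the orbit
  closure. Here linear algebra in \<open>\<gg>\<ll>(\<gg>)\<close> takes the place of the resolution. If \<open>N = ad x\<close> and
  \<open>[H, N] = N\<close>, then \<open>\<kappa>(x, w) = - tr (H [ad w, N])\<close>, so the contact form on the velocity of a
  family \<open>N\<close> is \<open>- tr (H N')\<close>. Although \<open>H\<close> may have poles, \<open>tr (H N')\<close> has none
  (\<open>trace_grading_derivation\<close>): \<open>H\<close> preserves the kernel of \<open>N\<close>, the kernel is a direct summand,
  and if \<open>Q\<close> is a projection along it, then passing to the map induced on the quotient changes
  \<open>tr (H N')\<close> by \<open>tr (N Q')\<close>, where \<open>H\<close> does not occur; iterate. This is applied over the polynomial ring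
  \<open>L[t]\<close>, for the finite points of the line, and over \<open>L[1/t]\<close>, for the point at infinity, where
  \<open>L\<close> is the field of Laurent series in the parameter \<open>s\<close> of the disc; the two derivations are
  \<open>\<partial>/\<partial>t\<close> and \<open>\<partial>/\<partial>s\<close>. Working over \<open>L\<close> means that poles are controlled for generic \<open>s\<close> only, which
  is enough because the conclusion is a closed condition on \<open>s\<close>. The result is
  \<open>isotropic_pencil_derivative\<close>.

  Near \<open>t = 0\<close> one needs a regular \<open>H\<close> with a prescribed first order part. It exists because the
  rank of \<open>[-, ad x]\<close> is constant on \<open>Z\<close>: this provides a generalized inverse whose entries are
  polynomials in \<open>x\<close> (\<open>constant_rank_inverse\<close>), and polynomial identities pass from \<open>Z\<close> to its
  closure. In this way \<open>isotropic_lines\<close> needs only that homogeneous polynomials vanishing on \<open>Z\<close>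
  vanish on the lines.

  The Levi tensor is \<open>\<kappa>(y, [a, b])\<close>: one inclusion of cosets follows by differentiating
  \<open>tr (H \<xi>) = 0\<close> along one-parameter groups (\<open>levi_affine_value\<close>), the other from explicit
  sections of \<open>D\<close> (\<open>contact_section\<close>). Finally \<open>F\<close> is cut out in \<open>\<PP>(D\<^sub>z)\<close> by the polynomials
  \<open>a \<mapsto> q (\<psi>(a) y + f(a))\<close>, with \<open>q\<close> vanishing on \<open>Z\<close>, \<open>\<psi>\<close> a linear form on \<open>D\<^sub>z\<close> and
  \<open>f(a)\<close> equal to \<open>[a, y]\<close> modulo \<open>y\<close>.
\<close>

no_notation fps_nth (infixl \<open>$\<close> 75)

section \<open>Square matrices over a commutative ring\<close>

text \<open>A type of its own makes square matrices an instance of \<open>ring_1\<close>, so that powers and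
  \<open>algebra_simps\<close> are available; on \<open>'a^'n^'n\<close> the symbol \<open>*\<close> is the entrywise product.\<close>

typedef ('a, 'n) sqmat = "UNIV :: ('n \<Rightarrow> 'n \<Rightarrow> 'a) set"
  morphisms ent Mat by simp

lemma ent_Mat [simp]: "ent (Mat f) = f"
  by (simp add: Mat_inverse)

lemma sqmat_eqI: "(\<And>i j. ent x i j = ent y i j) \<Longrightarrow> x = y"
  by (metis ent_inject ext)

instantiation sqmat :: (comm_ring_1, finite) ring_1
begin
definition "0 = Mat (\<lambda>i j. 0)"
definition "1 = Mat (\<lambda>i j. if i = j then 1 else 0)"
definition "x + y = Mat (\<lambda>i j. ent x i j + ent y i j)"
definition "x - y = Mat (\<lambda>i j. ent x i j - ent y i j)"
definition "- x = Mat (\<lambda>i j. - ent x i j)"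
definition "x * y = Mat (\<lambda>i j. \<Sum>k\<in>UNIV. ent x i k * ent y k j)"
instance
proof
  fix a b c :: "('a, 'b) sqmat"
  have "(\<Sum>k\<in>UNIV. (\<Sum>l\<in>UNIV. ent a i l * ent b l k) * ent c k j) =
        (\<Sum>l\<in>UNIV. ent a i l * (\<Sum>k\<in>UNIV. ent b l k * ent c k j))" for i j
    unfolding sum_distrib_left sum_distrib_right
    by (subst sum.swap) (simp add: mult.assoc)
  then show "a * b * c = a * (b * c)"
    by (simp add: times_sqmat_def)
  show "(0 :: ('a, 'b) sqmat) \<noteq> 1"
    by (metis (mono_tags, lifting) ent_Mat one_sqmat_def zero_neq_one zero_sqmat_def)
qed (simp_all add: zero_sqmat_def one_sqmat_def plus_sqmat_def minus_sqmat_def uminus_sqmat_def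
      times_sqmat_def algebra_simps sum.distrib if_distrib if_distribR ent_inverse
      cong: if_cong)
end

lemma ent_simps [simp]:
  "ent 0 i j = 0" "ent (x + y) i j = ent x i j + ent y i j"
  "ent (x - y) i j = ent x i j - ent y i j" "ent (- x) i j = - ent x i j"
  for x y :: "('a::comm_ring_1, 'n::finite) sqmat"
  by (simp_all add: zero_sqmat_def plus_sqmat_def minus_sqmat_def uminus_sqmat_def)

lemma ent_1: "ent 1 i j = (if i = j then 1 else 0)"
  by (simp add: one_sqmat_def)

lemma ent_mult: "ent (x * y) i j = (\<Sum>k\<in>UNIV. ent x i k * ent y k j)"
  by (simp add: times_sqmat_def)

definition scale :: "'a::comm_ring_1 \<Rightarrow> ('a, 'n) sqmat \<Rightarrow> ('a, 'n) sqmat" (infixr \<open>*m\<close> 75) where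
  "c *m x = Mat (\<lambda>i j. c * ent x i j)"

definition tr :: "('a::comm_ring_1, 'n::finite) sqmat \<Rightarrow> 'a" where
  "tr x = (\<Sum>i\<in>UNIV. ent x i i)"

definition mmap :: "('a \<Rightarrow> 'b) \<Rightarrow> ('a, 'n) sqmat \<Rightarrow> ('b, 'n) sqmat" where
  "mmap f x = Mat (\<lambda>i j. f (ent x i j))"

lemma ent_mmap [simp]: "ent (mmap f x) i j = f (ent x i j)"
  by (simp add: mmap_def)

lemma ent_scale [simp]: "ent (c *m x) i j = c * ent x i j"
  by (simp add: scale_def)

lemma scale_simps [simp]:
  "(c *m x) * y = c *m (x * y)" "x * (c *m y) = c *m (x * y)" "c *m d *m x = (c * d) *m x"
  "1 *m x = x" "0 *m x = 0" "c *m 0 = 0"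
  for x y :: "('a::comm_ring_1, 'n::finite) sqmat"
  by (auto intro!: sqmat_eqI simp: ent_mult sum_distrib_left mult_ac)

lemma scale_distrib:
  "c *m (x + y) = c *m x + c *m y" "c *m (x - y) = c *m x - c *m y" "(c + d) *m x = c *m x + d *m x"
  "(c - d) *m x = c *m x - d *m x" "c *m (- x) = - (c *m x)"
  for x y :: "('a::comm_ring_1, 'n::finite) sqmat"
  by (auto intro!: sqmat_eqI simp: algebra_simps)

lemma scale_cancel: "c *m x = c *m y \<longleftrightarrow> x = y" if "c \<noteq> 0"
  for c :: "'a::idom"
  using that by (metis ent_scale mult_left_cancel sqmat_eqI)

lemma scale_eq_0: "c *m x = 0 \<longleftrightarrow> x = 0" if "c \<noteq> 0"
  for c :: "'a::idom" and x :: "('a, 'n::finite) sqmat"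
  using scale_cancel[OF that, of x 0] by simp

lemma tr_simps [simp]:
  "tr 0 = 0" "tr (x + y) = tr x + tr y" "tr (x - y) = tr x - tr y" "tr (- x) = - tr x"
  "tr (c *m x) = c * tr x"
  by (simp_all add: tr_def sum.distrib sum_subtractf sum_negf sum_distrib_left)

lemma tr_commute: "tr (x * y) = tr (y * x)"
  unfolding tr_def ent_mult by (subst sum.swap) (simp add: mult.commute)

definition comm :: "'a::ring \<Rightarrow> 'a \<Rightarrow> 'a" where
  "comm x y = x * y - y * x"

lemma tr_comm: "tr (comm x y * z) = tr (x * comm y z)"
  unfolding comm_def left_diff_distrib right_diff_distrib tr_simps
  by (metis mult.assoc tr_commute)

text \<open>A nonzero linear combination of least Euclidean size divides everything.\<close>

lemma bezout_family:
  fixes f :: "'n::finite \<Rightarrow> 'a::euclidean_ring"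
  obtains c g where "(\<Sum>k\<in>UNIV. f k * c k) = g" "\<And>k. g dvd f k"
proof (cases "\<forall>c. (\<Sum>k\<in>UNIV. f k * c k) = 0")
  case True
  have "f k = 0" for k
    using True[rule_format, of "\<lambda>l. if l = k then 1 else 0"] by (simp add: if_distrib cong: if_cong)
  then show ?thesis
    using that[of "\<lambda>_. 0" 0] by simp
next
  case False
  define X where "X = {g. g \<noteq> 0 \<and> (\<exists>c. g = (\<Sum>k\<in>UNIV. f k * c k))}"
  have "\<exists>g. g \<in> X"
    using False by (auto simp: X_def)
  then obtain g where g: "g \<in> X" and min: "\<And>h. h \<in> X \<Longrightarrow> euclidean_size g \<le> euclidean_size h"
    using exists_least_iff[of "\<lambda>n. \<exists>g\<in>X. euclidean_size g = n"] by (metis not_le)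
  then obtain c where c: "g = (\<Sum>k\<in>UNIV. f k * c k)" and g0: "g \<noteq> 0"
    by (auto simp: X_def)
  have "g dvd f k" for k
  proof -
    have "f k mod g = f k - f k div g * g"
      by (simp add: minus_div_mult_eq_mod)
    also have "\<dots> = (\<Sum>l\<in>UNIV. f l * (if l = k then 1 else 0)) - f k div g * (\<Sum>l\<in>UNIV. f l * c l)"
      by (subst c[symmetric]) (simp add: if_distrib cong: if_cong)
    also have "\<dots> = (\<Sum>l\<in>UNIV. f l * ((if l = k then 1 else 0) - f k div g * c l))"
      by (simp add: right_diff_distrib sum_subtractf sum_distrib_left mult_ac)
    finally have "f k mod g \<noteq> 0 \<Longrightarrow> f k mod g \<in> X"
      unfolding X_def by (intro CollectI conjI exI)
    then have "f k mod g = 0"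
      using min mod_size_less[OF g0, of "f k"] by (meson not_le)
    then show ?thesis
      by (simp add: dvd_eq_mod_eq_0)
  qed
  then show ?thesis
    using that c by metis
qed

text \<open>Over a Euclidean ring the kernel of a matrix is a direct summand, and the complementary
  projection is, up to a denominator \<open>d\<close>, a left multiple of the matrix. The rows are imposed one
  at a time: if \<open>r\<close> is the new row and \<open>r P\<close> has content \<open>g = r P c\<close>, then \<open>P\<close> is replaced by
  \<open>P - w (r P / g)\<close>, where \<open>w = P c\<close>. The support condition on \<open>S\<close> says that only the rows imposed
  so far are used.\<close>

lemma kernel_splits_rows:
  fixes N :: "('a::euclidean_ring, 'n::finite) sqmat"
  shows "\<exists>P S d. d \<noteq> 0 \<and> P * P = P \<and> (\<forall>i\<in>I. \<forall>k. ent (N * P) i k = 0) \<and>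
     d *m (1 - P) = S * N \<and> (\<forall>i j. j \<notin> I \<longrightarrow> ent S i j = 0)"
  using finite[of I]
proof (induction I)
  case empty
  show ?case
    by (rule exI[of _ 1], rule exI[of _ 0], rule exI[of _ 1]) simp
next
  case (insert i I)
  then obtain P S d where d: "d \<noteq> 0" and PP: "P * P = P"
    and NP: "\<And>i k. i \<in> I \<Longrightarrow> ent (N * P) i k = 0"
    and SN: "d *m (1 - P) = S * N" and S: "\<And>i j. j \<notin> I \<Longrightarrow> ent S i j = 0"
    by blast
  show ?case
  proof (cases "\<forall>k. ent (N * P) i k = 0")
    case True
    then show ?thesis
      using d PP NP SN S by (intro exI[of _ P] exI[of _ S] exI[of _ d]) auto
  next
    case False
    define r where "r = ent (N * P) i"
    obtain c g where c: "(\<Sum>k\<in>UNIV. r k * c k) = g" and g: "\<And>k. g dvd r k"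
      using bezout_family by blast
    have g0: "g \<noteq> 0"
      using False g by (auto simp: r_def)
    define q where "q k = r k div g" for k
    have r: "r k = g * q k" for k
      using g by (simp add: q_def)
    define C where "C = Mat (\<lambda>j k. c j * q k)"
    define W where "W = P * C"
    \<comment> \<open>\<open>U N\<close> has the \<open>i\<close>-th row of \<open>N\<close> in all its rows, weighted by the vector \<open>P c\<close>.\<close>
    define U where "U = Mat (\<lambda>j k. if k = i then (\<Sum>l\<in>UNIV. ent P j l * c l) else 0)"
    have PW: "P * W = W"
      by (simp add: W_def PP flip: mult.assoc)
    have gW: "g *m W = U * N * P"
    proof (rule sqmat_eqI)
      fix j k
      have "ent (U * N * P) j k = ent (U * (N * P)) j k"
        by (simp add: mult.assoc)
      also have "\<dots> = (\<Sum>l\<in>UNIV. ent P j l * c l) * r k"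
        unfolding r_def by (subst ent_mult) (simp add: U_def if_distribR if_distrib cong: if_cong)
      also have "\<dots> = ent (g *m W) j k"
        unfolding ent_scale by (simp add: W_def C_def ent_mult r sum_distrib_left sum_distrib_right mult_ac)
      finally show "ent (g *m W) j k = ent (U * N * P) j k" ..
    qed
    have NW: "ent (N * W) i k = r k" for k
    proof -
      have "ent (N * W) i k = ent (N * P * C) i k"
        by (simp add: W_def mult.assoc)
      also have "\<dots> = (\<Sum>l\<in>UNIV. r l * (c l * q k))"
        by (subst ent_mult) (simp add: C_def r_def)
      also have "\<dots> = g * q k"
        by (simp add: c[symmetric] sum_distrib_left sum_distrib_right mult_ac)
      finally show ?thesis
        by (simp add: r)
    qed
    have "g *m (W * P) = (g *m W) * P"
      by simp
    also have "\<dots> = g *m W"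
      by (simp only: gW mult.assoc PP)
    finally have WP: "W * P = W"
      using g0 by (simp add: scale_cancel)
    have UNW: "U * (N * W) = U * (N * P)"
      by (rule sqmat_eqI, unfold ent_mult[of U])
        (simp add: U_def if_distribR if_distrib NW r_def cong: if_cong)
    have "g *m (W * W) = (g *m W) * W"
      by simp
    also have "\<dots> = U * N * P * W"
      by (simp only: gW)
    also have "\<dots> = U * (N * W)"
      by (simp add: mult.assoc PW)
    also have "\<dots> = g *m W"
      by (simp add: UNW gW mult.assoc)
    finally have WW: "W * W = W"
      using g0 by (simp add: scale_cancel)
    define S' where "S' = g *m S + d *m U - U * N * S"
    have "(P - W) * (P - W) = P - W"
      by (simp add: algebra_simps PP PW WP WW)
    moreover have "ent (N * (P - W)) l k = 0" if "l \<in> insert i I" for l k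
    proof (cases "l = i")
      case True
      then show ?thesis
        by (simp add: right_diff_distrib NW r_def)
    next
      case False
      then have "l \<in> I"
        using that by simp
      moreover have "ent (N * W) l k = ent ((N * P) * C) l k"
        by (simp add: W_def mult.assoc)
      ultimately show ?thesis
        by (simp add: right_diff_distrib NP ent_mult[of "N * P"])
    qed
    moreover have "(d * g) *m (1 - (P - W)) = S' * N"
    proof -
      have "(d * g) *m (1 - (P - W)) = g *m (d *m (1 - P)) + d *m (g *m W)"
        by (simp add: scale_distrib mult.commute[of d g])
      also have "d *m (g *m W) = d *m (U * N) - U * N * (d *m (1 - P))"
        by (simp add: gW algebra_simps scale_distrib)
      also have "g *m (d *m (1 - P)) + (d *m (U * N) - U * N * (d *m (1 - P))) = S' * N"
        unfolding SN S'_def by (simp add: algebra_simps scale_distrib)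
      finally show ?thesis .
    qed
    moreover have "ent S' j l = 0" if "l \<notin> insert i I" for j l
      using that by (simp add: S'_def S ent_mult[of "U * N"]) (simp add: U_def)
    ultimately show ?thesis
      using d g0 by (intro exI[of _ "P - W"] exI[of _ S'] exI[of _ "d * g"]) simp
  qed
qed

lemma kernel_splits:
  fixes N :: "('a::euclidean_ring, 'n::finite) sqmat"
  obtains P S d where "d \<noteq> 0" "P * P = P" "N * P = 0" "S * N = d *m (1 - P)"
proof -
  obtain P S d where *: "d \<noteq> 0" "P * P = P" "\<forall>i k. ent (N * P) i k = 0" "S * N = d *m (1 - P)"
    using kernel_splits_rows[of UNIV N] by auto
  have "N * P = 0"
    using *(3) by (auto intro: sqmat_eqI)
  with * show ?thesis
    using that by blast
qed

section \<open>Grading elements of nilpotent matrices\<close>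

definition unital_hom :: "('a::comm_ring_1 \<Rightarrow> 'b::comm_ring_1) \<Rightarrow> bool" where
  "unital_hom \<iota> \<longleftrightarrow> \<iota> 1 = 1 \<and> (\<forall>x y. \<iota> (x + y) = \<iota> x + \<iota> y) \<and> (\<forall>x y. \<iota> (x * y) = \<iota> x * \<iota> y)"

lemma unital_hom_0: "unital_hom \<iota> \<Longrightarrow> \<iota> 0 = 0"
  unfolding unital_hom_def by (metis add_cancel_right_left add_0)

lemma mmap_hom:
  fixes \<iota> :: "'a::comm_ring_1 \<Rightarrow> 'b::comm_ring_1" and x y :: "('a, 'n::finite) sqmat"
  assumes "unital_hom \<iota>"
  shows "mmap \<iota> (x + y) = mmap \<iota> x + mmap \<iota> y" "mmap \<iota> (x - y) = mmap \<iota> x - mmap \<iota> y"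
    "mmap \<iota> (x * y) = mmap \<iota> x * mmap \<iota> y" "mmap \<iota> 1 = 1" "mmap \<iota> 0 = 0"
    "mmap \<iota> (c *m x) = \<iota> c *m mmap \<iota> x" "\<iota> (tr x) = tr (mmap \<iota> x)"
proof -
  have hom: "\<iota> 1 = 1" "\<iota> (x + y) = \<iota> x + \<iota> y" "\<iota> (x * y) = \<iota> x * \<iota> y" for x y
    using assms by (auto simp: unital_hom_def)
  have 0: "\<iota> 0 = 0"
    using hom(2)[of 0 0] by simp
  have sum: "\<iota> (\<Sum>k\<in>A. f k) = (\<Sum>k\<in>A. \<iota> (f k))" for A and f :: "'n \<Rightarrow> 'a"
    by (induction A rule: infinite_finite_induct) (simp_all add: hom 0)
  have diff: "\<iota> (x - y) = \<iota> x - \<iota> y" for x y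
    by (metis hom(2) add_diff_cancel_right' diff_add_cancel)
  show "mmap \<iota> (x + y) = mmap \<iota> x + mmap \<iota> y" "mmap \<iota> (x - y) = mmap \<iota> x - mmap \<iota> y"
    "mmap \<iota> (x * y) = mmap \<iota> x * mmap \<iota> y" "mmap \<iota> 1 = 1" "mmap \<iota> 0 = 0"
    "mmap \<iota> (c *m x) = \<iota> c *m mmap \<iota> x" "\<iota> (tr x) = tr (mmap \<iota> x)"
    by (auto intro!: sqmat_eqI simp: hom 0 ent_mult sum diff ent_1 tr_def)
qed

lemma mmap_derivation:
  fixes D :: "'a::comm_ring_1 \<Rightarrow> 'a" and x y :: "('a, 'n::finite) sqmat"
  assumes "\<And>x y. D (x + y) = D x + D y" "\<And>x y. D (x * y) = D x * y + x * D y"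
  shows "mmap D (x + y) = mmap D x + mmap D y" "mmap D (x - y) = mmap D x - mmap D y"
    "mmap D (x * y) = mmap D x * y + x * mmap D y" "mmap D 1 = 0" "mmap D 0 = 0"
    "D (tr x) = tr (mmap D x)"
proof -
  have 0: "D 0 = 0"
    using assms(1)[of 0 0] by simp
  have 1: "D 1 = 0"
    using assms(2)[of 1 1] by simp
  have sum: "D (\<Sum>k\<in>A. f k) = (\<Sum>k\<in>A. D (f k))" for A and f :: "'n \<Rightarrow> 'a"
    by (induction A rule: infinite_finite_induct) (simp_all add: assms 0)
  have diff: "D (x - y) = D x - D y" for x y
    by (metis assms(1) add_diff_cancel_right' diff_add_cancel)
  show "mmap D (x + y) = mmap D x + mmap D y" "mmap D (x - y) = mmap D x - mmap D y"
    "mmap D (x * y) = mmap D x * y + x * mmap D y" "mmap D 1 = 0" "mmap D 0 = 0"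
    "D (tr x) = tr (mmap D x)"
    by (auto intro!: sqmat_eqI simp: assms ent_mult sum diff ent_1 tr_def 0 1 sum.distrib)
qed

text \<open>Replace \<open>N\<close> by the map that it induces on the quotient by its kernel.\<close>

lemma nilpotent_reduction:
  fixes N :: "('a::idom, 'n::finite) sqmat"
  assumes "d \<noteq> 0" "P * P = P" "N * P = 0" "S * N = d *m (1 - P)" "N ^ Suc (Suc m) = 0"
  shows "((1 - P) * N) ^ Suc m = 0"
proof -
  have NQ: "N * (1 - P) = N"
    using assms(3) by (simp add: right_diff_distrib)
  have pow: "((1 - P) * N) ^ Suc k = (1 - P) * N ^ Suc k" for k
  proof (induction k)
    case (Suc k)
    have "((1 - P) * N) ^ Suc (Suc k) = (1 - P) * (N * (1 - P)) * N ^ Suc k"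
      by (subst power_Suc, subst Suc.IH) (simp only: mult.assoc)
    then show ?case
      by (simp only: NQ power_Suc mult.assoc)
  qed simp
  have "d *m ((1 - P) * N ^ Suc m) = S * N ^ Suc (Suc m)"
    by (simp add: assms(4) flip: mult.assoc)
  then have "(1 - P) * N ^ Suc m = 0"
    using assms(1,5) by (simp add: scale_eq_0)
  then show ?thesis
    by (simp only: pow)
qed

text \<open>By induction on the nilpotency index, with denominators cleared: a solution \<open>K\<close> for the induced map on the quotient by the kernel lifts, since the component
  of \<open>H\<close> in the kernel can be prescribed on the image of \<open>N\<close>, where \<open>N\<close> has a partial left
  inverse.\<close>

lemma grading_element_exists:
  fixes N :: "('a::euclidean_ring, 'n::finite) sqmat"
  assumes "N ^ m = 0"
  shows "\<exists>H d. d \<noteq> 0 \<and> comm H N = d *m N"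
  using assms
proof (induction m arbitrary: N)
  case 0
  then show ?case by simp
next
  case (Suc m)
  show ?case
  proof (cases m)
    case 0
    then show ?thesis
      using Suc.prems by (intro exI[of _ 0] exI[of _ 1]) (simp add: comm_def)
  next
    case [simp]: (Suc m')
    obtain P S e where e: "e \<noteq> 0" and PP: "P * P = P" and NP: "N * P = 0"
      and SN: "S * N = e *m (1 - P)"
      by (rule kernel_splits[of N])
    define Q where "Q = 1 - P"
    have QQ: "Q * Q = Q" and NQ: "N * Q = N"
      by (simp_all add: Q_def algebra_simps PP NP)
    have "(Q * N) ^ m = 0"
      using nilpotent_reduction[OF e PP NP SN, of m'] Suc.prems by (simp add: Q_def)
    then obtain H d where d: "d \<noteq> 0" and H: "comm H (Q * N) = d *m (Q * N)"
      using Suc.IH by blast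
    define K where "K = Q * H * Q"
    have K: "K * N - Q * (N * K) = d *m (Q * N)"
    proof -
      have "Q * (H * (Q * N) - Q * N * H) * Q = Q * (d *m (Q * N)) * Q"
        using H by (simp add: comm_def)
      then show ?thesis
        by (simp add: K_def algebra_simps NQ QQ) (metis NQ QQ mult.assoc)
    qed
    have KQ: "K * Q = K" and QK: "Q * K = K"
      by (simp_all add: K_def QQ mult.assoc) (simp add: QQ flip: mult.assoc)
    \<comment> \<open>On the kernel, the new element is prescribed by its composition with \<open>N\<close>.\<close>
    define G where "G = e *m K + P * ((d *m N + N * K) * S)"
    have NG: "N * G = e *m (N * K)"
    proof -
      have "N * G = e *m (N * K) + (N * P) * ((d *m N + N * K) * S)"
        by (simp only: G_def distrib_left scale_simps mult.assoc)
      then show ?thesis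
        by (simp add: NP)
    qed
    have "G * N = e *m (K * N) + P * ((d *m N + N * K) * (S * N))"
      by (simp only: G_def distrib_right[of _ _ N] scale_simps mult.assoc)
    also have "\<dots> = e *m (K * N) + e *m (P * ((d *m N + N * K) * Q))"
      by (simp add: SN Q_def[symmetric] mult.assoc)
    also have "\<dots> = e *m (K * N) + e *m (P * (d *m N + N * K))"
      by (simp add: distrib_right mult.assoc NQ KQ)
    also have "\<dots> = e *m (K * N + P * (d *m N + N * K))"
      by (simp only: scale_distrib)
    also have "K * N + P * (d *m N + N * K) = d *m N + N * K"
    proof -
      have "K * N = Q * (d *m N + N * K)"
        using K by (simp add: algebra_simps scale_distrib)
      then show ?thesis
        by (simp add: Q_def left_diff_distrib)
    qed
    finally have "comm G N = (e * d) *m N"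
      by (simp add: comm_def NG scale_distrib)
    then show ?thesis
      using e d by (intro exI[of _ G] exI[of _ "e * d"]) simp
  qed
qed

text \<open>The absence of poles. Here \<open>H\<close> lives over the target of \<open>\<iota>\<close> and depends on \<open>\<iota>\<close> in an
  arbitrary way, but \<open>tr (H N')\<close> is the value of one fixed element \<open>\<tau>\<close> of the ring over which \<open>N\<close> is
  defined. The factor \<open>c\<close> allows for denominators in \<open>H\<close>, and the points where the kernel of
  \<open>\<iota> N\<close> jumps are removed by \<open>\<iota> e \<noteq> 0\<close>.\<close>

lemma trace_grading_derivation:
  fixes N :: "('a::euclidean_ring, 'n::finite) sqmat" and D :: "'a \<Rightarrow> 'a"
  assumes "N ^ m = 0"
    and D: "\<And>x y. D (x + y) = D x + D y" "\<And>x y. D (x * y) = D x * y + x * D y"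
  shows "\<exists>\<tau> e. e \<noteq> 0 \<and> (\<forall>(\<iota> :: 'a \<Rightarrow> 'b::idom) H c.
     unital_hom \<iota> \<and> \<iota> e \<noteq> 0 \<and> comm H (mmap \<iota> N) = c *m mmap \<iota> N \<longrightarrow> tr (H * mmap \<iota> (mmap D N)) = c * \<iota> \<tau>)"
  using assms(1)
proof (induction m arbitrary: N)
  case 0
  then show ?case by simp
next
  case (Suc m)
  show ?case
  proof (cases m)
    case 0
    have "mmap D 0 = (0 :: ('a, 'n) sqmat)"
      by (rule mmap_derivation[OF D])
    moreover have "mmap \<iota> 0 = (0 :: ('b, 'n) sqmat)" if "unital_hom \<iota>" for \<iota> :: "'a \<Rightarrow> 'b"
      by (rule mmap_hom[OF that])
    ultimately show ?thesis
      using Suc.prems 0 by (rule_tac exI[where x = 0], rule_tac exI[where x = 1]) (auto simp: unital_hom_0)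
  next
    case [simp]: (Suc m')
    obtain P S d where d: "d \<noteq> 0" and PP: "P * P = P" and NP: "N * P = 0"
      and SN: "S * N = d *m (1 - P)"
      by (rule kernel_splits[of N])
    define Q where "Q = 1 - P"
    have QQ: "Q * Q = Q" and NQ: "N * Q = N"
      by (simp_all add: Q_def algebra_simps PP NP)
    have QNm: "(Q * N) ^ m = 0"
      using nilpotent_reduction[OF d PP NP SN, of m'] Suc.prems by (simp add: Q_def)
    obtain \<tau> e where e: "e \<noteq> 0" and \<tau>: "\<forall>(\<iota> :: 'a \<Rightarrow> 'b) H c.
        unital_hom \<iota> \<and> \<iota> e \<noteq> 0 \<and> comm H (mmap \<iota> (Q * N)) = c *m mmap \<iota> (Q * N)
        \<longrightarrow> tr (H * mmap \<iota> (mmap D (Q * N))) = c * \<iota> \<tau>"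
      using Suc.IH[OF QNm] by (elim exE conjE) (rule that)
    note mD = mmap_derivation[OF D]
    define N' where "N' = mmap D N"
    define Q' where "Q' = mmap D Q"
    have "mmap D P = - Q'"
      by (simp add: Q'_def Q_def mD)
    then have N'P: "N' * P = N * Q'"
      using mD(3)[of N P] by (simp add: NP mD N'_def)
    have QN': "mmap D (Q * N) = Q' * N + Q * N'"
      by (simp add: mD N'_def Q'_def)
    show ?thesis
    proof (rule exI[of _ "\<tau> + tr (N * Q')"], rule exI[of _ "d * e"], intro conjI allI impI; (elim conjE)?)
      show "d * e \<noteq> 0"
        using d e by simp
      fix \<iota> :: "'a \<Rightarrow> 'b" and H c
      assume \<iota>: "unital_hom \<iota>"
        and nz: "\<iota> (d * e) \<noteq> 0" and H: "comm H (mmap \<iota> N) = c *m mmap \<iota> N"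
      have m: "mmap \<iota> (x + y) = mmap \<iota> x + mmap \<iota> y" "mmap \<iota> (x - y) = mmap \<iota> x - mmap \<iota> y"
        "mmap \<iota> (x * y) = mmap \<iota> x * mmap \<iota> y" "mmap \<iota> 1 = 1" "mmap \<iota> 0 = 0"
        "mmap \<iota> (f *m x) = \<iota> f *m mmap \<iota> x" "\<iota> (tr x) = tr (mmap \<iota> x)" for x y :: "('a, 'n) sqmat" and f
        by (rule mmap_hom[OF \<iota>])+
      define p q n n' q' where "p = mmap \<iota> P" and "q = mmap \<iota> Q" and "n = mmap \<iota> N"
        and "n' = mmap \<iota> N'" and "q' = mmap \<iota> Q'"
      have np: "n * p = 0"
        using arg_cong[OF NP, of "mmap \<iota>"] by (simp add: m n_def p_def)
      have nq: "n * q = n"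
        using arg_cong[OF NQ, of "mmap \<iota>"] by (simp add: m n_def q_def)
      have n'p: "n' * p = n * q'"
        using arg_cong[OF N'P, of "mmap \<iota>"] by (simp add: m n_def n'_def p_def q'_def)
      have p: "p = 1 - q"
        by (simp add: p_def q_def Q_def m)
      have sn: "mmap \<iota> S * n = \<iota> d *m q"
        using arg_cong[OF SN[folded Q_def], of "mmap \<iota>"] by (simp add: m n_def q_def)
      have Hn: "H * n - n * H = c *m n"
        using H by (simp add: comm_def n_def)
      \<comment> \<open>\<open>H\<close> preserves the kernel of \<open>N\<close>.\<close>
      have "n * (H * p) = (H * n - c *m n) * p"
        by (simp add: mult.assoc flip: Hn)
      also have "\<dots> = 0"
        by (simp add: left_diff_distrib np mult.assoc)
      finally have "mmap \<iota> S * n * (H * p) = 0"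
        by (simp add: mult.assoc)
      then have "(\<iota> d) *m (q * (H * p)) = 0"
        by (simp add: sn mult.assoc)
      moreover have "\<iota> d \<noteq> 0" "\<iota> e \<noteq> 0"
        using nz \<iota> by (auto simp: unital_hom_def)
      ultimately have qHp: "q * (H * p) = 0"
        by (simp add: scale_eq_0)
      have "q * H = q * H * q + q * (H * p)"
        by (simp add: p right_diff_distrib mult.assoc)
      then have qHq: "q * H * q = q * H"
        by (simp add: qHp)
      have "q * H * (q * n) - q * n * (q * H) = q * (H * n - n * H)"
        by (simp add: right_diff_distrib qHq nq flip: mult.assoc) (simp add: nq mult.assoc)
      then have "comm (q * H) (mmap \<iota> (Q * N)) = c *m mmap \<iota> (Q * N)"
        by (simp add: comm_def m Hn n_def[symmetric] q_def[symmetric])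
      then have "tr (q * H * mmap \<iota> (mmap D (Q * N))) = c * \<iota> \<tau>"
        using \<tau> \<iota> \<open>\<iota> e \<noteq> 0\<close> by blast
      then have "c * \<iota> \<tau> = tr (q * H * (q' * n)) + tr (q * H * (q * n'))"
        by (simp add: QN' m q'_def[symmetric] n_def[symmetric] q_def[symmetric] n'_def[symmetric] distrib_left)
      also have "tr (q * H * (q' * n)) = tr (n * q * H * q')"
        by (metis mult.assoc tr_commute)
      also have "n * q = n"
        by (rule nq)
      also have "tr (q * H * (q * n')) = tr (q * H * n')"
        by (simp add: qHq flip: mult.assoc)
      also have "\<dots> = tr (H * n') - tr (p * (H * n'))"
        by (simp add: p left_diff_distrib mult.assoc)
      also have "tr (p * (H * n')) = tr (H * n * q')"
        by (metis mult.assoc n'p tr_commute)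
      finally have "tr (H * n') = c * \<iota> \<tau> + tr ((H * n - n * H) * q')"
        by (simp add: left_diff_distrib)
      also have "tr ((H * n - n * H) * q') = c * tr (n * q')"
        by (simp add: Hn)
      also have "c * \<iota> \<tau> + c * tr (n * q') = c * \<iota> (\<tau> + tr (N * Q'))"
        using \<iota> by (simp add: m n_def q'_def distrib_left unital_hom_def)
      finally show "tr (H * mmap \<iota> (mmap D N)) = c * \<iota> (\<tau> + tr (N * Q'))"
        by (simp add: n'_def N'_def)
    qed
  qed
qed

section \<open>Pencils of nilpotent matrices\<close>

lemma poly_eq_on_cofinite:
  fixes p q :: "'a::field_char_0 poly"
  assumes "finite E" "\<And>x. x \<notin> E \<Longrightarrow> poly p x = poly q x"
  shows "p = q"
proof (rule ccontr)
  assume "p \<noteq> q"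
  then have "finite {x. poly (p - q) x = 0}"
    by (intro poly_roots_finite) simp
  moreover have "UNIV \<subseteq> E \<union> {x. poly (p - q) x = 0}"
    using assms(2) by auto
  ultimately have "finite (UNIV :: 'a set)"
    using assms(1) by (meson finite_UnI finite_subset)
  then show False
    by (simp add: infinite_UNIV_char_0)
qed

text \<open>The sections of a line bundle on the projective line: \<open>p\<close> and \<open>q\<close> are the two local
  expressions, and \<open>t ^ (j - i)\<close> is the transition function of \<open>\<O>(j - i)\<close>.\<close>

lemma degree_le_of_pole_order_at_infinity:
  fixes p q :: "'a::field_char_0 poly"
  assumes "finite E" "\<And>x. x \<notin> E \<Longrightarrow> x ^ i * poly p x = x ^ j * poly q (inverse x)" "p \<noteq> 0"
  shows "i + degree p \<le> j"
proof -
  define m where "m = degree q"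
  have "monom 1 (i + m) * p = monom 1 j * reflect_poly q"
  proof (rule poly_eq_on_cofinite)
    show "finite (insert 0 E)"
      using assms(1) by simp
    fix x assume "x \<notin> insert 0 E"
    then show "poly (monom 1 (i + m) * p) x = poly (monom 1 j * reflect_poly q) x"
      using assms(2)[of x]
      by (simp add: poly_monom poly_reflect_poly_nz m_def power_add mult_ac)
  qed
  then have "degree (monom 1 (i + m) * p) = degree (monom 1 j * reflect_poly q)"
    by simp
  also have "\<dots> \<le> j + m"
    by (metis add_mono degree_monom_le degree_mult_le degree_reflect_poly_le le_trans m_def)
  also have "degree (monom 1 (i + m) * p) = i + m + degree p"
    using assms(3) by (simp add: degree_mult_eq degree_monom_eq)
  finally show ?thesis
    by simp
qed

lemma pderiv_mult': "pderiv (p * q) = pderiv p * q + p * pderiv q"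
  by (simp add: pderiv_mult mult.commute add.commute)

lemma map_poly_derivation:
  fixes D :: "'a::comm_ring_1 \<Rightarrow> 'a"
  assumes D: "\<And>x y. D (x + y) = D x + D y" "\<And>x y. D (x * y) = D x * y + x * D y"
  shows "map_poly D (p + q) = map_poly D p + map_poly D q"
    "map_poly D (p * q) = map_poly D p * q + p * map_poly D q"
proof -
  have 0: "D 0 = 0"
    using D(1)[of 0 0] by simp
  have sum: "D (\<Sum>k\<in>A. f k) = (\<Sum>k\<in>A. D (f k))" for A and f :: "nat \<Rightarrow> 'a"
    by (induction A rule: infinite_finite_induct) (simp_all add: D 0)
  show "map_poly D (p + q) = map_poly D p + map_poly D q"
    by (rule poly_eqI) (simp add: coeff_map_poly 0 D)
  show "map_poly D (p * q) = map_poly D p * q + p * map_poly D q"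
    by (rule poly_eqI) (simp add: coeff_map_poly 0 D coeff_mult sum sum.distrib)
qed

definition cmat :: "('a::comm_ring_1, 'n) sqmat \<Rightarrow> ('a poly, 'n) sqmat" where
  "cmat = mmap (\<lambda>c. [:c:])"

definition pencil :: "('a::comm_ring_1, 'n::finite) sqmat \<Rightarrow> ('a, 'n) sqmat \<Rightarrow> ('a poly, 'n) sqmat" where
  "pencil X Y = mmap (\<lambda>c. [:c:]) X + [:0, 1:] *m mmap (\<lambda>c. [:c:]) Y"

lemma ent_pencil: "ent (pencil X Y) i j = [:ent X i j, ent Y i j:]"
  for X :: "('a::comm_ring_1, 'n::finite) sqmat"
  by (simp add: pencil_def)

lemma unital_hom_const: "unital_hom (\<lambda>c. [:c:])"
  by (simp add: unital_hom_def)

lemma unital_hom_eval: "unital_hom (\<lambda>p. poly p x)"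
  by (simp add: unital_hom_def)

lemmas const_hom = mmap_hom[OF unital_hom_const, folded cmat_def]
lemmas eval_hom = mmap_hom[OF unital_hom_eval]

lemma comm_simps:
  "comm (x + y) z = comm x z + comm y z" "comm z (x + y) = comm z x + comm z y"
  "comm (x - y) z = comm x z - comm y z" "comm z (x - y) = comm z x - comm z y"
  "comm (c *m x) z = c *m comm x z" "comm z (c *m x) = c *m comm z x"
  for x y z :: "('a::comm_ring_1, 'n::finite) sqmat"
  by (simp_all add: comm_def algebra_simps scale_distrib)

lemma mmap_comm: "unital_hom \<iota> \<Longrightarrow> mmap \<iota> (comm x y) = comm (mmap \<iota> x) (mmap \<iota> y)"
  for x y :: "('a::comm_ring_1, 'n::finite) sqmat" and \<iota> :: "'a \<Rightarrow> 'b::comm_ring_1"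
  by (simp add: comm_def mmap_hom)

lemma eval_const [simp]: "mmap (\<lambda>p. poly p x) (cmat X) = X"
  by (rule sqmat_eqI) (simp add: cmat_def)

lemma eval_pencil: "mmap (\<lambda>p. poly p x) (pencil X Y) = X + x *m Y"
  for X :: "('a::comm_ring_1, 'n::finite) sqmat"
  by (rule sqmat_eqI) (simp add: ent_pencil)

lemma leading_terms_vanish:
  fixes \<delta> r :: "'a::field poly"
  assumes "\<delta> * [:a, b:] = [:0, 0, 1:] * r" "coeff \<delta> 0 \<noteq> 0"
  shows "a = 0" "b = 0"
proof -
  have "coeff (\<delta> * [:a, b:]) 0 = 0"
    unfolding assms(1) by simp
  then show a: "a = 0"
    using assms(2) by (simp add: coeff_mult)
  have "coeff (\<delta> * [:a, b:]) 1 = 0"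
    unfolding assms(1) by simp
  then show "b = 0"
    using assms(2) a by (simp add: coeff_mult)
qed

lemma trace_grading_eval:
  fixes N :: "('a::field poly, 'n::finite) sqmat" and D :: "'a poly \<Rightarrow> 'a poly"
  assumes "N ^ m = 0"
    and D: "\<And>x y. D (x + y) = D x + D y" "\<And>x y. D (x * y) = D x * y + x * D y"
  shows "\<exists>\<tau> E. finite E \<and> (\<forall>x G c. x \<notin> E \<longrightarrow> comm G (mmap (\<lambda>p. poly p x) N) = c *m mmap (\<lambda>p. poly p x) N
      \<longrightarrow> tr (G * mmap (\<lambda>p. poly p x) (mmap D N)) = c * poly \<tau> x)"
proof -
  obtain \<tau> e where e: "e \<noteq> 0" and \<tau>: "\<forall>(\<iota> :: 'a poly \<Rightarrow> 'a) H c.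
     unital_hom \<iota> \<and> \<iota> e \<noteq> 0 \<and> comm H (mmap \<iota> N) = c *m mmap \<iota> N \<longrightarrow> tr (H * mmap \<iota> (mmap D N)) = c * \<iota> \<tau>"
    using trace_grading_derivation[OF assms(1) D] by (elim exE conjE) (rule that)
  show ?thesis
    by (rule exI[of _ \<tau>], rule exI[of _ "{x. poly e x = 0}"])
      (use e \<tau> unital_hom_eval in \<open>auto simp: poly_roots_finite\<close>)
qed

text \<open>The symplectic form \<open>tr ([A, B] Y)\<close> on the tangent space of the orbit of \<open>Y\<close> is the
  antisymmetrization of the bilinear form \<open>tr ([A, H] [B, Y])\<close>, which depends on the choice of \<open>H\<close>.\<close>

lemma grading_jacobi:
  fixes A B H Y :: "('a::comm_ring_1, 'n::finite) sqmat"
  assumes "comm H Y = Y"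
  shows "tr (comm A H * comm B Y) - tr (comm B H * comm A Y) = tr (comm A B * Y)"
proof -
  have "comm (comm A H) B - comm (comm B H) A = comm (comm A B) H"
    by (simp add: comm_def algebra_simps)
  then have "tr (comm (comm A B) H * Y) = tr (comm (comm A H) B * Y) - tr (comm (comm B H) A * Y)"
    by (metis left_diff_distrib tr_simps(3))
  then show ?thesis
    unfolding tr_comm[of "comm A B"] assms by (simp only: tr_comm)
qed

text \<open>The algebraic core. The matrix \<open>A\<close> depends on a parameter, differentiated by \<open>D\<close>, and the
  line at parameter \<open>s\<close> joins \<open>Y\<close> to \<open>F = [A, Y]\<close>. The operator \<open>\<beta>\<close> is a generalized inverse of
  \<open>[-, N]\<close> near \<open>t = 0\<close>, which turns a solution of a linear equation with poles at \<open>t = 0\<close> into one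
  without.

  Since \<open>F\<close> is tangent to the orbit of \<open>Y\<close>, the matrix \<open>H0 + t [A, H0]\<close> satisfies the equation
  \<open>[H, N] = N\<close> up to \<open>t\<^sup>2\<close>, and \<open>\<beta>\<close> corrects it to an exact solution \<open>G\<close>. The vanishing of the contact form in the
  directions \<open>t\<close> and \<open>s\<close> then gives, in degree one, \<open>tr ([A, H0] [A, Y]) = 0\<close> and
  \<open>tr ([A, H0] [A', Y]) = 0\<close>. Hence both terms of the derivative of the first
  vanish, and their difference is \<open>tr ([A, A'] Y)\<close>.\<close>

theorem isotropic_pencil_derivative:
  fixes Y A H0 :: "('a::field_char_0, 'n::finite) sqmat" and D :: "'a \<Rightarrow> 'a"
    and \<beta> :: "('a poly, 'n) sqmat \<Rightarrow> ('a poly, 'n) sqmat"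
  defines "F \<equiv> comm A Y"
  assumes D: "\<And>x y. D (x + y) = D x + D y" "\<And>x y. D (x * y) = D x * y + x * D y"
    and DY: "mmap D Y = 0" and DH0: "mmap D H0 = 0" and H0: "comm H0 Y = Y"
    and nil: "pencil Y F ^ m = 0" "pencil F Y ^ m = 0"
    and \<beta>: "\<And>c X. \<beta> (c *m X) = c *m \<beta> X"
      "\<And>X. comm (\<beta> (comm X (pencil Y F))) (pencil Y F) = \<delta> *m comm X (pencil Y F)"
    and \<delta>: "coeff \<delta> 0 \<noteq> 0"
  shows "tr (A * Y) = 0" "tr (comm A (mmap D A) * Y) = 0"
proof -
  let ?ev = "\<lambda>x. mmap (\<lambda>p. poly p x)"
  define N where "N = pencil Y F"
  define N' where "N' = pencil F Y"
  define A' where "A' = mmap D A"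
  define F' where "F' = mmap D F"
  have D0: "D 0 = 0"
    using D(1)[of 0 0] by simp
  note Dm = mmap_derivation[OF D]
  have F': "F' = comm A' Y"
    by (simp add: F'_def F_def comm_def Dm DY A'_def)
  note Dp = map_poly_derivation[OF D]
  have evN: "?ev x N = Y + x *m F" and evN': "?ev x N' = F + x *m Y" for x
    by (simp_all add: N_def N'_def eval_pencil)
  have N'_N: "?ev (inverse x) N' = inverse x *m ?ev x N" if "x \<noteq> 0" for x
    using that by (simp add: evN evN' scale_distrib)
  have dN: "mmap pderiv N = cmat F" "mmap pderiv N' = cmat Y"
    by (auto intro!: sqmat_eqI simp: N_def N'_def ent_pencil cmat_def pderiv_pCons)
  have map_D: "map_poly D [:a, b:] = [:D a, D b:]" for a b
    by (rule poly_eqI) (auto simp: coeff_map_poly D0 coeff_pCons split: nat.splits)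
  have DN: "mmap (map_poly D) N = [:0, 1:] *m cmat F'" "mmap (map_poly D) N' = cmat F'"
  proof -
    have "D (ent Y i j) = 0" for i j
      using DY by (metis ent_mmap ent_simps(1))
    then show "mmap (map_poly D) N = [:0, 1:] *m cmat F'" "mmap (map_poly D) N' = cmat F'"
      by (auto intro!: sqmat_eqI simp: N_def N'_def ent_pencil cmat_def map_D F'_def)
  qed
  have evX: "?ev x ([:0, 1:] *m cmat X) = x *m X" for x and X :: "('a, 'n) sqmat"
    by (simp add: eval_hom)
  obtain H d where d: "d \<noteq> 0" and H: "comm H N = d *m N"
    using grading_element_exists[OF nil(1)] by (auto simp: N_def)
  have evH: "comm (?ev x H) (?ev x N) = poly d x *m ?ev x N" for x
    using arg_cong[OF H, of "?ev x"] by (simp add: mmap_comm unital_hom_eval eval_hom)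
  have evH': "comm (?ev x H) (?ev (inverse x) N') = poly d x *m ?ev (inverse x) N'" if "x \<noteq> 0" for x
    using that by (simp add: N'_N comm_simps evH mult.commute)
  have trHN: "tr (?ev x H * ?ev x N) = 0" if "poly d x \<noteq> 0" for x
  proof -
    have "poly d x * tr (?ev x H * ?ev x N) = tr (?ev x H * comm (?ev x H) (?ev x N))"
      by (simp add: evH)
    also have "\<dots> = 0"
      unfolding tr_comm[symmetric] by (simp add: comm_def)
    finally show ?thesis
      using that by simp
  qed
  obtain \<tau> E where E: "finite E" and \<tau>: "\<forall>x G c. x \<notin> E \<longrightarrow> comm G (?ev x N) = c *m ?ev x N
      \<longrightarrow> tr (G * F) = c * poly \<tau> x"
    using trace_grading_eval[OF nil(1) pderiv_add pderiv_mult', folded N_def, unfolded dN eval_const] by (elim exE conjE) (rule that)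
  obtain \<tau>' E' where E': "finite E'" and \<tau>': "\<forall>x G c. x \<notin> E' \<longrightarrow> comm G (?ev x N') = c *m ?ev x N'
      \<longrightarrow> tr (G * Y) = c * poly \<tau>' x"
    using trace_grading_eval[OF nil(2) pderiv_add pderiv_mult', folded N'_def, unfolded dN eval_const] by (elim exE conjE) (rule that)
  obtain \<sigma> S where S: "finite S" and \<sigma>: "\<forall>x G c. x \<notin> S \<longrightarrow> comm G (?ev x N) = c *m ?ev x N
      \<longrightarrow> tr (G * (x *m F')) = c * poly \<sigma> x"
    using trace_grading_eval[OF nil(1) Dp, folded N_def, unfolded DN evX] by (elim exE conjE) (rule that)
  obtain \<sigma>' S' where S': "finite S'" and \<sigma>': "\<forall>x G c. x \<notin> S' \<longrightarrow> comm G (?ev x N') = c *m ?ev x N'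
      \<longrightarrow> tr (G * F') = c * poly \<sigma>' x"
    using trace_grading_eval[OF nil(2) Dp, folded N'_def, unfolded DN eval_const] by (elim exE conjE) (rule that)
  note \<tau> = \<tau>[rule_format] and \<tau>' = \<tau>'[rule_format] and \<sigma> = \<sigma>[rule_format] and \<sigma>' = \<sigma>'[rule_format]
  define X where "X = insert 0 (E \<union> S \<union> {x. poly d x = 0} \<union> inverse ` (E' \<union> S'))"
  have X: "finite X"
    using E E' S S' d by (simp add: X_def poly_roots_finite)
  have notX: "x \<noteq> 0" "x \<notin> E" "x \<notin> S" "poly d x \<noteq> 0" "inverse x \<notin> E'" "inverse x \<notin> S'" if "x \<notin> X" for x
    using that unfolding X_def by (auto simp: image_iff dest: bspec[where x = "inverse x"])
  \<comment> \<open>A section of \<open>\<O>(-1)\<close>, from the derivation in the direction of the line.\<close>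
  have "\<tau> = 0"
  proof (rule ccontr)
    assume "\<tau> \<noteq> 0"
    have "x ^ 1 * poly \<tau> x = x ^ 0 * poly (- \<tau>') (inverse x)" if "x \<notin> X" for x
    proof -
      note x = notX[OF that]
      have "tr (?ev x H * Y) + x * tr (?ev x H * F) = 0"
        using trHN[OF x(4)] by (simp add: evN distrib_left)
      then have "poly d x * (poly \<tau>' (inverse x) + x * poly \<tau> x) = 0"
        by (simp add: \<tau>[OF x(2) evH] \<tau>'[OF x(5) evH'[OF x(1)]] algebra_simps)
      then show ?thesis
        using x(4) by (simp add: eq_neg_iff_add_eq_0 add.commute)
    qed
    then have "1 + degree \<tau> \<le> 0"
      using degree_le_of_pole_order_at_infinity[OF X _ \<open>\<tau> \<noteq> 0\<close>, of 1 0] by blast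
    then show False by simp
  qed
  \<comment> \<open>A section of \<open>\<O>(1)\<close>, from the derivation in the parameter.\<close>
  have \<sigma>1: "degree \<sigma> \<le> 1"
  proof (cases "\<sigma> = 0")
    case False
    have "x ^ 0 * poly \<sigma> x = x ^ 1 * poly \<sigma>' (inverse x)" if "x \<notin> X" for x
    proof -
      note x = notX[OF that]
      have "x * tr (?ev x H * F') = poly d x * poly \<sigma> x"
        using \<sigma>[OF x(3) evH] by (simp only: scale_simps tr_simps)
      then have "poly d x * (poly \<sigma> x - x * poly \<sigma>' (inverse x)) = 0"
        by (simp only: \<sigma>'[OF x(6) evH'[OF x(1)]] right_diff_distrib mult.left_commute[of x]) simp
      then show ?thesis
        using x(4) by simp
    qed
    then have "0 + degree \<sigma> \<le> 1"
      using degree_le_of_pole_order_at_infinity[OF X _ False, of 0 1] by blast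
    then show ?thesis by simp
  qed simp
  define H1 where "H1 = comm A H0"
  define W where "W = cmat (comm H1 F)"
  define G where "G = \<delta> *m pencil H0 H1 - [:0, 0, 1:] *m \<beta> W"
  have W: "comm (pencil H0 H1) N - N = [:0, 0, 1:] *m W"
  proof -
    have "comm H1 Y + comm H0 F = comm A (comm H0 Y)"
      by (simp add: H1_def F_def comm_def algebra_simps)
    then have H1: "comm H1 Y = F - comm H0 F"
      by (simp add: H0 F_def algebra_simps)
    have "comm (pencil H0 H1) N = cmat (comm H0 Y) + [:0, 1:] *m cmat (comm H1 Y + comm H0 F)
        + [:0, 0, 1:] *m W"
      by (simp add: N_def pencil_def cmat_def[symmetric] comm_simps W_def const_hom scale_distrib mmap_comm[OF unital_hom_const, folded cmat_def])
    then show ?thesis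
      by (simp add: H0 H1 N_def pencil_def cmat_def[symmetric])
  qed
  have G: "comm G N = \<delta> *m N"
  proof -
    have "comm (d *m pencil H0 H1 - H) N = d *m (comm (pencil H0 H1) N - N)"
      by (simp add: comm_simps H scale_distrib)
    also have "\<dots> = (d * [:0, 0, 1:]) *m W"
      by (simp add: W)
    finally have "comm (\<beta> ((d * [:0, 0, 1:]) *m W)) N = \<delta> *m (d * [:0, 0, 1:]) *m W"
      using \<beta>(2)[of "d *m pencil H0 H1 - H", folded N_def] by metis
    then have dW: "(d * [:0, 0, 1:]) *m comm (\<beta> W) N = (d * [:0, 0, 1:]) *m \<delta> *m W"
      unfolding \<beta>(1) comm_simps by (simp only: scale_simps mult.commute[of \<delta>])
    have "d * [:0, 0, 1:] \<noteq> 0"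
      using d by simp
    then have "comm (\<beta> W) N = \<delta> *m W"
      using dW by (rule scale_cancel[THEN iffD1])
    then have "comm G N = \<delta> *m comm (pencil H0 H1) N - \<delta> *m [:0, 0, 1:] *m W"
      by (simp add: G_def comm_simps mult.commute)
    also have "\<dots> = \<delta> *m N"
      unfolding W[symmetric] by (simp only: scale_distrib diff_diff_eq2 add_diff_cancel_left')
    finally show ?thesis .
  qed
  have evG: "comm (?ev x G) (?ev x N) = poly \<delta> x *m ?ev x N" for x
    using arg_cong[OF G, of "?ev x"] by (simp add: mmap_comm unital_hom_eval eval_hom)
  have tr_pencil: "tr (pencil H0 H1 * cmat Z) = [:tr (H0 * Z), tr (H1 * Z):]" for Z
    by (simp add: pencil_def cmat_def[symmetric] distrib_right const_hom(7)[symmetric] const_hom(3)[symmetric])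
  have tr_ev: "poly (tr Z) x = tr (?ev x Z)" for x and Z :: "('a poly, 'n) sqmat"
    by (rule eval_hom(7))
  have trG: "tr (G * cmat Z) = \<delta> * [:tr (H0 * Z), tr (H1 * Z):] - [:0, 0, 1:] * tr (\<beta> W * cmat Z)" for Z
    by (simp only: G_def left_diff_distrib scale_simps tr_simps tr_pencil)
  have "tr (G * cmat F) = 0"
  proof (rule poly_eq_on_cofinite[OF E])
    fix x assume "x \<notin> E"
    then show "poly (tr (G * cmat F)) x = poly 0 x"
      by (simp add: tr_ev eval_hom \<tau>[OF _ evG] \<open>\<tau> = 0\<close>)
  qed
  then have "\<delta> * [:tr (H0 * F), tr (H1 * F):] = [:0, 0, 1:] * tr (\<beta> W * cmat F)"
    unfolding trG by (simp only: right_minus_eq)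
  note a = leading_terms_vanish[OF this \<delta>]
  have b0: "tr (H0 * F') = 0"
  proof -
    have "D (tr (H0 * F)) = tr (H0 * F')"
      by (simp add: Dm DH0 F'_def)
    then show ?thesis
      by (simp add: a D0)
  qed
  have X\<sigma>: "[:0, 1:] * tr (G * cmat F') = \<delta> * \<sigma>"
  proof (rule poly_eq_on_cofinite[OF S])
    fix x assume "x \<notin> S"
    then show "poly ([:0, 1:] * tr (G * cmat F')) x = poly (\<delta> * \<sigma>) x"
      using \<sigma>[OF _ evG, of x] by (simp add: tr_ev eval_hom)
  qed
  obtain s0 s1 where s: "\<sigma> = [:s0, s1:]"
  proof (rule that)
    show "\<sigma> = [:coeff \<sigma> 0, coeff \<sigma> 1:]"
      by (rule poly_eqI) (use \<sigma>1 in \<open>auto simp: coeff_pCons coeff_eq_0 split: nat.splits\<close>)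
  qed
  \<comment> \<open>The double zero at \<open>t = 0\<close>.\<close>
  have "\<delta> * [:s0, s1:] = [:0, 1:] * (\<delta> * [:0, tr (H1 * F'):] - [:0, 0, 1:] * tr (\<beta> W * cmat F'))"
    using X\<sigma> by (simp only: trG s b0)
  also have "\<dots> = [:0, 0, 1:] * (\<delta> * [:tr (H1 * F'):] - [:0, 1:] * tr (\<beta> W * cmat F'))"
    by (simp add: algebra_simps)
  finally have "s0 = 0" "s1 = 0"
    by (rule leading_terms_vanish[OF _ \<delta>])+
  then have "tr (G * cmat F') = 0"
    using X\<sigma> s by simp
  then have "\<delta> * [:tr (H0 * F'), tr (H1 * F'):] = [:0, 0, 1:] * tr (\<beta> W * cmat F')"
    unfolding trG by (simp only: right_minus_eq)
  note b = leading_terms_vanish[OF this \<delta>]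
  have "tr (H0 * F) = tr (comm H0 A * Y)"
    by (simp add: F_def tr_comm)
  also have "\<dots> = - tr (comm A H0 * Y)"
    by (simp add: comm_def left_diff_distrib)
  also have "\<dots> = - tr (A * Y)"
    by (simp add: tr_comm H0)
  finally show "tr (A * Y) = 0"
    using a by simp
  have "mmap D H1 = comm A' H0"
    by (simp add: H1_def comm_def Dm DH0 A'_def)
  then have "D (tr (H1 * F)) = tr (comm A' H0 * F) + tr (H1 * F')"
    by (simp add: Dm F'_def)
  then have c: "tr (comm A' H0 * F) = 0"
    using a b by (simp add: D0)
  have "tr (comm A A' * Y) = tr (H1 * F') - tr (comm A' H0 * F)"
    unfolding F' F_def H1_def by (rule grading_jacobi[OF H0, symmetric])
  then show "tr (comm A (mmap D A) * Y) = 0"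
    unfolding A'_def[symmetric] by (simp only: b c diff_zero)
qed

section \<open>Homogeneous polynomials and Laurent expansions\<close>

definition hpoly :: "nat \<Rightarrow> (complex^'n \<Rightarrow> complex) \<Rightarrow> bool" where
  "hpoly d p \<longleftrightarrow> (\<exists>c. p = (\<lambda>x.
     \<Sum>\<alpha> \<in> {\<alpha> :: 'n \<Rightarrow> nat. (\<Sum>i\<in>UNIV. \<alpha> i) = d}. c \<alpha> * (\<Prod>i\<in>UNIV. (x $ i) ^ \<alpha> i)))"

lemma homogeneous_poly_iff: "homogeneous_poly p \<longleftrightarrow> (\<exists>d. hpoly d p)"
  by (simp add: homogeneous_poly_def hpoly_def)

lemma finite_exponents: "finite {\<alpha> :: 'n::finite \<Rightarrow> nat. (\<Sum>i\<in>UNIV. \<alpha> i) = d}"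
proof (rule finite_subset)
  show "{\<alpha> :: 'n \<Rightarrow> nat. (\<Sum>i\<in>UNIV. \<alpha> i) = d} \<subseteq> Pi\<^sub>E UNIV (\<lambda>_. {..d})"
    by (auto simp: member_le_sum)
qed (simp add: finite_PiE)

lemma hpoly_add: "hpoly d p \<Longrightarrow> hpoly d q \<Longrightarrow> hpoly d (\<lambda>x. p x + q x)"
  unfolding hpoly_def
proof (elim exE)
  fix c c'
  assume "p = (\<lambda>x. \<Sum>\<alpha> | sum \<alpha> UNIV = d. c \<alpha> * (\<Prod>i\<in>UNIV. x $ i ^ \<alpha> i))"
    and "q = (\<lambda>x. \<Sum>\<alpha> | sum \<alpha> UNIV = d. c' \<alpha> * (\<Prod>i\<in>UNIV. x $ i ^ \<alpha> i))"
  then show "\<exists>c. (\<lambda>x. p x + q x) = (\<lambda>x. \<Sum>\<alpha> | sum \<alpha> UNIV = d. c \<alpha> * (\<Prod>i\<in>UNIV. x $ i ^ \<alpha> i))"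
    by (intro exI[of _ "\<lambda>\<alpha>. c \<alpha> + c' \<alpha>"]) (simp add: sum.distrib distrib_right)
qed

lemma hpoly_0: "hpoly d (\<lambda>x. 0)"
  unfolding hpoly_def by (rule exI[of _ "\<lambda>_. 0"]) simp

lemma hpoly_const: "hpoly 0 (\<lambda>x :: complex^'n. k)"
  unfolding hpoly_def
proof (rule exI[of _ "\<lambda>_. k"])
  have "{\<alpha> :: 'n \<Rightarrow> nat. sum \<alpha> UNIV = 0} = {\<lambda>_. 0}"
    by auto
  then show "(\<lambda>x :: complex^'n. k) = (\<lambda>x. \<Sum>\<alpha> | sum \<alpha> UNIV = 0. k * (\<Prod>i\<in>UNIV. x $ i ^ \<alpha> i))"
    by simp
qed

lemma hpoly_coord: "hpoly 1 (\<lambda>x :: complex^'n. x $ i)"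
  unfolding hpoly_def
proof (rule exI, rule ext)
  define \<delta> :: "'n \<Rightarrow> nat" where "\<delta> j = (if j = i then 1 else 0)" for j
  fix x :: "complex^'n"
  have "(\<Sum>\<alpha> | sum \<alpha> UNIV = 1. (if \<alpha> = \<delta> then 1 else 0) * (\<Prod>j\<in>UNIV. x $ j ^ \<alpha> j))
      = (\<Sum>\<alpha> | sum \<alpha> UNIV = 1. if \<alpha> = \<delta> then (\<Prod>j\<in>UNIV. x $ j ^ \<delta> j) else 0)"
    by (rule sum.cong) auto
  also have "\<dots> = (\<Prod>j\<in>UNIV. if j = i then x $ j else 1)"
    by (simp add: finite_exponents \<delta>_def if_distrib cong: if_cong)
  also have "\<dots> = x $ i"
    by simp
  finally show "x $ i = (\<Sum>\<alpha> | sum \<alpha> UNIV = 1. (if \<alpha> = \<delta> then 1 else 0) * (\<Prod>j\<in>UNIV. x $ j ^ \<alpha> j))"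
    by simp
qed

lemma hpoly_mult: "hpoly d (p :: complex^'n \<Rightarrow> complex) \<Longrightarrow> hpoly e q \<Longrightarrow> hpoly (d + e) (\<lambda>x. p x * q x)"
  unfolding hpoly_def
proof (elim exE)
  fix c c'
  let ?S = "\<lambda>d. {\<alpha> :: 'n \<Rightarrow> nat. sum \<alpha> UNIV = d}"
  let ?m = "\<lambda>x \<alpha>. \<Prod>i\<in>UNIV. (x :: complex^'n) $ i ^ \<alpha> i"
  let ?g = "\<lambda>(\<alpha>, \<beta>) i. \<alpha> i + \<beta> i :: nat"
  assume p: "p = (\<lambda>x. \<Sum>\<alpha>\<in>?S d. c \<alpha> * ?m x \<alpha>)" and q: "q = (\<lambda>x. \<Sum>\<alpha>\<in>?S e. c' \<alpha> * ?m x \<alpha>)"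
  define C where "C \<gamma> = (\<Sum>z\<in>{z\<in>?S d \<times> ?S e. ?g z = \<gamma>}. c (fst z) * c' (snd z))" for \<gamma>
  show "\<exists>c. (\<lambda>x. p x * q x) = (\<lambda>x. \<Sum>\<alpha>\<in>?S (d + e). c \<alpha> * ?m x \<alpha>)"
  proof (rule exI[of _ C], rule ext)
    fix x
    have "p x * q x = (\<Sum>z\<in>?S d \<times> ?S e. c (fst z) * c' (snd z) * ?m x (?g z))"
      unfolding p q sum_product sum.cartesian_product
      by (intro sum.cong refl) (auto simp: prod.distrib power_add)
    also have "\<dots> = (\<Sum>\<gamma>\<in>?S (d + e). \<Sum>z\<in>{z\<in>?S d \<times> ?S e. ?g z = \<gamma>}. c (fst z) * c' (snd z) * ?m x (?g z))"
      by (rule sum.group[symmetric]) (auto simp: finite_exponents sum.distrib)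
    also have "\<dots> = (\<Sum>\<gamma>\<in>?S (d + e). C \<gamma> * ?m x \<gamma>)"
      unfolding C_def sum_distrib_right by (intro sum.cong refl) auto
    finally show "p x * q x = (\<Sum>\<gamma>\<in>?S (d + e). C \<gamma> * ?m x \<gamma>)" .
  qed
qed

lemma hpoly_cmult: "hpoly d p \<Longrightarrow> hpoly d (\<lambda>x. k * p x)"
  using hpoly_mult[OF hpoly_const] by simp

lemma hpoly_diff: "hpoly d p \<Longrightarrow> hpoly d q \<Longrightarrow> hpoly d (\<lambda>x. p x - q x)"
  using hpoly_add[OF _ hpoly_cmult[of d q "-1"]] by simp

lemma hpoly_sum: "(\<And>a. a \<in> A \<Longrightarrow> hpoly d (f a)) \<Longrightarrow> hpoly d (\<lambda>x. \<Sum>a\<in>A. f a x)"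
  by (induction A rule: infinite_finite_induct) (auto simp: hpoly_0 hpoly_add)

lemma hpoly_prod: "(\<And>a. a \<in> A \<Longrightarrow> hpoly (d a) (f a)) \<Longrightarrow> hpoly (\<Sum>a\<in>A. d a) (\<lambda>x. \<Prod>a\<in>A. f a x)"
  by (induction A rule: infinite_finite_induct) (auto simp: hpoly_const intro!: hpoly_mult)

lemma hpoly_power: "hpoly d p \<Longrightarrow> hpoly (d * k) (\<lambda>x. p x ^ k)"
  by (induction k) (auto simp: hpoly_const intro!: hpoly_mult)

lemma hpoly_det:
  assumes "\<And>i j. hpoly 1 (\<lambda>x. M x $ i $ j)"
  shows "hpoly CARD('m) (\<lambda>x. det (M x :: complex^'m^'m))"
proof -
  have "hpoly (\<Sum>i\<in>(UNIV :: 'm set). 1) (\<lambda>x. \<Prod>i\<in>UNIV. M x $ i $ \<pi> i)" for \<pi>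
    by (intro hpoly_prod assms)
  then show ?thesis
    unfolding det_def by (intro hpoly_sum hpoly_cmult) simp
qed

lemma hpoly_linear:
  assumes "Vector_Spaces.linear (*s) (*s) L" "hpoly d p"
  shows "hpoly d (\<lambda>x :: complex^'n. p (L x :: complex^'m))"
proof -
  obtain c where c: "p = (\<lambda>x. \<Sum>\<alpha> | sum \<alpha> UNIV = d. c \<alpha> * (\<Prod>i\<in>UNIV. x $ i ^ \<alpha> i))"
    using assms(2) by (auto simp: hpoly_def)
  have L: "hpoly 1 (\<lambda>x. L x $ i)" for i
  proof -
    have "L x $ i = (\<Sum>j\<in>UNIV. matrix L $ i $ j * x $ j)" for x
      using matrix_works[OF assms(1), of x] by (simp add: matrix_vector_mult_def vec_eq_iff)
    then show ?thesis
      by (simp only:) (intro hpoly_sum hpoly_cmult hpoly_coord)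
  qed
  have "hpoly d (\<lambda>x. \<Prod>i\<in>UNIV. L x $ i ^ \<alpha> i)" if "sum \<alpha> UNIV = d" for \<alpha> :: "'m \<Rightarrow> nat"
    using hpoly_prod[of UNIV \<alpha> "\<lambda>i x. L x $ i ^ \<alpha> i"] hpoly_power[OF L] that by simp
  then show ?thesis
    unfolding c by (intro hpoly_sum hpoly_cmult) simp
qed

lemma hpoly_scale: "hpoly d p \<Longrightarrow> p (k *s x) = k ^ d * p x"
  unfolding hpoly_def
  by (auto simp: power_mult_distrib prod.distrib power_sum[symmetric] sum_distrib_left mult_ac intro!: sum.cong)

text \<open>For the cone over a projective set, these are the equations of its Zariski closure.\<close>

definition vanishing_on :: "(complex^'n) set \<Rightarrow> nat \<Rightarrow> (complex^'n \<Rightarrow> complex) \<Rightarrow> bool" where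
  "vanishing_on C d p \<longleftrightarrow> hpoly d p \<and> (\<forall>w\<in>C. p w = 0)"

text \<open>A family of polynomials in \<open>t\<close> whose coefficients are functions of \<open>s\<close> near \<open>s = 0\<close> is related to
  the polynomial over the field of Laurent series that it defines. The relation respects the ring
  operations, so that identities between numbers become identities over that field.\<close>

definition laurent_poly :: "(complex \<Rightarrow> complex poly) \<Rightarrow> complex fls poly \<Rightarrow> bool" where
  "laurent_poly G P \<longleftrightarrow> (\<forall>k. (\<lambda>s. coeff (G s) k) has_laurent_expansion coeff P k)"

lemma laurent_poly_add: "laurent_poly G P \<Longrightarrow> laurent_poly G' P' \<Longrightarrow> laurent_poly (\<lambda>s. G s + G' s) (P + P')"
  by (simp add: laurent_poly_def has_laurent_expansion_add)

lemma laurent_poly_diff: "laurent_poly G P \<Longrightarrow> laurent_poly G' P' \<Longrightarrow> laurent_poly (\<lambda>s. G s - G' s) (P - P')"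
  by (simp add: laurent_poly_def has_laurent_expansion_diff)

lemma laurent_poly_mult: "laurent_poly G P \<Longrightarrow> laurent_poly G' P' \<Longrightarrow> laurent_poly (\<lambda>s. G s * G' s) (P * P')"
  by (auto simp: laurent_poly_def coeff_mult intro!: has_laurent_expansion_sum has_laurent_expansion_mult)

lemma laurent_poly_pCons:
  assumes "f has_laurent_expansion F" "laurent_poly G P"
  shows "laurent_poly (\<lambda>s. pCons (f s) (G s)) (pCons F P)"
  unfolding laurent_poly_def
proof
  fix k show "(\<lambda>s. coeff (pCons (f s) (G s)) k) has_laurent_expansion coeff (pCons F P) k"
    using assms by (cases k) (auto simp: laurent_poly_def)
qed

lemma laurent_poly_0: "laurent_poly (\<lambda>s. 0) 0"
  by (simp add: laurent_poly_def)

lemma laurent_poly_const: "laurent_poly (\<lambda>s. [:k:]) [:fls_const k:]"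
  by (intro laurent_poly_pCons laurent_poly_0 has_laurent_expansion_const)

lemma laurent_poly_1: "laurent_poly (\<lambda>s. 1) 1"
  using laurent_poly_const[of 1] by (simp add: one_pCons)

lemma laurent_poly_sum:
  "(\<And>a. a \<in> A \<Longrightarrow> laurent_poly (G a) (P a)) \<Longrightarrow> laurent_poly (\<lambda>s. \<Sum>a\<in>A. G a s) (\<Sum>a\<in>A. P a)"
  by (induction A rule: infinite_finite_induct) (auto simp: laurent_poly_0 laurent_poly_add)

lemma laurent_poly_prod:
  "(\<And>a. a \<in> A \<Longrightarrow> laurent_poly (G a) (P a)) \<Longrightarrow> laurent_poly (\<lambda>s. \<Prod>a\<in>A. G a s) (\<Prod>a\<in>A. P a)"
  by (induction A rule: infinite_finite_induct) (auto simp: laurent_poly_1 laurent_poly_mult)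

lemma laurent_poly_power: "laurent_poly G P \<Longrightarrow> laurent_poly (\<lambda>s. G s ^ k) (P ^ k)"
  by (induction k) (auto simp: laurent_poly_1 laurent_poly_mult)

lemma laurent_poly_eq_0:
  assumes "laurent_poly G P" "eventually (\<lambda>s. \<forall>t. poly (G s) t = 0) (at 0)"
  shows "P = 0"
proof (rule poly_eqI)
  fix k
  have ev: "eventually (\<lambda>s. coeff (G s) k = 0) (at 0)"
    using assms(2) by eventually_elim (simp add: poly_all_0_iff_0)
  have "(\<lambda>s. coeff (G s) k) has_laurent_expansion coeff P k"
    using assms(1) by (simp add: laurent_poly_def)
  then have "(\<lambda>s. 0) has_laurent_expansion coeff P k"
    using has_laurent_expansion_cong[OF ev refl] by blast
  then show "coeff P k = coeff 0 k"
    by (simp add: zero_has_laurent_expansion_imp_eq_0)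
qed

lemma hpoly_laurent:
  fixes p :: "complex^'n \<Rightarrow> complex"
  assumes "hpoly d p" "\<And>i. laurent_poly (X i) (P i)"
  shows "\<exists>G Q. laurent_poly G Q \<and> (\<forall>s t. poly (G s) t = p (\<chi> i. poly (X i s) t))"
proof -
  obtain c where c: "p = (\<lambda>x. \<Sum>\<alpha> | sum \<alpha> UNIV = d. c \<alpha> * (\<Prod>i\<in>UNIV. x $ i ^ \<alpha> i))"
    using assms(1) by (auto simp: hpoly_def)
  have "laurent_poly (\<lambda>s. \<Sum>\<alpha> | sum \<alpha> UNIV = d. [:c \<alpha>:] * (\<Prod>i\<in>UNIV. X i s ^ \<alpha> i))
     (\<Sum>\<alpha> | sum \<alpha> UNIV = d. [:fls_const (c \<alpha>):] * (\<Prod>i\<in>UNIV. P i ^ \<alpha> i))"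
    by (intro laurent_poly_sum laurent_poly_mult laurent_poly_const laurent_poly_prod laurent_poly_power assms(2))
  moreover have "poly (\<Sum>\<alpha> | sum \<alpha> UNIV = d. [:c \<alpha>:] * (\<Prod>i\<in>UNIV. X i s ^ \<alpha> i)) t = p (\<chi> i. poly (X i s) t)" for s t
    by (simp add: c poly_sum poly_prod)
  ultimately show ?thesis
    by blast
qed

section \<open>Generalized inverses of matrices of constant rank\<close>

definition app :: "('a::comm_ring_1, 'm::finite) sqmat \<Rightarrow> ('m \<Rightarrow> 'a) \<Rightarrow> 'm \<Rightarrow> 'a" where
  "app x v i = (\<Sum>j\<in>UNIV. ent x i j * v j)"

lemma app_mult: "app (x * y) v = app x (app y v)"
proof
  fix i
  have "app (x * y) v i = (\<Sum>j\<in>UNIV. \<Sum>k\<in>UNIV. ent x i k * ent y k j * v j)"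
    by (simp add: app_def ent_mult sum_distrib_right)
  also have "\<dots> = app x (app y v) i"
    by (subst sum.swap) (simp add: app_def sum_distrib_left mult.assoc)
  finally show "app (x * y) v i = app x (app y v) i" .
qed

lemma app_scale: "app x (\<lambda>i. c * v i) = (\<lambda>i. c * app x v i)" "app (c *m x) v = (\<lambda>i. c * app x v i)"
  by (auto simp: app_def sum_distrib_left mult_ac)

definition flat :: "('a, 'n) sqmat \<Rightarrow> 'n \<times> 'n \<Rightarrow> 'a" where
  "flat X p = ent X (fst p) (snd p)"

definition unflat :: "('n \<times> 'n \<Rightarrow> 'a) \<Rightarrow> ('a, 'n) sqmat" where
  "unflat v = Mat (\<lambda>i j. v (i, j))"

lemma unflat_flat [simp]: "unflat (flat X) = X"
  by (simp add: unflat_def flat_def ent_inverse)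

lemma flat_unflat [simp]: "flat (unflat v) = v"
  by (rule ext) (simp add: unflat_def flat_def)

text \<open>The matrix of \<open>X \<mapsto> [X, N]\<close>, with \<open>X\<close> written as a vector indexed by pairs.\<close>

definition bracket_matrix :: "('a::comm_ring_1, 'n::finite) sqmat \<Rightarrow> ('a, 'n \<times> 'n) sqmat" where
  "bracket_matrix N = Mat (\<lambda>p q. (if fst p = fst q then ent N (snd q) (snd p) else 0) -
     (if snd p = snd q then ent N (fst p) (fst q) else 0))"

lemma app_bracket_matrix: "app (bracket_matrix N) (flat X) = flat (comm X N)"
proof
  fix p
  have "app (bracket_matrix N) (flat X) p = (\<Sum>k\<in>UNIV. \<Sum>l\<in>UNIV. 
      (if fst p = k then ent N l (snd p) * ent X k l else 0) - (if snd p = l then ent N (fst p) k * ent X k l else 0))"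
    unfolding app_def UNIV_Times_UNIV[symmetric] sum.cartesian_product
    by (intro sum.cong refl) (auto simp: bracket_matrix_def flat_def left_diff_distrib)
  also have "\<dots> = (\<Sum>k\<in>UNIV. \<Sum>l\<in>UNIV. if fst p = k then ent N l (snd p) * ent X k l else 0)
      - (\<Sum>k\<in>UNIV. \<Sum>l\<in>UNIV. if snd p = l then ent N (fst p) k * ent X k l else 0)"
    by (simp only: sum_subtractf)
  also have "(\<Sum>k\<in>UNIV. \<Sum>l\<in>UNIV. if fst p = k then ent N l (snd p) * ent X k l else 0)
      = (\<Sum>l\<in>UNIV. ent N l (snd p) * ent X (fst p) l)"
    by (subst sum.swap) simp
  also have "(\<Sum>k\<in>UNIV. \<Sum>l\<in>UNIV. if snd p = l then ent N (fst p) k * ent X k l else 0)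
      = (\<Sum>k\<in>UNIV. ent N (fst p) k * ent X k (snd p))"
    by simp
  also have "(\<Sum>l\<in>UNIV. ent N l (snd p) * ent X (fst p) l) - \<dots> = flat (comm X N) p"
    by (simp add: flat_def comm_def ent_mult mult.commute)
  finally show "app (bracket_matrix N) (flat X) p = flat (comm X N) p" .
qed

lemma mmap_bracket_matrix:
  "unital_hom \<iota> \<Longrightarrow> mmap \<iota> (bracket_matrix N) = bracket_matrix (mmap \<iota> N)"
proof (rule sqmat_eqI)
  fix p q
  assume \<iota>: "unital_hom \<iota>"
  have "\<iota> (x - y) = \<iota> x - \<iota> y" for x y
    using \<iota> unfolding unital_hom_def by (metis add_diff_cancel_right' diff_add_cancel)
  then show "ent (mmap \<iota> (bracket_matrix N)) p q = ent (bracket_matrix (mmap \<iota> N)) p q"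
    using unital_hom_0[OF \<iota>] by (simp add: bracket_matrix_def)
qed

definition to_mat :: "('a, 'm) sqmat \<Rightarrow> 'a^'m^'m" where
  "to_mat x = (\<chi> i j. ent x i j)"

lemma to_mat_eq_iff: "to_mat x = to_mat y \<longleftrightarrow> x = y"
  by (auto simp: to_mat_def vec_eq_iff intro: sqmat_eqI)

lemma to_mat_1: "to_mat 1 = mat 1"
  by (simp add: to_mat_def mat_def ent_1)

lemma to_mat_diff: "to_mat (x - y) = to_mat x - to_mat y"
  for x y :: "('a::comm_ring_1, 'm::finite) sqmat"
  by (simp add: to_mat_def vec_eq_iff)

lemma to_mat_add: "to_mat (x + y) = to_mat x + to_mat y"
  for x y :: "('a::comm_ring_1, 'm::finite) sqmat"
  by (simp add: to_mat_def vec_eq_iff)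

lemma to_mat_0: "to_mat 0 = (0 :: 'a::comm_ring_1^'m::finite^'m)"
  by (simp add: to_mat_def vec_eq_iff)

lemma to_mat_scale: "to_mat (c *m x) *v v = c *s (to_mat x *v v)"
  for x :: "('a::comm_ring_1, 'm::finite) sqmat"
  by (simp add: to_mat_def matrix_vector_mult_def vec_eq_iff sum_distrib_left mult_ac)

lemma to_mat_mult: "to_mat (x * y) = to_mat x ** to_mat y"
  by (simp add: to_mat_def matrix_matrix_mult_def ent_mult vec_eq_iff)

lemma to_mat_vec: "to_mat x *v v = (\<chi> i. app x (\<lambda>j. v $ j) i)"
  by (simp add: to_mat_def matrix_vector_mult_def app_def vec_eq_iff)

text \<open>Cramer's formula. The factor \<open>f\<close>, in place of \<open>1\<close>, serves to make the entries homogeneous of the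
  same degree as the determinant if \<open>f\<close> and the entries of \<open>C\<close> are linear.\<close>

definition adjugate :: "'a::comm_ring_1 \<Rightarrow> ('a, 'm::finite) sqmat \<Rightarrow> ('a, 'm) sqmat" where
  "adjugate f C = Mat (\<lambda>p q. det (\<chi> i j. if j = p then (if i = q then f else 0) else ent C i j))"

lemma adjugate_eq:
  fixes C :: "('a::field, 'm::finite) sqmat"
  assumes "C * E = 1"
  shows "adjugate f C = (f * det (to_mat C)) *m E"
proof (rule sqmat_eqI)
  fix p q
  define w where "w = (\<chi> k. f * ent E k q)"
  have "(to_mat C *v w) $ i = f * ent (C * E) i q" for i
    by (simp add: to_mat_def w_def matrix_vector_mult_def ent_mult sum_distrib_left mult_ac)
  then have w: "(to_mat C *v w) $ i = (if i = q then f else 0)" for i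
    by (simp add: assms ent_1)
  have "ent (adjugate f C) p q = det (\<chi> i j. if j = p then (to_mat C *v w) $ i else to_mat C $ i $ j)"
    unfolding w by (simp add: adjugate_def to_mat_def cong: if_cong)
  also have "\<dots> = ent ((f * det (to_mat C)) *m E) p q"
    by (simp add: cramer_lemma w_def)
  finally show "ent (adjugate f C) p q = ent ((f * det (to_mat C)) *m E) p q" .
qed

definition mat_kernel :: "(complex, 'm::finite) sqmat \<Rightarrow> (complex^'m) set" where
  "mat_kernel x = {v. to_mat x *v v = 0}"

lemma sqmat_inverse:
  fixes C :: "('a::field, 'm::finite) sqmat"
  assumes "det (to_mat C) \<noteq> 0"
  obtains E where "C * E = 1" "E * C = 1"
proof -
  obtain B where B: "to_mat C ** B = mat 1" "B ** to_mat C = mat 1"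
    using assms unfolding invertible_det_nz[symmetric] invertible_def by blast
  define E where "E = Mat (\<lambda>i j. B $ i $ j)"
  have "to_mat E = B"
    by (simp add: to_mat_def E_def vec_eq_iff)
  then have "C * E = 1" "E * C = 1"
    using B by (simp_all add: to_mat_mult to_mat_1 flip: to_mat_eq_iff)
  then show ?thesis
    using that by blast
qed

text \<open>With \<open>C = c P + G M\<close>, the kernel of \<open>M\<close> is mapped by \<open>C\<close> into the range of \<open>P\<close>, and onto it as the
  dimensions agree. Hence \<open>M C\<^sup>-\<^sup>1 P = 0\<close>, and so \<open>M C\<^sup>-\<^sup>1 G M = M\<close>. Multiplying by the determinant
  of \<open>C\<close> gives an identity between polynomials in the entries of \<open>M\<close>.\<close>

lemma constant_rank_inverse:
  fixes M M0 P G :: "(complex, 'm::finite) sqmat"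
  assumes M0: "M0 * P = 0" "G * M0 = 1 - P"
    and dim: "vec.dim (mat_kernel M) = vec.dim (mat_kernel M0)"
    and det: "det (to_mat (c *m P + G * M)) \<noteq> 0"
  shows "M * (adjugate f (c *m P + G * M) * G) * M = (f * det (to_mat (c *m P + G * M))) *m M"
proof -
  define C where "C = c *m P + G * M"
  obtain E where E: "C * E = 1" "E * C = 1"
    using sqmat_inverse det unfolding C_def by blast
  have lin: "Vector_Spaces.linear (*s) (*s) ((*v) (to_mat x))" for x :: "(complex, 'm) sqmat"
    by (rule matrix_vector_mul_linear_gen)
  have kP: "mat_kernel M0 = range ((*v) (to_mat P))"
  proof (intro equalityI subsetI)
    fix v assume "v \<in> mat_kernel M0"
    then have "to_mat (G * M0) *v v = 0"
      by (simp add: mat_kernel_def to_mat_mult flip: matrix_vector_mul_assoc)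
    then have "v = to_mat P *v v"
      by (simp add: M0 to_mat_diff to_mat_1 matrix_vector_mult_diff_rdistrib)
    then show "v \<in> range ((*v) (to_mat P))"
      by blast
  next
    fix v assume "v \<in> range ((*v) (to_mat P))"
    then obtain w where w: "v = to_mat P *v w"
      by blast
    have "to_mat M0 *v v = to_mat (M0 * P) *v w"
      by (simp add: w to_mat_mult matrix_vector_mul_assoc)
    then show "v \<in> mat_kernel M0"
      by (simp add: mat_kernel_def M0 to_mat_0)
  qed
  have inj: "inj ((*v) (to_mat C))"
  proof (rule inj_on_inverseI)
    fix v show "to_mat E *v (to_mat C *v v) = v"
      using E(2) by (simp add: matrix_vector_mul_assoc to_mat_1 flip: to_mat_mult)
  qed
  have img: "(*v) (to_mat C) ` mat_kernel M = mat_kernel M0"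
  proof (rule vec.subspace_dim_equal)
    show "vec.subspace ((*v) (to_mat C) ` mat_kernel M)"
      unfolding mat_kernel_def by (intro vec.linear_subspace_image vec.linear_subspace_kernel lin)
    show "vec.subspace (mat_kernel M0)"
      unfolding mat_kernel_def by (intro vec.linear_subspace_kernel lin)
    show "(*v) (to_mat C) ` mat_kernel M \<subseteq> mat_kernel M0"
    proof clarify
      fix v assume v: "v \<in> mat_kernel M"
      have "to_mat C *v v = c *s (to_mat P *v v) + to_mat G *v (to_mat M *v v)"
        by (simp add: C_def to_mat_add to_mat_scale matrix_vector_mult_add_rdistrib to_mat_mult
            matrix_vector_mul_assoc)
      also have "\<dots> = to_mat P *v (c *s v)"
        using v by (simp add: mat_kernel_def vector_scalar_commute)
      finally show "to_mat C *v v \<in> mat_kernel M0"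
        by (simp add: kP)
    qed
    have "vec.dim ((*v) (to_mat C) ` mat_kernel M) = vec.dim (mat_kernel M)"
      by (rule vec.dim_image_eq) (use inj lin in \<open>auto intro: inj_on_subset\<close>)
    then show "vec.dim ((*v) (to_mat C) ` mat_kernel M) \<ge> vec.dim (mat_kernel M0)"
      by (simp add: dim)
  qed
  have "M * E * P = 0"
  proof -
    have "to_mat (M * E * P) *v w = 0" for w
    proof -
      have "to_mat P *v w \<in> mat_kernel M0"
        by (simp add: kP)
      then obtain v where v: "v \<in> mat_kernel M" "to_mat P *v w = to_mat C *v v"
        using img by blast
      have "to_mat (M * E * P) *v w = to_mat M *v (to_mat E *v (to_mat C *v v))"
        by (simp add: to_mat_mult v flip: matrix_vector_mul_assoc)
      also have "to_mat E *v (to_mat C *v v) = v"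
        using E(2) by (simp add: matrix_vector_mul_assoc to_mat_1 flip: to_mat_mult)
      finally show ?thesis
        using v by (simp add: mat_kernel_def)
    qed
    then have "to_mat (M * E * P) = 0"
      by (simp add: matrix_eq)
    then show ?thesis
      by (auto simp: to_mat_def vec_eq_iff intro: sqmat_eqI)
  qed
  moreover have "M = M * E * C"
    by (simp add: mult.assoc E)
  ultimately have "M = M * E * (G * M)"
    by (simp add: C_def distrib_left)
  then show ?thesis
    unfolding C_def[symmetric] adjugate_eq[OF E(1)] by (simp add: mult.assoc)
qed

section \<open>The adjoint representation\<close>

definition ad_mat :: "(complex^'n \<Rightarrow> complex^'n \<Rightarrow> complex^'n) \<Rightarrow> complex^'n \<Rightarrow> (complex, 'n) sqmat" where
  "ad_mat br x = Mat (\<lambda>i j. br x (axis j 1) $ i)"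

locale complex_lie_algebra =
  fixes br :: "complex^'n \<Rightarrow> complex^'n \<Rightarrow> complex^'n"
  assumes lie_algebra: "lie_algebra br"
begin

abbreviation "ad \<equiv> ad_mat br"

lemma linear_br: "Vector_Spaces.linear (*s) (*s) (br x)" "Vector_Spaces.linear (*s) (*s) (\<lambda>x. br x y)"
  using lie_algebra by (auto simp: lie_algebra_def)

lemma br_simps:
  "br (x + y) z = br x z + br y z" "br z (x + y) = br z x + br z y"
  "br (c *s x) z = c *s br x z" "br z (c *s x) = c *s br z x"
  using linear_br unfolding Vector_Spaces.linear_iff by auto

lemma br_more:
  "br 0 z = 0" "br z 0 = 0" "br (- x) z = - br x z" "br z (- x) = - br z x"
  "br (x - y) z = br x z - br y z" "br z (x - y) = br z x - br z y"
proof -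
  show *: "br 0 z = 0" "br z 0 = 0" for z
    using br_simps(3)[of 0 0] br_simps(4)[of _ 0 0] by simp_all
  show neg: "br (- x) z = - br x z" "br z (- x) = - br z x" for x z
    using br_simps(1)[of x "- x" z] br_simps(2)[of z x "- x"] * by (simp_all add: eq_neg_iff_add_eq_0 add.commute)
  show "br (x - y) z = br x z - br y z" "br z (x - y) = br z x - br z y"
    using br_simps(1)[of x "- y" z] br_simps(2)[of z x "- y"] neg by simp_all
qed

lemma br_self: "br x x = 0"
  using lie_algebra by (simp add: lie_algebra_def)

lemma br_skew: "br x y = - br y x"
proof -
  have "br (x + y) (x + y) = 0"
    by (rule br_self)
  then have "br x y + br y x = 0"
    unfolding br_simps by (simp add: br_self add.commute)
  then show ?thesis
    by (simp add: eq_neg_iff_add_eq_0)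
qed

lemma br_jacobi: "br x (br y z) = br (br x y) z + br y (br x z)"
proof -
  have "br x (br y z) + br y (br z x) + br z (br x y) = 0"
    using lie_algebra unfolding lie_algebra_def by blast
  moreover have "br y (br z x) = - br y (br x z)" "br z (br x y) = - br (br x y) z"
    using br_skew[of z x] br_skew[of z "br x y"] by (simp_all add: br_more)
  ultimately show ?thesis
    by (simp add: algebra_simps)
qed

lemma to_mat_ad: "to_mat (ad x) = matrix (br x)"
  by (simp add: to_mat_def ad_mat_def matrix_def)

lemma ad_vec: "to_mat (ad x) *v u = br x u"
  by (simp add: to_mat_ad matrix_works linear_br)

lemma sqmat_eq_vecI: "(\<And>u. to_mat x *v u = to_mat y *v u) \<Longrightarrow> x = y"
  for x y :: "(complex, 'n) sqmat"
  by (simp add: matrix_eq flip: to_mat_eq_iff)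

lemma ad_add: "ad (x + y) = ad x + ad y"
  and ad_diff: "ad (x - y) = ad x - ad y"
  and ad_scale: "ad (c *s x) = c *m ad x"
  and ad_uminus: "ad (- x) = - ad x"
  and ad_0: "ad 0 = 0"
  by (auto intro!: sqmat_eqI simp: ad_mat_def br_simps br_more)

lemma ad_br: "ad (br x y) = comm (ad x) (ad y)"
proof (rule sqmat_eq_vecI)
  fix u
  have "to_mat (comm (ad x) (ad y)) *v u = br x (br y u) - br y (br x u)"
    by (simp add: comm_def to_mat_diff to_mat_mult matrix_vector_mult_diff_rdistrib ad_vec
        flip: matrix_vector_mul_assoc)
  then show "to_mat (ad (br x y)) *v u = to_mat (comm (ad x) (ad y)) *v u"
    using br_jacobi[of x y u] by (simp add: ad_vec)
qed

lemma ad_sum: "ad (\<Sum>k\<in>A. f k) = (\<Sum>k\<in>A. ad (f k))"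
  by (induction A rule: infinite_finite_induct) (simp_all add: ad_0 ad_add)

lemma ent_sum: "ent (\<Sum>k\<in>A. f k) i j = (\<Sum>k\<in>A. ent (f k) i j)"
  for f :: "'k \<Rightarrow> (complex, 'n) sqmat"
  by (induction A rule: infinite_finite_induct) simp_all

lemma ent_ad: "ent (ad x) i j = (\<Sum>k\<in>UNIV. x $ k * ent (ad (axis k 1)) i j)"
proof -
  have "x = (\<Sum>k\<in>UNIV. x $ k *s axis k 1)"
    by (simp add: basis_expansion)
  then have "ad x = (\<Sum>k\<in>UNIV. x $ k *m ad (axis k 1))"
    by (metis (mono_tags, lifting) ad_scale ad_sum sum.cong)
  then show ?thesis
    by (simp add: ent_sum)
qed

lemma br_nth: "br x u $ i = (\<Sum>j\<in>UNIV. ent (ad x) i j * u $ j)"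
  using ad_vec[of x u] by (simp add: to_mat_def matrix_vector_mult_def vec_eq_iff)

lemma killing_eq: "killing br x y = tr (ad x * ad y)"
proof -
  have "matrix (\<lambda>u. br x (br y u)) = matrix (br x) ** matrix (br y)"
    using matrix_compose_gen[OF linear_br(1)[of y] linear_br(1)[of x]] by (simp add: o_def)
  then have "killing br x y = trace (to_mat (ad x * ad y))"
    by (simp add: killing_def to_mat_mult to_mat_ad)
  then show ?thesis
    by (simp add: trace_def tr_def to_mat_def)
qed

lemma killing_simps:
  "killing br (x + y) z = killing br x z + killing br y z"
  "killing br z (x + y) = killing br z x + killing br z y"
  "killing br (x - y) z = killing br x z - killing br y z"
  "killing br z (x - y) = killing br z x - killing br z y"
  "killing br (c *s x) z = c * killing br x z" "killing br z (c *s x) = c * killing br z x"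
  "killing br 0 z = 0" "killing br z 0 = 0"
  by (simp_all add: killing_eq ad_add ad_diff ad_scale ad_0 algebra_simps)

lemma killing_commute: "killing br x y = killing br y x"
  by (simp add: killing_eq tr_commute)

lemma killing_invariant: "killing br (br x y) z = killing br x (br y z)"
  by (simp add: killing_eq ad_br tr_comm)

lemma ad_nilpotent_power:
  assumes "ad_nilpotent br v"
  obtains m where "ad v ^ m = 0"
proof -
  obtain k where k: "\<And>u. (br v ^^ k) u = 0"
    using assms by (auto simp: ad_nilpotent_def)
  have "to_mat (ad v ^ j) *v u = (br v ^^ j) u" for j u
    by (induction j) (simp_all add: to_mat_1 to_mat_mult ad_vec flip: matrix_vector_mul_assoc)
  then have "ad v ^ k = 0"
    by (intro sqmat_eq_vecI) (simp add: k to_mat_0)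
  then show ?thesis
    using that by blast
qed

lemma grading_matrix:
  assumes "ad v ^ m = 0"
  obtains H where "comm H (ad v) = ad v"
proof -
  obtain H d where d: "d \<noteq> 0" and H: "comm H (ad v) = d *m ad v"
    using grading_element_exists[OF assms] by (elim exE conjE) (rule that)
  have "comm ((1 / d) *m H) (ad v) = ad v"
    using d by (simp add: comm_simps H)
  then show ?thesis
    by (rule that)
qed

end

definition laurent_mat :: "(complex \<Rightarrow> (complex poly, 'm) sqmat) \<Rightarrow> (complex fls poly, 'm) sqmat \<Rightarrow> bool" where
  "laurent_mat X P \<longleftrightarrow> (\<forall>i j. laurent_poly (\<lambda>s. ent (X s) i j) (ent P i j))"

lemma laurent_mat_mult:
  "laurent_mat X P \<Longrightarrow> laurent_mat X' P' \<Longrightarrow> laurent_mat (\<lambda>s. X s * X' s) (P * P' :: (_, 'm::finite) sqmat)"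
  by (auto simp: laurent_mat_def ent_mult intro!: laurent_poly_sum laurent_poly_mult)

lemma laurent_mat_diff:
  "laurent_mat X P \<Longrightarrow> laurent_mat X' P' \<Longrightarrow> laurent_mat (\<lambda>s. X s - X' s) (P - P' :: (_, 'm::finite) sqmat)"
  by (auto simp: laurent_mat_def intro!: laurent_poly_diff)

lemma laurent_mat_scale:
  "laurent_poly c f \<Longrightarrow> laurent_mat X P \<Longrightarrow> laurent_mat (\<lambda>s. c s *m X s) (f *m P :: (_, 'm::finite) sqmat)"
  by (auto simp: laurent_mat_def intro!: laurent_poly_mult)

lemma laurent_mat_1: "laurent_mat (\<lambda>s. 1) (1 :: (_, 'm::finite) sqmat)"
  by (auto simp: laurent_mat_def ent_1 laurent_poly_1 laurent_poly_0)

lemma laurent_mat_power: "laurent_mat X P \<Longrightarrow> laurent_mat (\<lambda>s. X s ^ k) (P ^ k :: (_, 'm::finite) sqmat)"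
  by (induction k) (auto simp: laurent_mat_1 laurent_mat_mult)

lemma laurent_mat_pencil:
  assumes "\<And>i j. (\<lambda>s. ent (X s) i j) has_laurent_expansion ent P i j"
    "\<And>i j. (\<lambda>s. ent (X' s) i j) has_laurent_expansion ent P' i j"
  shows "laurent_mat (\<lambda>s. pencil (X s) (X' s)) (pencil P P')"
  unfolding laurent_mat_def ent_pencil by (intro allI laurent_poly_pCons laurent_poly_0 assms)

lemma laurent_mat_bracket_matrix:
  "laurent_mat X P \<Longrightarrow> laurent_mat (\<lambda>s. bracket_matrix (X s)) (bracket_matrix P)"
  unfolding laurent_mat_def bracket_matrix_def
  by (auto simp: laurent_poly_0 laurent_poly_diff intro: laurent_poly_diff[OF laurent_poly_0, simplified])

lemma laurent_mat_eq_0: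
  assumes "laurent_mat X P" "eventually (\<lambda>s. \<forall>t. mmap (\<lambda>p. poly p t) (X s) = 0) (at 0)"
  shows "P = (0 :: (_, 'm::finite) sqmat)"
proof (rule sqmat_eqI)
  fix i j
  have "eventually (\<lambda>s. \<forall>t. poly (ent (X s) i j) t = 0) (at 0)"
    using assms(2) by eventually_elim (metis ent_mmap ent_simps(1))
  moreover have "laurent_poly (\<lambda>s. ent (X s) i j) (ent P i j)"
    using assms(1) by (simp add: laurent_mat_def)
  ultimately show "ent P i j = ent 0 i j"
    using laurent_poly_eq_0 by fastforce
qed

lemma hpoly_ent_mult:
  assumes "\<And>i j. hpoly d (\<lambda>x. ent (X x) i j)" "\<And>i j. hpoly e (\<lambda>x. ent (Y x) i j)"
  shows "hpoly (d + e) (\<lambda>x. ent (X x * Y x :: (complex, 'm::finite) sqmat) i j)"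
  unfolding ent_mult by (intro hpoly_sum hpoly_mult assms)

lemma hpoly_ent_power:
  assumes "\<And>i j. hpoly 1 (\<lambda>x. ent (X x) i j)"
  shows "hpoly m (\<lambda>x. ent (X x ^ m :: (complex, 'm::finite) sqmat) i j)"
proof (induction m arbitrary: i j)
  case 0
  then show ?case
    by (simp add: ent_1 hpoly_const)
next
  case (Suc m)
  show ?case
    using hpoly_ent_mult[OF assms Suc] by simp
qed

lemma hpoly_adjugate:
  assumes "\<And>i j. hpoly 1 (\<lambda>x. ent (C x) i j)" "hpoly 1 f"
  shows "hpoly CARD('m) (\<lambda>x. ent (adjugate (f x) (C x) :: (complex, 'm::finite) sqmat) p q)"
  unfolding adjugate_def ent_Mat
proof (rule hpoly_det)
  show "hpoly 1 (\<lambda>x. (\<chi> i j. if j = p then if i = q then f x else 0 else ent (C x) i j) $ i $ j)" for i j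
    using assms by (cases "j = p"; cases "i = q") (simp_all add: hpoly_0)
qed

lemma hpoly_bracket_matrix:
  assumes "\<And>i j. hpoly d (\<lambda>x. ent (X x) i j)"
  shows "hpoly d (\<lambda>x. ent (bracket_matrix (X x)) p q)"
  unfolding bracket_matrix_def ent_Mat
proof (rule hpoly_diff)
  show "hpoly d (\<lambda>x. if fst p = fst q then ent (X x) (snd q) (snd p) else 0)"
    by (cases "fst p = fst q") (simp_all add: assms hpoly_0)
  show "hpoly d (\<lambda>x. if snd p = snd q then ent (X x) (fst p) (fst q) else 0)"
    by (cases "snd p = snd q") (simp_all add: assms hpoly_0)
qed

section \<open>Lines in a family of nilpotent elements\<close>

lemma hpoly_cmult_right: "hpoly d p \<Longrightarrow> hpoly d (\<lambda>x. p x * k)"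
  using hpoly_mult[OF _ hpoly_const] by fastforce

lemma fls_const_hom: "unital_hom (fls_const :: complex \<Rightarrow> complex fls)"
  by (simp add: unital_hom_def fls_const_mult_const fls_plus_const)

lemma fls_deriv_add': "fls_deriv (x + y) = fls_deriv x + fls_deriv y"
  and fls_deriv_mult': "fls_deriv (x * y) = fls_deriv x * y + x * fls_deriv y"
  for x y :: "complex fls"
  by (simp_all add: fls_deriv_mult add.commute)

lemma has_laurent_expansion_tr_mult:
  assumes "\<And>i j. (\<lambda>s. ent (X s) i j) has_laurent_expansion ent P i j"
    "\<And>i j. (\<lambda>s. ent (X' s) i j) has_laurent_expansion ent P' i j"
  shows "(\<lambda>s. tr (X s * X' s)) has_laurent_expansion tr (P * P' :: (_, 'm::finite) sqmat)"
  unfolding tr_def ent_mult by (intro has_laurent_expansion_sum has_laurent_expansion_mult assms)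

lemma has_laurent_expansion_ent_comm:
  assumes "\<And>i j. (\<lambda>s. ent (X s) i j) has_laurent_expansion ent P i j"
    "\<And>i j. (\<lambda>s. ent (X' s) i j) has_laurent_expansion ent P' i j"
  shows "(\<lambda>s. ent (comm (X s) (X' s)) i j) has_laurent_expansion ent (comm P P' :: (_, 'm::finite) sqmat) i j"
  unfolding comm_def ent_simps ent_mult
  by (intro has_laurent_expansion_diff has_laurent_expansion_sum has_laurent_expansion_mult assms)

lemma laurent_expansion_0_value:
  assumes "f has_laurent_expansion 0" "isCont f 0"
  shows "f 0 = 0"
proof -
  have "eventually (\<lambda>s. f (0 + s) = 0) (at 0)"
    using has_laurent_expansion_eventually_zero_iff[of f 0 0] assms(1) by simp
  then have "(f \<longlongrightarrow> 0) (at 0)"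
    by (simp add: tendsto_eventually)
  moreover have "(f \<longlongrightarrow> f 0) (at 0)"
    using assms(2) by (simp add: isCont_def)
  ultimately show ?thesis
    using tendsto_unique at_neq_bot by blast
qed

context complex_lie_algebra
begin

text \<open>The transfer of \<open>isotropic_pencil_derivative\<close> to a disc of lines \<open>\<langle>y, [\<alpha>(s), y]\<rangle>\<close> on which the
  equations of the cone \<open>C\<close> hold. The generalized inverse of \<open>[-, ad x]\<close> is given by polynomials
  in \<open>x\<close>; the identity that makes it one holds on \<open>C\<close> after multiplication by the determinant
  \<open>\<Delta>\<close>, hence also on the lines.\<close>

theorem isotropic_lines:
  fixes C :: "(complex^'n) set" and \<alpha> :: "complex \<Rightarrow> complex^'n"
  assumes y: "y \<in> C" "y \<noteq> 0"
    and nil: "\<And>x. x \<in> C \<Longrightarrow> ad x ^ m = 0"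
    and rank: "\<And>x. x \<in> C \<Longrightarrow> vec.dim (mat_kernel (bracket_matrix (ad x))) = vec.dim (mat_kernel (bracket_matrix (ad y)))"
    and \<alpha>: "r > 0" "\<And>i. (\<lambda>s. \<alpha> s $ i) holomorphic_on ball 0 r"
    and lines: "\<And>s a b d p. s \<in> ball 0 r \<Longrightarrow> vanishing_on C d p
       \<Longrightarrow> p (a *s y + b *s br (\<alpha> s) y) = 0"
  shows "killing br (\<alpha> 0) y = 0"
    "killing br (br (\<alpha> 0) (\<chi> i. deriv (\<lambda>s. \<alpha> s $ i) 0)) y = 0"
proof -
  have ball: "eventually (\<lambda>s. s \<in> ball 0 r) (at (0::complex))"
    using \<alpha>(1) by (intro eventually_at_in_open') auto
  define Y where "Y = ad y"
  define F where "F s = comm (ad (\<alpha> s)) Y" for s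
  have F: "F s = ad (br (\<alpha> s) y)" for s
    by (simp add: F_def Y_def ad_br)
  define e where "e k = fps_to_fls (fps_expansion (\<lambda>s. \<alpha> s $ k) 0)" for k
  have e: "(\<lambda>s. \<alpha> s $ k) has_laurent_expansion e k" for k
    unfolding e_def
    by (intro has_laurent_expansion_fps has_fps_expansion_fps_expansion[OF _ _ \<alpha>(2)]) (use \<alpha>(1) in auto)
  define A where "A = Mat (\<lambda>i j. \<Sum>k\<in>UNIV. e k * fls_const (ent (ad (axis k 1)) i j))"
  have A: "(\<lambda>s. ent (ad (\<alpha> s)) i j) has_laurent_expansion ent A i j" for i j
    unfolding ent_ad[of "\<alpha> _"] A_def ent_Mat
    by (intro has_laurent_expansion_sum has_laurent_expansion_mult e has_laurent_expansion_const)
  define YL where "YL = mmap fls_const Y"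
  have YL: "(\<lambda>s. ent Y i j) has_laurent_expansion ent YL i j" for i j
    by (simp add: YL_def)
  have FL: "(\<lambda>s. ent (F s) i j) has_laurent_expansion ent (comm A YL) i j" for i j
    unfolding F_def by (intro has_laurent_expansion_ent_comm A YL)
  note pencils = laurent_mat_pencil[of "\<lambda>_. Y" YL F "comm A YL", OF YL FL]
    laurent_mat_pencil[of F "comm A YL" "\<lambda>_. Y" YL, OF FL YL]
  have ev_pencil: "mmap (\<lambda>p. poly p t) (pencil Y (F s)) = ad (1 *s y + t *s br (\<alpha> s) y)"
    "mmap (\<lambda>p. poly p t) (pencil (F s) Y) = ad (t *s y + 1 *s br (\<alpha> s) y)" for s t
    by (simp_all add: eval_pencil Y_def F ad_add ad_scale)
  have ev_power: "mmap (\<lambda>p. poly p t) (X ^ k) = mmap (\<lambda>p. poly p t) X ^ k" for t k and X :: "(complex poly, 'n) sqmat"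
    by (induction k) (simp_all add: eval_hom)
  have hpoly_ad: "hpoly 1 (\<lambda>x. ent (ad x) i j)" for i j
  proof -
    have "(\<lambda>x. ent (ad x) i j) = (\<lambda>x. \<Sum>k\<in>UNIV. x $ k * ent (ad (axis k 1)) i j)"
      by (rule ext) (rule ent_ad)
    then show ?thesis
      by (rule ssubst) (intro hpoly_sum hpoly_cmult_right hpoly_coord)
  qed
  have powers: "ad (a *s y + b *s br (\<alpha> s) y) ^ m = 0" if "s \<in> ball 0 r" for a b s
  proof (rule sqmat_eqI)
    fix i j
    have "vanishing_on C m (\<lambda>x. ent (ad x ^ m) i j)"
      unfolding vanishing_on_def by (intro conjI hpoly_ent_power hpoly_ad ballI) (simp add: nil)
    then show "ent (ad (a *s y + b *s br (\<alpha> s) y) ^ m) i j = ent 0 i j"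
      unfolding ent_simps by (rule lines[OF that])
  qed
  have nil1: "pencil YL (comm A YL) ^ m = 0"
  proof (rule laurent_mat_eq_0)
    show "laurent_mat (\<lambda>s. pencil Y (F s) ^ m) (pencil YL (comm A YL) ^ m)"
      by (intro laurent_mat_power pencils)
    show "eventually (\<lambda>s. \<forall>t. mmap (\<lambda>p. poly p t) (pencil Y (F s) ^ m) = 0) (at 0)"
      using ball by eventually_elim (simp only: ev_power ev_pencil powers simp_thms)
  qed
  have nil2: "pencil (comm A YL) YL ^ m = 0"
  proof (rule laurent_mat_eq_0)
    show "laurent_mat (\<lambda>s. pencil (F s) Y ^ m) (pencil (comm A YL) YL ^ m)"
      by (intro laurent_mat_power pencils)
    show "eventually (\<lambda>s. \<forall>t. mmap (\<lambda>p. poly p t) (pencil (F s) Y ^ m) = 0) (at 0)"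
      using ball by eventually_elim (simp only: ev_power ev_pencil powers simp_thms)
  qed
  obtain H where H: "comm H Y = Y"
    using grading_matrix[OF nil[OF y(1)]] unfolding Y_def by blast
  obtain i where i: "y $ i \<noteq> 0"
    using y(2) by (auto simp: vec_eq_iff)
  \<comment> \<open>A linear form that homogenizes the constant matrix \<open>P\<close> below.\<close>
  define \<phi> where "\<phi> x = 1 / y $ i * x $ i" for x
  have \<phi>: "hpoly 1 \<phi>" "\<phi> y = 1"
    using i unfolding \<phi>_def by (intro hpoly_cmult hpoly_coord, simp)
  define M where "M x = bracket_matrix (ad x)" for x
  obtain P S d where d: "d \<noteq> 0" and PP: "P * P = P" and MP: "M y * P = 0" and SM: "S * M y = d *m (1 - P)"
    by (rule kernel_splits[of "M y"])
  define G where "G = (1 / d) *m S"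
  have GM: "G * M y = 1 - P"
    using d by (simp add: G_def SM)
  define K where "K x = \<phi> x *m P + G * M x" for x
  define B where "B x = adjugate (\<phi> x) (K x) * G" for x
  define \<Delta> where "\<Delta> x = det (to_mat (K x))" for x
  have hM: "hpoly 1 (\<lambda>x. ent (M x) p q)" for p q
    unfolding M_def by (intro hpoly_bracket_matrix hpoly_ad)
  have hK: "hpoly 1 (\<lambda>x. ent (K x) p q)" for p q
    using hpoly_ent_mult[of 0 "\<lambda>_. G" 1 M, OF hpoly_const hM] unfolding K_def ent_simps ent_scale
    by (intro hpoly_add hpoly_cmult_right \<phi>) simp
  have h\<Delta>: "hpoly CARD('n \<times> 'n) \<Delta>"
    unfolding \<Delta>_def by (rule hpoly_det) (simp only: to_mat_def vec_lambda_beta hK)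
  have hB: "hpoly CARD('n \<times> 'n) (\<lambda>x. ent (B x) p q)" for p q
  proof -
    have "hpoly 0 (\<lambda>x. ent G i j)" for i j
      by (rule hpoly_const)
    from hpoly_ent_mult[where Y = "\<lambda>_. G", OF hpoly_adjugate[OF hK \<phi>(1)] this] show ?thesis
      unfolding B_def by (simp only: add_0_right)
  qed
  have h\<delta>: "hpoly (1 + CARD('n \<times> 'n)) (\<lambda>x. \<phi> x * \<Delta> x)"
    by (intro hpoly_mult \<phi> h\<Delta>)
  define Z where "Z x = \<Delta> x *m (M x * B x * M x - (\<phi> x * \<Delta> x) *m M x)" for x
  have hZ: "hpoly (CARD('n \<times> 'n) + (1 + CARD('n \<times> 'n) + 1)) (\<lambda>x. ent (Z x) p q)" for p q
    unfolding Z_def ent_scale ent_simps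
    by (intro hpoly_mult hpoly_diff h\<Delta> hpoly_ent_mult hM hB h\<delta>)
  have Z0: "Z x = 0" if "x \<in> C" for x
  proof (cases "\<Delta> x = 0")
    case False
    then have "M x * B x * M x = (\<phi> x * \<Delta> x) *m M x"
      unfolding B_def \<Delta>_def K_def
      by (intro constant_rank_inverse[OF MP GM]) (use rank[OF that] in \<open>simp_all add: M_def\<close>)
    then show ?thesis
      by (simp add: Z_def)
  qed (simp add: Z_def)
  have Zlines: "Z (1 *s y + t *s br (\<alpha> s) y) = 0" if "s \<in> ball 0 r" for s t
  proof (rule sqmat_eqI)
    fix p q
    have "vanishing_on C (CARD('n \<times> 'n) + (1 + CARD('n \<times> 'n) + 1)) (\<lambda>x. ent (Z x) p q)"
      unfolding vanishing_on_def by (intro conjI hZ ballI) (simp add: Z0)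
    then show "ent (Z (1 *s y + t *s br (\<alpha> s) y)) p q = ent 0 p q"
      unfolding ent_simps by (rule lines[OF that])
  qed
  define X where "X k s = [:y $ k, br (\<alpha> s) y $ k:]" for k s
  define PX where "PX k = [:fls_const (y $ k), \<Sum>j\<in>UNIV. ent A k j * fls_const (y $ j):]" for k
  have X: "laurent_poly (X k) (PX k)" for k
    unfolding X_def PX_def br_nth
    by (intro laurent_poly_pCons laurent_poly_0 has_laurent_expansion_const has_laurent_expansion_sum
        has_laurent_expansion_mult A)
  have Xev: "(\<chi> k. poly (X k s) t) = 1 *s y + t *s br (\<alpha> s) y" for s t
    by (simp add: X_def vec_eq_iff)
  have lift: "\<exists>g Q. laurent_poly g Q \<and> (\<forall>s t. poly (g s) t = f (1 *s y + t *s br (\<alpha> s) y))"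
    if "hpoly k f" for k f
    using hpoly_laurent[where X = X and P = PX, OF that X] by (simp only: Xev)
  have "\<exists>g Q. laurent_poly g Q \<and> (\<forall>s t. poly (g s) t = ent (B (1 *s y + t *s br (\<alpha> s) y)) p q)" for p q
    by (rule lift[OF hB])
  then have "\<forall>p q. \<exists>z. laurent_poly (fst z) (snd z) \<and> (\<forall>s t. poly (fst z s) t = ent (B (1 *s y + t *s br (\<alpha> s) y)) p q)"
    by auto
  then obtain z where z: "\<And>p q. laurent_poly (fst (z p q)) (snd (z p q)) \<and>
      (\<forall>s t. poly (fst (z p q) s) t = ent (B (1 *s y + t *s br (\<alpha> s) y)) p q)"
    unfolding choice_iff by blast
  define GB where "GB p q = fst (z p q)" for p q
  define QB where "QB p q = snd (z p q)" for p q
  have B: "laurent_poly (GB p q) (QB p q)" for p q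
    using z by (simp add: GB_def QB_def)
  have GB: "poly (GB p q s) t = ent (B (1 *s y + t *s br (\<alpha> s) y)) p q" for p q s t
    using z by (simp add: GB_def)
  obtain G\<Delta> Q\<Delta> where \<Delta>: "laurent_poly G\<Delta> Q\<Delta>"
    and G\<Delta>: "\<forall>s t. poly (G\<Delta> s) t = \<Delta> (1 *s y + t *s br (\<alpha> s) y)"
    using lift[OF h\<Delta>] by blast
  obtain G\<phi> Q\<phi> where \<phi>L: "laurent_poly G\<phi> Q\<phi>"
    and G\<phi>: "\<forall>s t. poly (G\<phi> s) t = \<phi> (1 *s y + t *s br (\<alpha> s) y)"
    using lift[OF \<phi>(1)] by blast
  note G\<Delta> = G\<Delta>[rule_format] and G\<phi> = G\<phi>[rule_format]
  have value_y: "coeff Q 0 = 1" if "laurent_poly g Q" "\<And>s. poly (g s) 0 = 1" for g Q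
  proof -
    have "(\<lambda>s. coeff (g s) 0) has_laurent_expansion coeff Q 0"
      using that(1) by (simp add: laurent_poly_def)
    moreover have "coeff (g s) 0 = 1" for s
      using that(2)[of s] by (simp add: poly_0_coeff_0)
    ultimately have "(\<lambda>s. 1) has_laurent_expansion coeff Q 0"
      by simp
    then show ?thesis
      using has_laurent_expansion_unique has_laurent_expansion_1 by blast
  qed
  \<comment> \<open>So the determinant does not vanish at \<open>t = 0\<close>.\<close>
  have Ky: "K y = 1"
    by (simp add: K_def \<phi> GM)
  have "\<Delta> y = 1"
    by (simp add: \<Delta>_def Ky to_mat_1)
  then have \<Delta>0: "coeff Q\<Delta> 0 = 1" and \<phi>0: "coeff Q\<phi> 0 = 1"
    using value_y[OF \<Delta>] value_y[OF \<phi>L] by (simp_all add: G\<Delta> G\<phi> \<phi>)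
  define N where "N = pencil YL (comm A YL)"
  define MN where "MN = bracket_matrix N"
  define BL where "BL = Mat QB"
  define \<delta> where "\<delta> = Q\<phi> * Q\<Delta>"
  have \<delta>0: "coeff \<delta> 0 \<noteq> 0"
    by (simp add: \<delta>_def coeff_mult \<Delta>0 \<phi>0)
  have "Q\<Delta> *m (MN * BL * MN - \<delta> *m MN) = 0"
  proof (rule laurent_mat_eq_0)
    let ?M = "\<lambda>s. bracket_matrix (pencil Y (F s))"
    let ?B = "\<lambda>s. Mat (\<lambda>p q. GB p q s)"
    have M': "laurent_mat ?M MN"
      unfolding MN_def N_def by (intro laurent_mat_bracket_matrix pencils)
    have B': "laurent_mat ?B BL"
      by (simp add: laurent_mat_def BL_def B)
    show "laurent_mat (\<lambda>s. G\<Delta> s *m (?M s * ?B s * ?M s - (G\<phi> s * G\<Delta> s) *m ?M s)) (Q\<Delta> *m (MN * BL * MN - \<delta> *m MN))"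
      unfolding \<delta>_def by (intro laurent_mat_scale laurent_mat_diff laurent_mat_mult laurent_poly_mult M' B' \<Delta> \<phi>L)
    have evB: "mmap (\<lambda>p. poly p t) (?B s) = B (1 *s y + t *s br (\<alpha> s) y)" for s t
      by (rule sqmat_eqI) (simp add: GB)
    have evM: "mmap (\<lambda>p. poly p t) (?M s) = M (1 *s y + t *s br (\<alpha> s) y)" for s t
      by (simp only: mmap_bracket_matrix[OF unital_hom_eval] ev_pencil M_def)
    show "eventually (\<lambda>s. \<forall>t. mmap (\<lambda>p. poly p t)
        (G\<Delta> s *m (?M s * ?B s * ?M s - (G\<phi> s * G\<Delta> s) *m ?M s)) = 0) (at 0)"
      using ball
    proof eventually_elim
      case (elim s)
      show ?case
        using Zlines[OF elim] unfolding Z_def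
        by (simp only: eval_hom evB evM poly_mult G\<Delta> G\<phi> simp_thms)
    qed
  qed
  moreover have "Q\<Delta> \<noteq> 0"
    using \<Delta>0 by auto
  ultimately have MBM: "MN * BL * MN = \<delta> *m MN"
    by (simp add: scale_eq_0)
  define \<beta> where "\<beta> V = unflat (app BL (flat V))" for V
  have \<beta>1: "\<beta> (c *m V) = c *m \<beta> V" for c V
  proof -
    have "flat (c *m V) = (\<lambda>p. c * flat V p)"
      by (simp add: flat_def fun_eq_iff)
    then show ?thesis
      by (auto intro!: sqmat_eqI simp: \<beta>_def app_scale unflat_def)
  qed
  have \<beta>2: "comm (\<beta> (comm V N)) N = \<delta> *m comm V N" for V
  proof -
    have "flat (comm (\<beta> (comm V N)) N) = app (MN * BL * MN) (flat V)"
      by (simp add: \<beta>_def app_mult MN_def flip: app_bracket_matrix)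
    also have "\<dots> = (\<lambda>p. \<delta> * flat (comm V N) p)"
      unfolding MBM app_scale by (simp only: MN_def app_bracket_matrix)
    also have "\<dots> = flat (\<delta> *m comm V N)"
      by (simp add: flat_def fun_eq_iff)
    finally show ?thesis
      by (metis unflat_flat)
  qed
  have const: "mmap fls_deriv (mmap fls_const V) = 0" for V :: "(complex, 'n) sqmat"
    by (rule sqmat_eqI) simp
  have HL: "comm (mmap fls_const H) YL = YL"
    unfolding YL_def mmap_comm[OF fls_const_hom, symmetric] H ..
  note core = isotropic_pencil_derivative[of fls_deriv YL "mmap fls_const H" A m \<beta> \<delta>,
      OF fls_deriv_add' fls_deriv_mult' const[of Y, folded YL_def] const HL nil1 nil2 \<beta>1 \<beta>2[unfolded N_def] \<delta>0]
  have holo_ad: "(\<lambda>s. ent (ad (\<alpha> s)) i j) holomorphic_on ball 0 r" for i j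
    unfolding ent_ad[of "\<alpha> _"] by (intro holomorphic_intros \<alpha>(2))
  have cont: "isCont f 0" if "f holomorphic_on ball 0 r" for f :: "complex \<Rightarrow> complex"
    using that \<alpha>(1) holomorphic_on_imp_continuous_on continuous_on_eq_continuous_at
    by (metis centre_in_ball open_ball)
  have "tr (ad (\<alpha> 0) * Y) = 0"
  proof (rule laurent_expansion_0_value)
    show "(\<lambda>s. tr (ad (\<alpha> s) * Y)) has_laurent_expansion 0"
      using has_laurent_expansion_tr_mult[OF A YL] core(1) by simp
    show "isCont (\<lambda>s. tr (ad (\<alpha> s) * Y)) 0"
      unfolding tr_def ent_mult by (intro cont holomorphic_intros holo_ad)
  qed
  then show "killing br (\<alpha> 0) y = 0"
    by (simp add: killing_eq Y_def)
  define A' where "A' s = Mat (\<lambda>i j. deriv (\<lambda>s. ent (ad (\<alpha> s)) i j) s)" for s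
  have A': "(\<lambda>s. ent (A' s) i j) has_laurent_expansion ent (mmap fls_deriv A) i j" for i j
    unfolding A'_def ent_Mat ent_mmap by (intro has_laurent_expansion_deriv A)
  have "tr (comm (ad (\<alpha> 0)) (A' 0) * Y) = 0"
  proof (rule laurent_expansion_0_value)
    show "(\<lambda>s. tr (comm (ad (\<alpha> s)) (A' s) * Y)) has_laurent_expansion 0"
      using has_laurent_expansion_tr_mult[OF has_laurent_expansion_ent_comm[OF A A'] YL] core(2) by simp
    show "isCont (\<lambda>s. tr (comm (ad (\<alpha> s)) (A' s) * Y)) 0"
      unfolding tr_def ent_mult comm_def ent_simps A'_def ent_Mat
      by (intro cont holomorphic_intros holo_ad) auto
  qed
  moreover have "A' 0 = ad (\<chi> i. deriv (\<lambda>s. \<alpha> s $ i) 0)"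
  proof (rule sqmat_eqI)
    fix i j
    have "((\<lambda>s. ent (ad (\<alpha> s)) i j) has_field_derivative
        (\<Sum>k\<in>UNIV. deriv (\<lambda>s. \<alpha> s $ k) 0 * ent (ad (axis k 1)) i j)) (at 0)"
      unfolding ent_ad[of "\<alpha> _"]
      by (intro DERIV_sum DERIV_cmult_right holomorphic_derivI[OF \<alpha>(2)]) (use \<alpha>(1) in auto)
    then show "ent (A' 0) i j = ent (ad (\<chi> i. deriv (\<lambda>s. \<alpha> s $ i) 0)) i j"
      by (subst ent_ad) (simp add: A'_def DERIV_imp_deriv)
  qed
  ultimately show "killing br (br (\<alpha> 0) (\<chi> i. deriv (\<lambda>s. \<alpha> s $ i) 0)) y = 0"
    by (simp add: killing_eq ad_br Y_def)
qed

end

section \<open>Exponentials of inner derivations\<close>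

lemma sums_vecI:
  fixes f :: "nat \<Rightarrow> complex^'n"
  assumes "\<And>i. (\<lambda>k. f k $ i) sums (s $ i)"
  shows "f sums s"
  using assms unfolding sums_def by (intro vec_tendstoI) (simp add: sum_component)

lemma scaleR_vec: "r *\<^sub>R v = complex_of_real r *s v" for v :: "complex^'n"
  unfolding vec_eq_iff vector_scaleR_component vector_smult_component by (simp add: scaleR_conv_of_real)

lemma has_derivative_vecI:
  fixes f :: "complex \<Rightarrow> complex^'n"
  assumes "\<And>i. ((\<lambda>s. f s $ i) has_field_derivative d $ i) (at a)"
  shows "(f has_derivative (\<lambda>h. h *s d)) (at a)"
  unfolding has_derivative_componentwise_within[of f "\<lambda>h. h *s d" a UNIV]
proof
  fix b :: "complex^'n" assume "b \<in> Basis"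
  then obtain i c where b: "b = axis i c"
    by (auto simp: Basis_vec_def)
  have "((\<lambda>s. f s $ i) has_derivative (\<lambda>h. d $ i * h)) (at a)"
    using assms[of i] by (simp add: has_field_derivative_def)
  then have "((\<lambda>s. inner (f s $ i) c) has_derivative (\<lambda>h. inner (d $ i * h) c)) (at a)"
    by (rule has_derivative_inner_left)
  then show "((\<lambda>s. inner (f s) b) has_derivative (\<lambda>h. inner (h *s d) b)) (at a)"
    by (simp add: b inner_axis mult.commute)
qed

context complex_lie_algebra
begin

lemma bounded_linear_br: "bounded_linear (br x)"
  by (rule linear_conv_bounded_linear[THEN iffD1])
    (auto intro!: linearI simp: br_simps scaleR_vec)

lemma br_power_scale: "(br (t *s x) ^^ k) y = t ^ k *s (br x ^^ k) y"
  by (induction k) (simp_all add: br_simps mult.commute)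

lemma exp_ad_coeff_bound:
  "\<exists>K\<ge>0. \<forall>k i. norm (((br x ^^ k) y) $ i) \<le> K ^ k * norm y"
proof -
  obtain K where K: "K \<ge> 0" "\<And>u. norm (br x u) \<le> norm u * K"
    using bounded_linear.nonneg_bounded[OF bounded_linear_br] by blast
  have "norm ((br x ^^ k) y) \<le> K ^ k * norm y" for k
  proof (induction k)
    case (Suc k)
    have "norm ((br x ^^ Suc k) y) \<le> norm ((br x ^^ k) y) * K"
      using K(2) by simp
    also have "\<dots> \<le> K ^ Suc k * norm y"
      using mult_right_mono[OF Suc K(1)] by (simp add: mult_ac)
    finally show ?case .
  qed simp
  then show ?thesis
    using K(1) by (meson Finite_Cartesian_Product.norm_nth_le order_trans)
qed

lemma summable_exp_ad: "summable (\<lambda>k. (1 / fact k * (br x ^^ k) y $ i) * t ^ k)"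
proof -
  obtain K where K: "K \<ge> 0" "\<And>k i. norm (((br x ^^ k) y) $ i) \<le> K ^ k * norm y"
    using exp_ad_coeff_bound by blast
  have "summable (\<lambda>k. norm y * (inverse (fact k) * (K * norm t) ^ k))"
    by (intro summable_mult summable_exp)
  then show ?thesis
  proof (rule summable_comparison_test')
    fix k :: nat
    have "norm (((br x ^^ k) y) $ i) * norm t ^ k / fact k \<le> K ^ k * norm y * norm t ^ k / fact k"
      by (intro divide_right_mono mult_right_mono K) auto
    then show "norm ((1 / fact k * (br x ^^ k) y $ i) * t ^ k) \<le> norm y * (inverse (fact k) * (K * norm t) ^ k)"
      by (simp add: norm_mult norm_divide norm_power power_mult_distrib field_simps)
  qed
qed

lemma exp_ad_sums: "(\<lambda>k. (1 / fact k) *s (br x ^^ k) y) sums exp_ad br x y"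
  and exp_ad_nth: "exp_ad br (t *s x) y $ i = (\<Sum>k. (1 / fact k * (br x ^^ k) y $ i) * t ^ k)"
proof -
  have *: "(\<lambda>k. (1 / fact k) *s (br (t *s x) ^^ k) y) sums
     (\<chi> i. \<Sum>k. (1 / fact k * (br x ^^ k) y $ i) * t ^ k)" for t
    by (rule sums_vecI)
      (use summable_sums[OF summable_exp_ad] in \<open>simp add: br_power_scale mult_ac\<close>)
  then have **: "exp_ad br (t *s x) y = (\<chi> i. \<Sum>k. (1 / fact k * (br x ^^ k) y $ i) * t ^ k)" for t
    unfolding exp_ad_def by (rule sums_unique[symmetric])
  show "(\<lambda>k. (1 / fact k) *s (br x ^^ k) y) sums exp_ad br x y"
    using *[of 1] **[of 1] by simp
  show "exp_ad br (t *s x) y $ i = (\<Sum>k. (1 / fact k * (br x ^^ k) y $ i) * t ^ k)"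
    by (simp add: **)
qed

lemma exp_ad_add: "exp_ad br x (y + z) = exp_ad br x y + exp_ad br x z"
  and exp_ad_scale: "exp_ad br x (c *s y) = c *s exp_ad br x y"
  and exp_ad_br_self: "exp_ad br x (br x y) = br x (exp_ad br x y)"
proof -
  have pow: "(br x ^^ k) (y + z) = (br x ^^ k) y + (br x ^^ k) z" "(br x ^^ k) (c *s y) = c *s (br x ^^ k) y" for k
    by (induction k) (simp_all add: br_simps)
  show "exp_ad br x (y + z) = exp_ad br x y + exp_ad br x z"
    using sums_unique2[OF exp_ad_sums[of x "y + z"]] sums_add[OF exp_ad_sums[of x y] exp_ad_sums[of x z]]
    by (simp add: pow vector_add_ldistrib)
  have "bounded_linear (\<lambda>v :: complex^'n. c *s v)"
    by (rule linear_conv_bounded_linear[THEN iffD1])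
      (auto intro!: linearI simp: scaleR_vec vector_add_ldistrib mult.commute)
  then show "exp_ad br x (c *s y) = c *s exp_ad br x y"
    using sums_unique2[OF exp_ad_sums[of x "c *s y"]] bounded_linear.sums[OF _ exp_ad_sums[of x y], of "\<lambda>v. c *s v"]
    by (simp add: pow mult.commute)
  show "exp_ad br x (br x y) = br x (exp_ad br x y)"
    using sums_unique2[OF exp_ad_sums[of x "br x y"]] bounded_linear.sums[OF bounded_linear_br exp_ad_sums[of x y], of x]
    by (simp add: br_simps funpow_swap1)
qed

lemma linear_exp_ad: "Vector_Spaces.linear (*s) (*s) (exp_ad br x)"
  unfolding Vector_Spaces.linear_iff by (auto simp: exp_ad_add exp_ad_scale vec.vector_space_axioms)

lemma exp_ad_0: "exp_ad br 0 y = y"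
proof -
  have "(\<lambda>k. (1 / fact k) *s (br 0 ^^ k) y) = (\<lambda>k. if k = 0 then y else 0)"
  proof
    fix k show "(1 / fact k) *s (br 0 ^^ k) y = (if k = 0 then y else 0)"
      by (cases k) (simp_all add: br_more)
  qed
  then show ?thesis
    using sums_unique2[OF exp_ad_sums[of 0 y]] sums_single[of 0 "\<lambda>_. y"] by simp
qed

lemma exp_ad_deriv:
  "((\<lambda>t. exp_ad br (t *s x) y $ i) has_field_derivative exp_ad br (t *s x) (br x y) $ i) (at t)"
proof -
  let ?c = "\<lambda>k. 1 / fact k * (br x ^^ k) y $ i"
  have "((\<lambda>t. \<Sum>k. ?c k * t ^ k) has_field_derivative (\<Sum>k. diffs ?c k * t ^ k)) (at t)"
    by (rule termdiffs_strong_converges_everywhere) (rule summable_exp_ad)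
  moreover have "diffs ?c = (\<lambda>k. 1 / fact k * (br x ^^ k) (br x y) $ i)"
    by (rule ext) (simp add: diffs_def funpow_swap1 del: of_nat_Suc)
  ultimately show ?thesis
    by (simp add: exp_ad_nth)
qed

lemma exp_ad_nth_expand: "exp_ad br x w $ i = (\<Sum>j\<in>UNIV. exp_ad br x (axis j 1) $ i * w $ j)"
  using matrix_works[OF linear_exp_ad, of x w]
  by (simp add: matrix_vector_mult_def matrix_def vec_eq_iff)

lemma exp_ad_neg_deriv:
  assumes "\<And>j. ((\<lambda>t. W t $ j) has_field_derivative W' $ j) (at t)"
  shows "((\<lambda>t. exp_ad br (- t *s x) (W t) $ i) has_field_derivative
           (exp_ad br (- t *s x) (W' - br x (W t))) $ i) (at t)"
proof -
  have *: "((\<lambda>t. exp_ad br (- t *s x) y $ i) has_field_derivative - (exp_ad br (- t *s x) (br x y) $ i)) (at t)" for y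
    using exp_ad_deriv[of "- x" y i t] by (simp add: br_more) (metis (no_types, lifting) br_more(4) exp_ad_scale vector_sneg_minus1 vector_uminus_component)
  have deriv: "((\<lambda>t. \<Sum>j\<in>UNIV. exp_ad br (- t *s x) (axis j 1) $ i * W t $ j) has_field_derivative
      (\<Sum>j\<in>UNIV. - (exp_ad br (- t *s x) (br x (axis j 1)) $ i) * W t $ j + W' $ j * exp_ad br (- t *s x) (axis j 1) $ i)) (at t)"
    by (intro DERIV_sum DERIV_mult * assms)
  have 1: "(\<Sum>j\<in>UNIV. exp_ad br (- t *s x) (br x (axis j 1)) $ i * W t $ j) = exp_ad br (- t *s x) (br x (W t)) $ i"
  proof -
    have "Vector_Spaces.linear (*s) (*s) (exp_ad br (- t *s x) \<circ> br x)"
      by (rule Vector_Spaces.linear_compose[OF linear_br(1) linear_exp_ad])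
    from matrix_works[OF this, of "W t"] show ?thesis
      by (simp add: matrix_vector_mult_def matrix_def vec_eq_iff)
  qed
  have 2: "(\<Sum>j\<in>UNIV. W' $ j * exp_ad br (- t *s x) (axis j 1) $ i) = exp_ad br (- t *s x) W' $ i"
    by (subst (2) exp_ad_nth_expand) (simp add: mult.commute)
  have "exp_ad br (- t *s x) (W' - br x (W t)) = exp_ad br (- t *s x) W' - exp_ad br (- t *s x) (br x (W t))"
    by (metis add_diff_cancel_right' diff_add_cancel exp_ad_add)
  then have val: "(\<Sum>j\<in>UNIV. - (exp_ad br (- t *s x) (br x (axis j 1)) $ i) * W t $ j + W' $ j * exp_ad br (- t *s x) (axis j 1) $ i)
      = (exp_ad br (- t *s x) (W' - br x (W t))) $ i"
    unfolding sum.distrib 2 by (simp only: mult_minus_left sum_negf 1 vector_minus_component) simp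
  have expand: "(\<lambda>t. exp_ad br (- t *s x) (W t) $ i) = (\<lambda>t. \<Sum>j\<in>UNIV. exp_ad br (- t *s x) (axis j 1) $ i * W t $ j)"
    by (rule ext) (rule exp_ad_nth_expand)
  show ?thesis
    unfolding expand using deriv by (simp only: val)
qed

text \<open>A solution of \<open>W' = [x, W]\<close> is \<open>exp (t ad x)\<close> applied to its initial value. Applied to
  \<open>exp (t ad x) y\<close> and to the bracket of two such curves, this shows that \<open>exp (ad x)\<close> is
  invertible and an automorphism.\<close>

lemma exp_ad_neg_const:
  assumes "\<And>t j. ((\<lambda>t. W t $ j) has_field_derivative br x (W t) $ j) (at t)"
  shows "exp_ad br (- t *s x) (W t) = W 0"
proof -
  have 0: "exp_ad br z 0 = 0" for z
    using exp_ad_scale[of z 0 0] by simp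
  have "exp_ad br (- t *s x) (W t) $ i = W 0 $ i" for i
  proof -
    have "((\<lambda>t. exp_ad br (- t *s x) (W t) $ i) has_field_derivative 0) (at t)" for t
      using exp_ad_neg_deriv[where W = W and x = x and t = t and i = i, OF assms] by (simp add: 0)
    then obtain c where c: "\<And>t. exp_ad br (- t *s x) (W t) $ i = c"
      using has_field_derivative_zero_constant[of UNIV "\<lambda>t. exp_ad br (- t *s x) (W t) $ i"] by auto
    show ?thesis
      using c[of t] c[of 0] by (simp add: exp_ad_0)
  qed
  then show ?thesis
    by (simp add: vec_eq_iff)
qed

lemma exp_ad_inverse: "exp_ad br (- x) (exp_ad br x y) = y"
proof -
  have "exp_ad br (- 1 *s x) (exp_ad br (1 *s x) y) = exp_ad br (0 *s x) y"
  proof (rule exp_ad_neg_const)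
    fix t j
    have "exp_ad br (t *s x) (br x y) = br x (exp_ad br (t *s x) y)"
      by (cases "t = 0") (metis exp_ad_0 vector_smult_lzero, metis exp_ad_br_self br_simps(3) exp_ad_scale vector_mul_lcancel)
    then show "((\<lambda>t. exp_ad br (t *s x) y $ j) has_field_derivative br x (exp_ad br (t *s x) y) $ j) (at t)"
      using exp_ad_deriv[of x y j t] by simp
  qed
  then show ?thesis
    by (simp add: exp_ad_0)
qed

lemma br_deriv:
  assumes "\<And>j. ((\<lambda>t. u t $ j) has_field_derivative u' $ j) (at t)"
    "\<And>j. ((\<lambda>t. v t $ j) has_field_derivative v' $ j) (at t)"
  shows "((\<lambda>t. br (u t) (v t) $ i) has_field_derivative (br u' (v t) + br (u t) v') $ i) (at t)"
proof -
  have exp: "br a b $ i = (\<Sum>j\<in>UNIV. \<Sum>k\<in>UNIV. a $ k * ent (ad (axis k 1)) i j * b $ j)" for a b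
    unfolding br_nth[of a b] by (subst ent_ad) (simp add: sum_distrib_right)
  have "((\<lambda>t. \<Sum>j\<in>UNIV. \<Sum>k\<in>UNIV. u t $ k * ent (ad (axis k 1)) i j * v t $ j) has_field_derivative
      (\<Sum>j\<in>UNIV. \<Sum>k\<in>UNIV. (u' $ k * ent (ad (axis k 1)) i j) * v t $ j + v' $ j * (u t $ k * ent (ad (axis k 1)) i j))) (at t)"
    by (intro DERIV_sum DERIV_mult DERIV_cmult_right assms)
  moreover have "(\<Sum>j\<in>UNIV. \<Sum>k\<in>UNIV. v' $ j * (u t $ k * ent (ad (axis k 1)) i j)) = br (u t) v' $ i"
    unfolding exp by (intro sum.cong refl) (simp add: mult_ac)
  ultimately show ?thesis
    by (simp add: sum.distrib flip: exp)
qed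

lemma exp_ad_br: "exp_ad br x (br y z) = br (exp_ad br x y) (exp_ad br x z)"
proof -
  have comm: "exp_ad br (t *s x) (br x y) = br x (exp_ad br (t *s x) y)" for t y
    by (cases "t = 0") (metis exp_ad_0 vector_smult_lzero, metis exp_ad_br_self br_simps(3) exp_ad_scale vector_mul_lcancel)
  have "exp_ad br (- 1 *s x) (br (exp_ad br (1 *s x) y) (exp_ad br (1 *s x) z))
      = br (exp_ad br (0 *s x) y) (exp_ad br (0 *s x) z)"
  proof (rule exp_ad_neg_const)
    fix t j
    have "((\<lambda>t. br (exp_ad br (t *s x) y) (exp_ad br (t *s x) z) $ j) has_field_derivative
      (br (exp_ad br (t *s x) (br x y)) (exp_ad br (t *s x) z) + br (exp_ad br (t *s x) y) (exp_ad br (t *s x) (br x z))) $ j) (at t)"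
      by (intro br_deriv exp_ad_deriv)
    then show "((\<lambda>t. br (exp_ad br (t *s x) y) (exp_ad br (t *s x) z) $ j) has_field_derivative
      br x (br (exp_ad br (t *s x) y) (exp_ad br (t *s x) z)) $ j) (at t)"
      by (simp add: comm br_jacobi[of x])
  qed
  then have "exp_ad br (- x) (br (exp_ad br x y) (exp_ad br x z)) = br y z"
    by (simp add: exp_ad_0)
  then show ?thesis
    using exp_ad_inverse[of "- x"] by (metis minus_minus)
qed

definition exp_mat :: "complex^'n \<Rightarrow> (complex, 'n) sqmat" where
  "exp_mat x = Mat (\<lambda>i j. exp_ad br x (axis j 1) $ i)"

lemma exp_mat_vec: "to_mat (exp_mat x) *v u = exp_ad br x u"
proof -
  have "to_mat (exp_mat x) = matrix (exp_ad br x)"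
    by (simp add: to_mat_def exp_mat_def matrix_def)
  then show ?thesis
    by (simp add: matrix_works linear_exp_ad)
qed

lemma exp_mat_inverse: "exp_mat (- x) * exp_mat x = 1" "exp_mat x * exp_mat (- x) = 1"
proof -
  show "exp_mat (- x) * exp_mat x = 1" for x
    by (rule sqmat_eq_vecI) (simp add: to_mat_mult to_mat_1 exp_mat_vec exp_ad_inverse flip: matrix_vector_mul_assoc)
  from this[of "- x"] show "exp_mat x * exp_mat (- x) = 1"
    by simp
qed

lemma ad_exp_ad: "ad (exp_ad br x y) = exp_mat x * ad y * exp_mat (- x)"
proof (rule sqmat_eq_vecI)
  fix u
  have "br (exp_ad br x y) u = exp_ad br x (br y (exp_ad br (- x) u))"
    using exp_ad_inverse[of "- x" u] by (simp add: exp_ad_br)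
  then show "to_mat (ad (exp_ad br x y)) *v u = to_mat (exp_mat x * ad y * exp_mat (- x)) *v u"
    by (simp add: to_mat_mult ad_vec exp_mat_vec flip: matrix_vector_mul_assoc)
qed

lemma Ad_group_conj:
  assumes "g \<in> Ad_group br"
  obtains T S where "T * S = 1" "S * T = 1" "\<And>x. g x = to_mat T *v x" "\<And>x. ad (g x) = T * ad x * S"
proof -
  have "\<exists>T S. T * S = 1 \<and> S * T = 1 \<and> (\<forall>x. g x = to_mat T *v x) \<and> (\<forall>x. ad (g x) = T * ad x * S)"
    using assms
  proof (induction rule: Ad_group.induct)
    case Ad_id
    then show ?case
      by (intro exI[of _ 1]) (simp add: to_mat_1)
  next
    case (Ad_step g x)
    then obtain T S where TS: "T * S = 1" "S * T = 1" "\<And>x. g x = to_mat T *v x" "\<And>x. ad (g x) = T * ad x * S"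
      by blast
    have "exp_mat x * T * (S * exp_mat (- x)) = exp_mat x * (T * S) * exp_mat (- x)"
      "S * exp_mat (- x) * (exp_mat x * T) = S * (exp_mat (- x) * exp_mat x) * T"
      by (simp_all only: mult.assoc)
    then have inv: "exp_mat x * T * (S * exp_mat (- x)) = 1" "S * exp_mat (- x) * (exp_mat x * T) = 1"
      by (simp_all add: TS(1,2) exp_mat_inverse)
    show ?case
    proof (rule exI[where x = "exp_mat x * T"], rule exI[where x = "S * exp_mat (- x)"], intro conjI allI inv)
      fix u
      show "(exp_ad br x \<circ> g) u = to_mat (exp_mat x * T) *v u"
        by (simp add: TS(3) to_mat_mult exp_mat_vec flip: matrix_vector_mul_assoc)
      show "ad ((exp_ad br x \<circ> g) u) = exp_mat x * T * ad u * (S * exp_mat (- x))"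
        by (simp add: ad_exp_ad TS(4) mult.assoc)
    qed
  qed
  then show ?thesis
    using that by blast
qed

end

section \<open>The contact form along sections of the contact distribution\<close>

lemma ppt_0: "ppt {0} v = range (\<lambda>c. c *s v)"
  by (simp add: ppt_def insert_commute vec.span_insert_0 vec.span_singleton)

lemma ppt_0_cong: "x = c *s w \<Longrightarrow> w = d *s x \<Longrightarrow> ppt {0} x = ppt {0} w"
  unfolding ppt_0
proof (intro equalityI subsetI; elim rangeE)
  fix u k
  assume "x = c *s w" "w = d *s x"
  then show "u = k *s x \<Longrightarrow> u \<in> range (\<lambda>c. c *s w)" "u = k *s w \<Longrightarrow> u \<in> range (\<lambda>c. c *s x)"
    by (metis rangeI vector_smult_assoc)+
qed

lemma ppt_0_scale: "c \<noteq> 0 \<Longrightarrow> ppt {0} (c *s x) = ppt {0} x"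
  by (rule ppt_0_cong[of _ c _ "1 / c"]) simp_all

lemma in_ppt_0: "v \<in> ppt {0} v"
  unfolding ppt_0 by (metis rangeI vector_smult_lid)

lemma linear_functional_bounded:
  assumes "Vector_Spaces.linear (*s) (*) \<phi>"
  shows "bounded_linear (\<phi> :: complex^'n \<Rightarrow> complex)"
  by (rule linear_conv_bounded_linear[THEN iffD1])
    (use assms in \<open>auto intro!: linearI simp: scaleR_vec Vector_Spaces.linear_iff scaleR_conv_of_real\<close>)

lemma linear_functional_expand:
  assumes "Vector_Spaces.linear (*s) (*) \<phi>"
  shows "\<phi> (w :: complex^'n) = (\<Sum>j\<in>UNIV. w $ j * \<phi> (axis j 1))"
proof -
  have "\<phi> (\<Sum>j\<in>UNIV. w $ j *s axis j 1) = (\<Sum>j\<in>UNIV. \<phi> (w $ j *s axis j 1))"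
    by (rule linear_sum[OF bounded_linear.linear[OF linear_functional_bounded[OF assms]]])
  then show ?thesis
    using assms by (simp add: basis_expansion Vector_Spaces.linear_iff)
qed

lemma bounded_bilinear_smult: "bounded_bilinear ((*s) :: complex \<Rightarrow> complex^'n \<Rightarrow> complex^'n)"
proof
  show "\<exists>K. \<forall>a (b :: complex^'n). norm (a *s b) \<le> norm a * norm b * K"
    by (rule exI[of _ 1]) (simp add: norm_vec_def norm_mult L2_set_right_distrib)
qed (simp_all add: scaleR_vec vector_add_ldistrib vector_sadd_rdistrib scaleR_conv_of_real[where 'a = complex] mult_ac)

lemmas has_derivative_smult = bounded_bilinear.FDERIV[OF bounded_bilinear_smult]

definition mat_deriv :: "(complex \<Rightarrow> (complex, 'n) sqmat) \<Rightarrow> (complex, 'n) sqmat \<Rightarrow> complex \<Rightarrow> bool" where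
  "mat_deriv X X' a \<longleftrightarrow> (\<forall>i j. ((\<lambda>s. ent (X s) i j) has_field_derivative ent X' i j) (at a))"

lemma mat_deriv_mult:
  "mat_deriv X X' a \<Longrightarrow> mat_deriv Y Y' a \<Longrightarrow> mat_deriv (\<lambda>s. X s * Y s) (X' * Y a + X a * Y' :: (_, 'n::finite) sqmat) a"
  unfolding mat_deriv_def ent_mult ent_simps sum.distrib[symmetric]
  by (intro allI DERIV_sum) (auto intro!: derivative_eq_intros)

lemma mat_deriv_tr: "mat_deriv X X' a \<Longrightarrow> ((\<lambda>s. tr (X s)) has_field_derivative tr (X' :: (_, 'n::finite) sqmat)) (at a)"
  unfolding mat_deriv_def tr_def by (intro DERIV_sum) auto

context complex_lie_algebra
begin

lemma killing_conj:
  assumes "T * S = 1" "S * T = 1" "ad x' = T * ad x * S" "ad w' = T * ad w * S"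
  shows "killing br x' w' = killing br x w"
proof -
  have "ad x' * ad w' = T * (ad x * (S * T) * ad w) * S"
    by (simp only: assms(3,4) mult.assoc)
  then have "ad x' * ad w' = T * (ad x * ad w) * S"
    by (simp add: assms)
  then have "tr (ad x' * ad w') = tr (S * T * (ad x * ad w))"
    by (metis mult.assoc tr_commute)
  then show ?thesis
    by (simp add: killing_eq assms)
qed

lemma contact_space_ppt: "contact_space br (ppt {0} v) = {w. killing br v w = 0}"
proof -
  have "(\<forall>x\<in>ppt {0} v. killing br x w = 0) \<longleftrightarrow> killing br v w = 0" for w
  proof
    show "killing br v w = 0" if "\<forall>x\<in>ppt {0} v. killing br x w = 0"
      using that in_ppt_0 by blast
    show "\<forall>x\<in>ppt {0} v. killing br x w = 0" if "killing br v w = 0"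
      using that by (auto simp: ppt_0 killing_simps)
  qed
  then show ?thesis
    by (simp add: contact_space_def)
qed

lemma tr_grading:
  assumes "comm G X = X"
  shows "tr (G * X) = 0" "tr (G * comm C X) = - tr (C * X)"
proof -
  have "tr (G * comm G X) = 0"
    unfolding tr_comm[symmetric] by (simp add: comm_def)
  then show "tr (G * X) = 0"
    by (simp add: assms)
  have "tr (G * comm C X) = tr (comm G C * X)"
    by (simp add: tr_comm)
  also have "\<dots> = - tr (comm C G * X)"
    by (simp add: comm_def left_diff_distrib)
  also have "\<dots> = - tr (C * X)"
    by (simp add: tr_comm assms)
  finally show "tr (G * comm C X) = - tr (C * X)" .
qed

text \<open>The contact form as a linear form on the ambient space. In contrast to the formula with
  \<open>c\<close>, the left-hand side depends only on the tangent vector.\<close>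

lemma tr_grading_action:
  assumes "comm G (ad x) = ad x"
  shows "tr (G * ad (action_in_chart br \<phi> x c)) = - killing br c x"
  by (simp add: action_in_chart_def ad_diff ad_scale ad_br right_diff_distrib tr_grading[OF assms] killing_eq)

lemma orbit_exp_ad:
  assumes "nilpotent_orbit br Z" "ppt {0} x \<in> Z"
  shows "ppt {0} (exp_ad br w x) \<in> Z"
proof -
  obtain v where Z: "Z = {ppt {0} (g v) | g. g \<in> Ad_group br}"
    using assms(1) by (auto simp: nilpotent_orbit_def)
  then obtain g where g: "g \<in> Ad_group br" "ppt {0} x = ppt {0} (g v)"
    using assms(2) by blast
  obtain c where c: "x = c *s g v"
    using in_ppt_0[of x] g(2) by (auto simp: ppt_0)
  obtain d where d: "g v = d *s x"
    using in_ppt_0[of "g v"] g(2) by (auto simp: ppt_0)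
  have "ppt {0} (exp_ad br w x) = ppt {0} (exp_ad br w (g v))"
    using c d by (intro ppt_0_cong[of _ c _ d]) (metis exp_ad_scale)+
  then have "ppt {0} (exp_ad br w x) = ppt {0} ((exp_ad br w \<circ> g) v)"
    by simp
  moreover have "exp_ad br w \<circ> g \<in> Ad_group br"
    using g(1) by (rule Ad_group.Ad_step)
  ultimately show ?thesis
    unfolding Z by blast
qed

lemma mat_deriv_ad:
  assumes "\<And>i. ((\<lambda>s. u s $ i) has_field_derivative u' $ i) (at a)"
  shows "mat_deriv (\<lambda>s. ad (u s)) (ad u') a"
  unfolding mat_deriv_def
proof (intro allI)
  fix i j
  have "((\<lambda>s. \<Sum>k\<in>UNIV. u s $ k * ent (ad (axis k 1)) i j) has_field_derivative
      (\<Sum>k\<in>UNIV. u' $ k * ent (ad (axis k 1)) i j)) (at a)"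
    by (intro DERIV_sum DERIV_cmult_right assms)
  then show "((\<lambda>s. ent (ad (u s)) i j) has_field_derivative ent (ad u') i j) (at a)"
    unfolding ent_ad[of "u _"] ent_ad[of u'] .
qed

lemma mat_deriv_exp_mat: "mat_deriv (\<lambda>s. exp_mat (s *s x)) (ad x) 0"
  unfolding mat_deriv_def exp_mat_def ent_Mat
proof (intro allI)
  fix i j
  show "((\<lambda>s. exp_ad br (s *s x) (axis j 1) $ i) has_field_derivative ent (ad x) i j) (at 0)"
    using exp_ad_deriv[of x "axis j 1" i 0] by (simp add: exp_ad_0 ad_mat_def)
qed

text \<open>Along the curve \<open>exp (s ad a) y\<close>, normalized to stay in the affine chart, the element \<open>H\<close> can be
  transported by conjugation. The contact form annihilates the section \<open>\<xi>\<close> along the curve, and the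
  derivative of this equation at \<open>s = 0\<close> is the assertion.\<close>

lemma section_derivative:
  assumes Z: "nilpotent_orbit br Z" and \<phi>: "Vector_Spaces.linear (*s) (*) \<phi>" "\<phi> y = 1"
    and y: "ppt {0} y \<in> Z" "y \<in> U" and H: "comm H (ad y) = ad y"
    and \<xi>: "local_section (orbit_in_chart \<phi> Z) (contact_in_chart br \<phi>) U \<xi>" "(\<xi> has_derivative \<xi>') (at y)"
  shows "tr (comm (ad a) H * ad (\<xi> y)) + tr (H * ad (\<xi>' (action_in_chart br \<phi> y a))) = 0"
proof -
  define E where "E s = exp_ad br (s *s a) y" for s
  define x where "x s = (1 / \<phi> (E s)) *s E s" for s
  define u where "u = action_in_chart br \<phi> y a"
  have E0: "E 0 = y"
    by (simp add: E_def exp_ad_0)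
  have x0: "x 0 = y"
    by (simp add: x_def E0 \<phi>)
  have E': "((\<lambda>s. E s $ i) has_field_derivative br a y $ i) (at 0)" for i
    using exp_ad_deriv[of a y i 0] by (simp add: E_def exp_ad_0)
  note \<phi>_expand = linear_functional_expand[OF \<phi>(1)]
  have \<phi>E': "((\<lambda>s. \<phi> (E s)) has_field_derivative \<phi> (br a y)) (at 0)"
  proof -
    have "((\<lambda>s. \<Sum>j\<in>UNIV. E s $ j * \<phi> (axis j 1)) has_field_derivative (\<Sum>j\<in>UNIV. br a y $ j * \<phi> (axis j 1))) (at 0)"
      by (intro DERIV_sum DERIV_cmult_right E')
    moreover have "(\<lambda>s. \<Sum>j\<in>UNIV. E s $ j * \<phi> (axis j 1)) = (\<lambda>s. \<phi> (E s))"
      by (rule ext) (rule \<phi>_expand[symmetric])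
    ultimately show ?thesis
      by (simp only: \<phi>_expand[of "br a y"])
  qed
  have x': "((\<lambda>s. x s $ i) has_field_derivative u $ i) (at 0)" for i
  proof -
    have "((\<lambda>s. E s $ i / \<phi> (E s)) has_field_derivative
       (br a y $ i * \<phi> (E 0) - E 0 $ i * \<phi> (br a y)) / (\<phi> (E 0) * \<phi> (E 0))) (at 0)"
      by (intro DERIV_divide E' \<phi>E') (simp add: E0 \<phi>)
    then show ?thesis
      by (simp add: x_def E0 \<phi> u_def action_in_chart_def mult.commute)
  qed
  have dx: "(x has_derivative (\<lambda>h. h *s u)) (at 0)"
    by (rule has_derivative_vecI) (rule x')
  have lin: "\<xi>' (h *s w) = h *s \<xi>' w" for h w
  proof -
    obtain f' where f': "(\<xi> has_derivative f') (at y)" "Vector_Spaces.linear (*s) (*s) f'"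
      using \<xi>(1) y(2) unfolding local_section_def cholomorphic_on_def by blast
    then have "\<xi>' = f'"
      using \<xi>(2) has_derivative_unique by blast
    then show ?thesis
      using f'(2) by (simp add: Vector_Spaces.linear_iff)
  qed
  have "((\<lambda>s. \<xi> (x s)) has_derivative (\<lambda>h. \<xi>' (h *s u))) (at 0)"
    using has_derivative_compose[OF dx, of \<xi> \<xi>'] \<xi>(2) by (simp add: x0)
  then have "((\<lambda>s. \<xi> (x s) $ i) has_derivative (\<lambda>h. \<xi>' (h *s u) $ i)) (at 0)" for i
    by (rule bounded_linear.has_derivative[OF bounded_linear_vec_nth])
  then have "((\<lambda>s. \<xi> (x s) $ i) has_field_derivative \<xi>' u $ i) (at 0)" for i
    by (simp add: lin has_field_derivative_def mult_commute_abs)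
  then have d\<xi>: "mat_deriv (\<lambda>s. ad (\<xi> (x s))) (ad (\<xi>' u)) 0"
    by (rule mat_deriv_ad)
  have dS: "mat_deriv (\<lambda>s. exp_mat (- (s *s a))) (- ad a) 0"
    using mat_deriv_exp_mat[of "- a"] by (simp add: ad_uminus)
  have dH: "mat_deriv (\<lambda>s. H) 0 0"
    by (simp add: mat_deriv_def)
  let ?f = "\<lambda>s. tr (exp_mat (s *s a) * H * exp_mat (- (s *s a)) * ad (\<xi> (x s)))"
  have exp0: "exp_mat 0 = 1"
    by (rule sqmat_eq_vecI) (simp add: exp_mat_vec exp_ad_0 to_mat_1)
  have "(?f has_field_derivative tr (((ad a * H + exp_mat (0 *s a) * 0) * exp_mat (- (0 *s a)) + (exp_mat (0 *s a) * H) * (- ad a)) * ad (\<xi> (x 0))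
      + (exp_mat (0 *s a) * H * exp_mat (- (0 *s a))) * ad (\<xi>' u))) (at 0)"
    by (intro mat_deriv_tr mat_deriv_mult mat_deriv_exp_mat dH dS d\<xi>)
  then have f': "(?f has_field_derivative tr (comm (ad a) H * ad (\<xi> y)) + tr (H * ad (\<xi>' u))) (at 0)"
    by (simp add: exp0 x0 comm_def)
  have ev: "eventually (\<lambda>s. ?f s = 0) (nhds 0)"
  proof -
    have "isCont (\<lambda>s. \<phi> (E s)) 0"
      using \<phi>E' DERIV_isCont by blast
    then have "eventually (\<lambda>s. \<phi> (E s) \<noteq> 0) (at 0)"
      using tendsto_imp_eventually_ne[of "\<lambda>s. \<phi> (E s)" "\<phi> (E 0)" "at 0" 0] by (simp add: isCont_def E0 \<phi>)
    then have 1: "eventually (\<lambda>s. \<phi> (E s) \<noteq> 0) (nhds 0)"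
      unfolding eventually_nhds_conv_at by (simp add: E0 \<phi>)
    have "open U"
      using \<xi>(1) by (simp add: local_section_def)
    moreover have "(x \<longlongrightarrow> x 0) (at 0)"
      using has_derivative_continuous[OF dx] by (simp add: isCont_def)
    ultimately have "eventually (\<lambda>s. x s \<in> U) (at 0)"
      using y(2) x0 topological_tendstoD by metis
    then have 2: "eventually (\<lambda>s. x s \<in> U) (nhds 0)"
      unfolding eventually_nhds_conv_at using y(2) by (simp add: x0)
    from 1 2 show ?thesis
    proof eventually_elim
      case (elim s)
      have "x s \<in> orbit_in_chart \<phi> Z"
      proof -
        have "\<phi> (x s) = 1"
          using \<phi>(1) elim by (simp add: x_def Vector_Spaces.linear_iff)
        moreover have "ppt {0} (x s) \<in> Z"
          using orbit_exp_ad[OF Z y(1)] elim by (simp add: x_def ppt_0_scale E_def)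
        ultimately show ?thesis
          by (simp add: orbit_in_chart_def)
      qed
      then have "\<xi> (x s) \<in> contact_in_chart br \<phi> (x s)"
        using \<xi>(1) elim by (simp add: local_section_def)
      then obtain c where c: "\<xi> (x s) = action_in_chart br \<phi> (x s) c" "killing br (x s) c = 0"
        by (auto simp: contact_in_chart_def contact_space_ppt)
      let ?T = "exp_mat (s *s a)" and ?S = "exp_mat (- (s *s a))"
      have adx: "ad (x s) = (1 / \<phi> (E s)) *m (?T * ad y * ?S)"
        by (simp add: x_def ad_scale E_def ad_exp_ad)
      have "comm (?T * H * ?S) (?T * ad y * ?S) = ?T * (H * (?S * ?T) * ad y - ad y * (?S * ?T) * H) * ?S"
        unfolding comm_def right_diff_distrib left_diff_distrib by (simp only: mult.assoc)
      also have "\<dots> = ?T * ad y * ?S"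
        using H by (simp add: exp_mat_inverse comm_def)
      finally have "comm (?T * H * ?S) (ad (x s)) = ad (x s)"
        by (simp add: adx comm_simps)
      from tr_grading_action[OF this, of \<phi> c] show ?case
        by (simp add: c killing_commute[of c "x s"])
    qed
  qed
  have "((\<lambda>s. 0) has_field_derivative tr (comm (ad a) H * ad (\<xi> y)) + tr (H * ad (\<xi>' u))) (at 0)"
    using f' DERIV_cong_ev[OF refl ev refl] by blast
  then show ?thesis
    unfolding u_def using DERIV_const DERIV_unique by blast
qed

text \<open>For all sections with the given values, the bracket is \<open>[a, b]\<close> as far as the contact form is
  concerned: apply \<open>section_derivative\<close> to each section in the direction of the other.\<close>

lemma levi_affine_value:
  assumes Z: "nilpotent_orbit br Z" and \<phi>: "Vector_Spaces.linear (*s) (*) \<phi>" "\<phi> y = 1"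
    and y: "ppt {0} y \<in> Z" and H: "comm H (ad y) = ad y"
    and ab: "killing br y a = 0" "killing br y b = 0"
    and w: "action_in_chart br \<phi> y w \<in> levi_affine (orbit_in_chart \<phi> Z) (contact_in_chart br \<phi>) y
         (action_in_chart br \<phi> y a) (action_in_chart br \<phi> y b)"
  shows "killing br y w = killing br y (br a b)"
proof -
  let ?act = "action_in_chart br \<phi> y"
  obtain U \<xi> \<eta> \<xi>' \<eta>' where U: "y \<in> U"
    and \<xi>: "local_section (orbit_in_chart \<phi> Z) (contact_in_chart br \<phi>) U \<xi>" "\<xi> y = ?act a" "(\<xi> has_derivative \<xi>') (at y)"
    and \<eta>: "local_section (orbit_in_chart \<phi> Z) (contact_in_chart br \<phi>) U \<eta>" "\<eta> y = ?act b" "(\<eta> has_derivative \<eta>') (at y)"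
    and D: "?act w - (\<eta>' (?act a) - \<xi>' (?act b)) \<in> contact_in_chart br \<phi> y"
    using w unfolding levi_affine_def by blast
  obtain c where c: "?act w - (\<eta>' (?act a) - \<xi>' (?act b)) = ?act c" "killing br y c = 0"
    using D by (auto simp: contact_in_chart_def contact_space_ppt)
  let ?\<Theta> = "\<lambda>u. tr (H * ad u)"
  have 1: "tr (comm (ad a) H * ad (?act b)) + ?\<Theta> (\<eta>' (?act a)) = 0"
    using section_derivative[OF Z \<phi> y U H \<eta>(1,3)] \<eta>(2) by simp
  have 2: "tr (comm (ad b) H * ad (?act a)) + ?\<Theta> (\<xi>' (?act b)) = 0"
    using section_derivative[OF Z \<phi> y U H \<xi>(1,3)] \<xi>(2) by simp
  have act: "ad (?act e) = comm (ad e) (ad y) - \<phi> (br e y) *m ad y" for e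
    by (simp add: action_in_chart_def ad_diff ad_scale ad_br)
  have 0: "tr (comm (ad e) H * ad y) = killing br y e" for e
    by (simp add: tr_comm H killing_eq) (rule tr_commute)
  have 3: "tr (comm (ad a) H * ad (?act b)) - tr (comm (ad b) H * ad (?act a)) = tr (comm (ad a) (ad b) * ad y)"
    unfolding act grading_jacobi[OF H, symmetric] by (simp add: right_diff_distrib 0 ab)
  have "?act w = ?act c + \<eta>' (?act a) - \<xi>' (?act b)"
    using c(1) by (simp add: algebra_simps)
  then have "?\<Theta> (?act w) = ?\<Theta> (?act c) + ?\<Theta> (\<eta>' (?act a)) - ?\<Theta> (\<xi>' (?act b))"
    by (simp add: ad_add ad_diff distrib_left right_diff_distrib)
  then have "- killing br w y = ?\<Theta> (\<eta>' (?act a)) - ?\<Theta> (\<xi>' (?act b))"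
    by (simp add: tr_grading_action[OF H] killing_commute[of c y] c)
  then have "killing br w y = tr (comm (ad a) (ad b) * ad y)"
    using 1 2 3 by algebra
  then show ?thesis
    by (metis ad_br killing_commute killing_eq)
qed

end

section \<open>The Levi tensor\<close>

context complex_lie_algebra
begin

lemma bounded_bilinear_br: "bounded_bilinear br"
  unfolding bilinear_conv_bounded_bilinear[symmetric] bilinear_def
  by (auto intro!: linearI simp: br_simps scaleR_vec)

lemma bounded_linear_killing: "bounded_linear (\<lambda>x. killing br x w)"
  by (rule linear_functional_bounded) (simp add: Vector_Spaces.linear_iff killing_simps vec.vector_space_axioms vector_space_over_itself.vector_space_axioms)

lemma killing_radical_orbit:
  assumes "nilpotent_orbit br Z" "ppt {0} x \<in> Z" "ppt {0} y \<in> Z" "\<And>w. killing br y w = 0"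
  shows "killing br x w = 0"
proof -
  obtain v where Z: "Z = {ppt {0} (g v) | g. g \<in> Ad_group br}"
    using assms(1) by (auto simp: nilpotent_orbit_def)
  obtain g where g: "g \<in> Ad_group br" "ppt {0} y = ppt {0} (g v)"
    using assms(3) Z by blast
  obtain h where h: "h \<in> Ad_group br" "ppt {0} x = ppt {0} (h v)"
    using assms(2) Z by blast
  obtain d where d: "g v = d *s y"
    using in_ppt_0[of "g v"] g(2) by (auto simp: ppt_0)
  obtain c where c: "x = c *s h v"
    using in_ppt_0[of x] h(2) by (auto simp: ppt_0)
  obtain T S where TS: "T * S = 1" "S * T = 1" "\<And>x. g x = to_mat T *v x" "\<And>x. ad (g x) = T * ad x * S"
    by (rule Ad_group_conj[OF g(1)]) blast
  obtain T' S' where TS': "T' * S' = 1" "S' * T' = 1" "\<And>x. h x = to_mat T' *v x" "\<And>x. ad (h x) = T' * ad x * S'"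
    by (rule Ad_group_conj[OF h(1)]) blast
  define w' where "w' = to_mat S' *v w"
  have "h w' = w"
    by (simp add: TS'(1,3) w'_def matrix_vector_mul_assoc to_mat_1 flip: to_mat_mult)
  then have "killing br (h v) w = killing br v w'"
    using killing_conj[OF TS'(1,2) TS'(4)[of v] TS'(4)[of w']] by simp
  also have "\<dots> = killing br (g v) (g w')"
    using killing_conj[OF TS(1,2) TS(4)[of v] TS(4)[of w']] by simp
  also have "\<dots> = 0"
    by (simp add: d killing_simps assms(4))
  finally show ?thesis
    by (simp add: c killing_simps)
qed

text \<open>The vector \<open>a\<close> is corrected by a multiple of a fixed \<open>c\<close> to be orthogonal to \<open>x\<close>. If the
  orbit lies in the radical of the Killing form there is no such \<open>c\<close>; but then the condition is
  void, and \<open>c = 0\<close> works, because division by \<open>0\<close> gives \<open>q = 0\<close>.\<close>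

lemma contact_section:
  fixes c :: "complex^'n"
  defines "q \<equiv> \<lambda>a x. killing br x a / killing br x c"
  defines "q' \<equiv> \<lambda>a x h. (killing br h a * killing br x c - killing br x a * killing br h c) / (killing br x c * killing br x c)"
  assumes \<phi>: "Vector_Spaces.linear (*s) (*) \<phi>" and U: "open U"
    and c: "(\<forall>x\<in>U. killing br x c \<noteq> 0) \<or> c = 0 \<and> (\<forall>x\<in>orbit_in_chart \<phi> Z. \<forall>w. killing br x w = 0)"
  shows "local_section (orbit_in_chart \<phi> Z) (contact_in_chart br \<phi>) U
      (\<lambda>x. action_in_chart br \<phi> x (a - q a x *s c))"
    "x \<in> U \<Longrightarrow> ((\<lambda>x. action_in_chart br \<phi> x (a - q a x *s c)) has_derivative
      (\<lambda>h. br (a - q a x *s c) h - q' a x h *s br c x - (\<phi> (br (a - q a x *s c) x) *s h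
         + \<phi> (br (a - q a x *s c) h - q' a x h *s br c x) *s x))) (at x)"
proof -
  have dq: "(q a has_derivative q' a x) (at x)" if "x \<in> U" for x
  proof (cases "c = 0")
    case True
    then have "q a = (\<lambda>_. 0)" "q' a x = (\<lambda>_. 0)"
      by (simp_all add: q_def q'_def killing_simps fun_eq_iff)
    then show ?thesis
      by simp
  next
    case False
    then have "killing br x c \<noteq> 0"
      using c that by blast
    then have "((\<lambda>x. killing br x a / killing br x c) has_derivative
      (\<lambda>h. (killing br h a * killing br x c - killing br x a * killing br h c) / (killing br x c * killing br x c))) (at x)"
      by (intro has_derivative_divide' bounded_linear_imp_has_derivative bounded_linear_killing)
    then show ?thesis
      by (simp add: q_def q'_def)
  qed
  have \<phi>s: "\<phi> (x + y) = \<phi> x + \<phi> y" "\<phi> (k *s x) = k * \<phi> x" for x y k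
    using \<phi> by (simp_all add: Vector_Spaces.linear_iff)
  show deriv: "((\<lambda>x. action_in_chart br \<phi> x (a - q a x *s c)) has_derivative
      (\<lambda>h. br (a - q a x *s c) h - q' a x h *s br c x - (\<phi> (br (a - q a x *s c) x) *s h
         + \<phi> (br (a - q a x *s c) h - q' a x h *s br c x) *s x))) (at x)" if x: "x \<in> U" for x
  proof -
    have "((\<lambda>x. q a x *s c) has_derivative (\<lambda>h. q' a x h *s c)) (at x)"
      using has_derivative_smult[OF dq[OF x] has_derivative_const[of c]] by simp
    then have "((\<lambda>x. a - q a x *s c) has_derivative (\<lambda>h. - (q' a x h *s c))) (at x)"
      using has_derivative_diff[OF has_derivative_const] by fastforce
    from bounded_bilinear.FDERIV[OF bounded_bilinear_br this has_derivative_ident]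
    have B: "((\<lambda>x. br (a - q a x *s c) x) has_derivative (\<lambda>h. br (a - q a x *s c) h - q' a x h *s br c x)) (at x)"
      by (simp add: br_more br_simps)
    have "((\<lambda>x. \<phi> (br (a - q a x *s c) x)) has_derivative (\<lambda>h. \<phi> (br (a - q a x *s c) h - q' a x h *s br c x))) (at x)"
      by (rule bounded_linear.has_derivative[OF linear_functional_bounded[OF \<phi>] B])
    from has_derivative_diff[OF B has_derivative_smult[OF this has_derivative_ident]]
    show ?thesis
      by (simp add: action_in_chart_def)
  qed
  show "local_section (orbit_in_chart \<phi> Z) (contact_in_chart br \<phi>) U
      (\<lambda>x. action_in_chart br \<phi> x (a - q a x *s c))"
    unfolding local_section_def cholomorphic_on_def
  proof (intro conjI ballI U exI)
    fix x assume x: "x \<in> U"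
    show "((\<lambda>x. action_in_chart br \<phi> x (a - q a x *s c)) has_derivative
      (\<lambda>h. br (a - q a x *s c) h - q' a x h *s br c x - (\<phi> (br (a - q a x *s c) x) *s h
         + \<phi> (br (a - q a x *s c) h - q' a x h *s br c x) *s x))) (at x)"
      by (rule deriv[OF x])
    have q': "q' a x (h + k) = q' a x h + q' a x k" "q' a x (l *s h) = l * q' a x h" for h k l
      by (simp_all add: q'_def killing_simps algebra_simps add_divide_distrib diff_divide_distrib)
    define L where "L h = br (a - q a x *s c) h - q' a x h *s br c x" for h
    have L: "L (h + k) = L h + L k" "L (l *s h) = l *s L h" for h k l
      by (simp_all add: L_def br_simps q' vec_eq_iff algebra_simps)
    show "Vector_Spaces.linear (*s) (*s) (\<lambda>h. br (a - q a x *s c) h - q' a x h *s br c x - (\<phi> (br (a - q a x *s c) x) *s h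
         + \<phi> (br (a - q a x *s c) h - q' a x h *s br c x) *s x))"
      unfolding Vector_Spaces.linear_iff L_def[symmetric]
      by (auto simp: vec.vector_space_axioms L \<phi>s vec_eq_iff algebra_simps)
  next
    fix x assume x: "x \<in> orbit_in_chart \<phi> Z \<inter> U"
    have "killing br x (a - q a x *s c) = 0"
      using c x by (auto simp: killing_simps q_def)
    then show "action_in_chart br \<phi> x (a - q a x *s c) \<in> contact_in_chart br \<phi> x"
      unfolding contact_in_chart_def contact_space_ppt by blast
  qed
qed

lemma levi_affine_contains:
  assumes Z: "nilpotent_orbit br Z" and \<phi>: "Vector_Spaces.linear (*s) (*) \<phi>" "\<phi> y = 1"
    and y: "ppt {0} y \<in> Z"
    and ab: "killing br y a = 0" "killing br y b = 0" "killing br y (br a b) = 0"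
    and w: "killing br y w = 0"
  shows "action_in_chart br \<phi> y w \<in> levi_affine (orbit_in_chart \<phi> Z) (contact_in_chart br \<phi>) y
         (action_in_chart br \<phi> y a) (action_in_chart br \<phi> y b)"
proof -
  have "\<exists>c U. open U \<and> y \<in> U \<and> ((\<forall>x\<in>U. killing br x c \<noteq> 0) \<or> c = 0 \<and> (\<forall>x\<in>orbit_in_chart \<phi> Z. \<forall>w. killing br x w = 0))"
  proof (cases "\<exists>c. killing br y c \<noteq> 0")
    case True
    then obtain c where "killing br y c \<noteq> 0"
      by blast
    moreover have "open {x. killing br x c \<noteq> 0}"
      by (intro open_Collect_neq linear_continuous_on[OF bounded_linear_killing] continuous_on_const)
    ultimately show ?thesis
      by (intro exI[of _ c] exI[of _ "{x. killing br x c \<noteq> 0}"]) simp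
  next
    case False
    then have "killing br x w = 0" if "x \<in> orbit_in_chart \<phi> Z" for x w
      using killing_radical_orbit[OF Z _ y] that by (auto simp: orbit_in_chart_def)
    then show ?thesis
      by (intro exI[of _ 0] exI[of _ UNIV]) simp
  qed
  then obtain c U where U: "open U" "y \<in> U"
    and c: "(\<forall>x\<in>U. killing br x c \<noteq> 0) \<or> c = 0 \<and> (\<forall>x\<in>orbit_in_chart \<phi> Z. \<forall>w. killing br x w = 0)"
    by blast
  note sec = contact_section[OF \<phi>(1) U(1) c]
  let ?act = "action_in_chart br \<phi> y"
  have \<phi>s: "\<phi> (x + y) = \<phi> x + \<phi> y" "\<phi> (k *s x) = k * \<phi> x" for x y k
    using \<phi> by (simp_all add: Vector_Spaces.linear_iff)
  have \<phi>d: "\<phi> (x - y) = \<phi> x - \<phi> y" for x y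
    by (metis \<phi>s(1) add_diff_cancel_right' diff_add_cancel)
  define Q where "Q e h = (killing br h e * killing br y c - killing br y e * killing br h c) / (killing br y c * killing br y c)" for e h
  define \<xi>' where "\<xi>' e h = br e h - Q e h *s br c y - (\<phi> (br e y) *s h + \<phi> (br e h - Q e h *s br c y) *s y)" for e h
  have d: "((\<lambda>x. action_in_chart br \<phi> x (e - (killing br x e / killing br x c) *s c)) has_derivative \<xi>' e) (at y)"
    if "killing br y e = 0" for e
    using sec(2)[OF U(2), of e] by (simp add: that \<xi>'_def[abs_def] Q_def)
  define e where "e = br b a - Q b (?act a) *s c + Q a (?act b) *s c"
  have bracket: "\<xi>' b (?act a) - \<xi>' a (?act b) = ?act e"
  proof -
    have jac: "br b (br a y) = br (br b a) y + br a (br b y)"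
      by (rule br_jacobi)
    show ?thesis
      unfolding \<xi>'_def e_def
      by (simp add: action_in_chart_def br_simps br_more jac \<phi>s \<phi>d \<phi>(2) vec_eq_iff algebra_simps)
  qed
  have Q: "Q p (?act r) * killing br y c = 0" if "killing br y p = 0" "killing br y (br r p) = 0" for p r
  proof -
    have "killing br (?act r) p = killing br (br r y) p"
      by (simp add: action_in_chart_def killing_simps that)
    also have "br r y = - br y r"
      by (rule br_skew)
    also have "killing br (- br y r) p = - killing br (br y r) p"
      by (simp add: killing_eq ad_uminus)
    also have "\<dots> = - killing br y (br r p)"
      by (simp add: killing_invariant)
    finally have "killing br (?act r) p = 0"
      by (simp add: that)
    then show ?thesis
      by (simp add: Q_def that)
  qed
  have ba: "killing br y (br b a) = 0"
    using ab(3) br_skew[of b a] by (simp add: killing_eq ad_uminus)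
  have "killing br y e = 0"
    unfolding e_def killing_simps using Q[OF ab(2) ab(3)] Q[OF ab(1) ba] ba by auto
  then have "?act w - ?act e \<in> contact_in_chart br \<phi> y"
    unfolding contact_in_chart_def contact_space_ppt
    by (intro image_eqI[of _ _ "w - e"])
      (simp_all add: action_in_chart_def br_more \<phi>d vec_eq_iff algebra_simps w killing_simps)
  then have D: "?act w - (\<xi>' b (?act a) - \<xi>' a (?act b)) \<in> contact_in_chart br \<phi> y"
    by (simp add: bracket)
  show ?thesis
    unfolding levi_affine_def
    by (rule CollectI, rule exI[where x = U],
        rule exI[where x = "\<lambda>x. action_in_chart br \<phi> x (a - (killing br x a / killing br x c) *s c)"],
        rule exI[where x = "\<lambda>x. action_in_chart br \<phi> x (b - (killing br x b / killing br x c) *s c)"],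
        rule exI[where x = "\<xi>' a"], rule exI[where x = "\<xi>' b"])
      (use U sec(1)[of a] sec(1)[of b] d[OF ab(1)] d[OF ab(2)] D ab in simp)
qed

text \<open>The two inclusions are of different nature: arbitrary local sections have to be considered for
  one (\<open>levi_affine_value\<close>), and sections have to be constructed for the other
  (\<open>levi_affine_contains\<close>).\<close>

theorem levi_tensor_eq_contact_space:
  assumes Z: "nilpotent_orbit br Z" and z: "ppt {0} y \<in> Z" "y \<noteq> 0" and nil: "ad y ^ m = 0"
    and ab: "killing br y a = 0" "killing br y b = 0" "killing br y (br a b) = 0"
  shows "levi_tensor br Z (ppt {0} y) a b = contact_space br (ppt {0} y)"
proof (intro equalityI subsetI)
  fix w assume "w \<in> levi_tensor br Z (ppt {0} y) a b"
  then obtain \<phi> v where \<phi>: "Vector_Spaces.linear (*s) (*) \<phi>" "\<phi> v = 1" and v: "v \<in> ppt {0} y"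
    and w: "action_in_chart br \<phi> v w \<in> levi_affine (orbit_in_chart \<phi> Z) (contact_in_chart br \<phi>) v
         (action_in_chart br \<phi> v a) (action_in_chart br \<phi> v b)"
    by (auto simp: levi_tensor_def)
  obtain k where k: "v = k *s y"
    using v by (auto simp: ppt_0)
  have k0: "k \<noteq> 0"
    using \<phi> k by (auto simp: Vector_Spaces.linear_iff)
  have pv: "ppt {0} v \<in> Z"
    using z(1) k0 by (simp add: k ppt_0_scale)
  obtain H where H: "comm H (ad y) = ad y"
    by (rule grading_matrix[OF nil])
  have "comm H (ad v) = ad v"
    by (simp add: k ad_scale comm_simps H)
  from levi_affine_value[OF Z \<phi> pv this _ _ w] show "w \<in> contact_space br (ppt {0} y)"
    using ab k0 by (simp add: contact_space_ppt k killing_simps)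
next
  fix w assume w: "w \<in> contact_space br (ppt {0} y)"
  obtain i where i: "y $ i \<noteq> 0"
    using z(2) by (auto simp: vec_eq_iff)
  define \<phi> where "\<phi> x = x $ i / y $ i" for x
  have \<phi>: "Vector_Spaces.linear (*s) (*) \<phi>" "\<phi> y = 1"
    using i by (simp_all add: Vector_Spaces.linear_iff \<phi>_def vec.vector_space_axioms vector_space_over_itself.vector_space_axioms add_divide_distrib)
  have "action_in_chart br \<phi> y w \<in> levi_affine (orbit_in_chart \<phi> Z) (contact_in_chart br \<phi>) y
         (action_in_chart br \<phi> y a) (action_in_chart br \<phi> y b)"
    using w by (intro levi_affine_contains[OF Z \<phi> z(1) ab]) (simp add: contact_space_ppt)
  then show "w \<in> levi_tensor br Z (ppt {0} y) a b"
    unfolding levi_tensor_def using \<phi> in_ppt_0 by blast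
qed

end

section \<open>Lines in the closure of a nilpotent orbit\<close>

definition orbit_cone :: "(complex^'n) set set \<Rightarrow> (complex^'n) set" where
  "orbit_cone Z = {x. x \<noteq> 0 \<and> ppt {0} x \<in> Z}"

lemma zariski_closure_vanishing:
  assumes "\<And>L. L \<in> Z \<Longrightarrow> \<exists>v. v \<noteq> 0 \<and> L = ppt {0} v"
    and "x \<noteq> 0" "ppt {0} x \<in> zariski_closure UNIV {0} Z" "vanishing_on (orbit_cone Z) d p"
  shows "p x = 0"
proof -
  let ?Y = "{ppt {0} a | a. a \<in> UNIV - {0} \<and> (\<forall>p\<in>{p}. p a = 0)}"
  have "zariski_closed UNIV {0} ?Y"
    unfolding zariski_closed_def using assms(4)
    by (intro exI[of _ "{p}"]) (auto simp: homogeneous_poly_iff vanishing_on_def)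
  moreover have "Z \<subseteq> ?Y"
  proof
    fix L assume L: "L \<in> Z"
    then obtain v where "v \<noteq> 0" "L = ppt {0} v"
      using assms(1) by blast
    then show "L \<in> ?Y"
      using assms(4) L by (auto simp: vanishing_on_def orbit_cone_def)
  qed
  ultimately have "ppt {0} x \<in> ?Y"
    using assms(3) unfolding zariski_closure_def by blast
  then obtain a where a: "ppt {0} x = ppt {0} a" "p a = 0"
    by auto
  obtain c where "x = c *s a"
    using in_ppt_0[of x] a(1) by (auto simp: ppt_0)
  then show ?thesis
    using hpoly_scale[of d p c a] a(2) assms(4) by (simp add: vanishing_on_def)
qed

lemma in_zariski_closureI:
  assumes "\<And>L. L \<in> Z \<Longrightarrow> \<exists>v. v \<noteq> 0 \<and> L = ppt {0} v"
    and "x \<noteq> 0" "\<And>d p. vanishing_on (orbit_cone Z) d p \<Longrightarrow> p x = 0"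
  shows "ppt {0} x \<in> zariski_closure UNIV {0} Z"
  unfolding zariski_closure_def
proof (clarsimp)
  fix Y assume Y: "zariski_closed UNIV {0} Y" "Z \<subseteq> Y"
  obtain S where S': "(\<forall>p\<in>S. homogeneous_poly p \<and> (\<forall>a\<in>UNIV. \<forall>b\<in>{0}. p (a + b) = p a)) \<and>
    Y = {ppt {0} a | a. a \<in> UNIV - {0} \<and> (\<forall>p\<in>S. p a = 0)}"
    using Y(1) unfolding zariski_closed_def by (elim exE) (rule that)
  have S: "homogeneous_poly p" if "p \<in> S" for p
    using S' that by blast
  have Y': "Y = {ppt {0} a | a. a \<in> UNIV - {0} \<and> (\<forall>p\<in>S. p a = 0)}"
    using S' by (rule conjunct2)
  have "p x = 0" if pS: "p \<in> S" for p
  proof -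
    obtain d where d: "hpoly d p"
      using S[OF pS] by (auto simp: homogeneous_poly_iff)
    have "p w = 0" if w: "w \<in> orbit_cone Z" for w
    proof -
      have "ppt {0} w \<in> Y"
        using w Y(2) by (auto simp: orbit_cone_def)
      then obtain a where a: "ppt {0} w = ppt {0} a" "p a = 0"
        using Y' \<open>p \<in> S\<close> by auto
      obtain c where "w = c *s a"
        using in_ppt_0[of w] a(1) by (auto simp: ppt_0)
      then show ?thesis
        using hpoly_scale[OF d, of c a] a(2) by simp
    qed
    then show ?thesis
      using assms(3) d by (auto simp: vanishing_on_def)
  qed
  then show "ppt {0} x \<in> Y"
    using Y' assms(2) by blast
qed

lemma ppt_eq:
  assumes "a \<in> ppt B b" "a \<notin> B" "vec.subspace B"
  shows "ppt B a = ppt B b"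
proof -
  have B: "vec.span B = B"
    using assms(3) by (rule vec.span_eq_iff[THEN iffD2])
  have a: "a \<in> vec.span (insert b B)"
    using assms(1) by (simp add: ppt_def)
  have "a \<notin> vec.span B"
    unfolding B by (rule assms(2))
  with a have "b \<in> vec.span (insert a B)"
    by (rule vec.in_span_insert)
  with a have "vec.span (insert a B) = vec.span (insert b B)"
    unfolding vec.span_eq by (auto intro: vec.span_base)
  then show ?thesis
    by (simp add: ppt_def)
qed

lemma conj_power: "(T * A * S) ^ k = T * A ^ k * S" if "S * T = 1" "T * S = 1" for A :: "'a::ring_1"
proof (induction k)
  case (Suc k)
  have "(T * A * S) ^ Suc k = T * A * (S * T) * A ^ k * S"
    unfolding power_Suc Suc by (simp only: mult.assoc)
  then show ?case
    by (simp add: that mult.assoc)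
qed (simp add: that)

lemma scale_power: "(c *m A) ^ k = c ^ k *m A ^ k" for A :: "('a::comm_ring_1, 'n::finite) sqmat"
  by (induction k) (simp_all add: mult.commute)

text \<open>Conjugation maps the centralizer of \<open>A\<close> injectively to that of its conjugate.\<close>

lemma dim_kernel_conj_le:
  fixes A T S :: "(complex, 'n::finite) sqmat"
  assumes "T * S = 1" "S * T = 1"
  shows "vec.dim (mat_kernel (bracket_matrix A)) \<le> vec.dim (mat_kernel (bracket_matrix (c *m (T * A * S))))"
proof -
  define \<Phi> :: "complex^('n \<times> 'n) \<Rightarrow> complex^('n \<times> 'n)" where
    "\<Phi> w = (\<chi> p. flat (T * unflat (\<lambda>p. w $ p) * S) p)" for w
  have unflat: "unflat (\<lambda>p. (v + w) $ p) = unflat (\<lambda>p. v $ p) + unflat (\<lambda>p. w $ p)"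
    "unflat (\<lambda>p. (k *s w) $ p) = k *m unflat (\<lambda>p. w $ p)" for v w :: "complex^('n \<times> 'n)" and k
    by (auto intro!: sqmat_eqI simp: unflat_def)
  have lin: "Vector_Spaces.linear (*s) (*s) \<Phi>"
    unfolding Vector_Spaces.linear_iff \<Phi>_def unflat
    by (auto simp: vec.vector_space_axioms distrib_left distrib_right vec_eq_iff flat_def)
  have unflat_\<Phi>: "unflat (\<lambda>p. \<Phi> w $ p) = T * unflat (\<lambda>p. w $ p) * S" for w
    by (simp add: \<Phi>_def)
  have inj: "inj \<Phi>"
  proof (rule injI)
    fix v w assume "\<Phi> v = \<Phi> w"
    then have "T * unflat (\<lambda>p. v $ p) * S = T * unflat (\<lambda>p. w $ p) * S"
      by (metis unflat_\<Phi>)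
    then have "S * (T * unflat (\<lambda>p. v $ p) * S) * T = S * (T * unflat (\<lambda>p. w $ p) * S) * T"
      by simp
    moreover have "S * (T * X * S) * T = (S * T) * X * (S * T)" for X
      by (simp add: mult.assoc)
    ultimately have "unflat (\<lambda>p. v $ p) = unflat (\<lambda>p. w $ p)"
      by (simp add: assms)
    then show "v = w"
      by (metis flat_unflat vec_lambda_eta)
  qed
  have ker: "w \<in> mat_kernel (bracket_matrix X) \<longleftrightarrow> comm (unflat (\<lambda>p. w $ p)) X = 0" for w and X :: "(complex, 'n) sqmat"
  proof -
    have "to_mat (bracket_matrix X) *v w = (\<chi> p. flat (comm (unflat (\<lambda>p. w $ p)) X) p)"
      by (simp add: to_mat_vec flip: app_bracket_matrix)
    then show ?thesis
      by (auto simp: mat_kernel_def vec_eq_iff flat_def intro!: sqmat_eqI)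
  qed
  have "\<Phi> ` mat_kernel (bracket_matrix A) \<subseteq> mat_kernel (bracket_matrix (c *m (T * A * S)))"
  proof (clarsimp simp: ker unflat_\<Phi>)
    fix w assume w: "comm (unflat (\<lambda>p. w $ p)) A = 0"
    have "comm (T * X * S) (T * A * S) = T * (X * (S * T) * A - A * (S * T) * X) * S" for X
      unfolding comm_def right_diff_distrib left_diff_distrib by (simp only: mult.assoc)
    then have conj: "comm (T * X * S) (T * A * S) = T * comm X A * S" for X
      by (simp add: assms comm_def)
    show "comm (T * unflat (\<lambda>p. w $ p) * S) (c *m (T * A * S)) = 0"
      unfolding comm_simps conj w by simp
  qed
  then have "vec.dim (\<Phi> ` mat_kernel (bracket_matrix A)) \<le> vec.dim (mat_kernel (bracket_matrix (c *m (T * A * S))))"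
    by (rule vec.dim_subset)
  moreover have "vec.dim (\<Phi> ` mat_kernel (bracket_matrix A)) = vec.dim (mat_kernel (bracket_matrix A))"
    by (rule vec.dim_image_eq[OF lin]) (use inj in \<open>auto intro: inj_on_subset\<close>)
  ultimately show ?thesis
    by simp
qed

lemma dim_kernel_conj:
  fixes A T S :: "(complex, 'n::finite) sqmat"
  assumes "T * S = 1" "S * T = 1" "c \<noteq> 0"
  shows "vec.dim (mat_kernel (bracket_matrix (c *m (T * A * S)))) = vec.dim (mat_kernel (bracket_matrix A))"
proof (rule antisym)
  have "(1 / c) *m (S * (c *m (T * A * S)) * T) = (S * T) * A * (S * T)"
    using assms(3) by (simp add: mult.assoc)
  then have "(1 / c) *m (S * (c *m (T * A * S)) * T) = A"
    by (simp add: assms)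
  then show "vec.dim (mat_kernel (bracket_matrix (c *m (T * A * S)))) \<le> vec.dim (mat_kernel (bracket_matrix A))"
    using dim_kernel_conj_le[OF assms(2,1), of "c *m (T * A * S)" "1 / c"] by simp
qed (rule dim_kernel_conj_le[OF assms(1,2)])

context complex_lie_algebra
begin

lemma nilpotent_cone:
  assumes "nilpotent_orbit br Z"
  shows "\<exists>m k. \<forall>x\<in>orbit_cone Z. ad x ^ m = 0 \<and> vec.dim (mat_kernel (bracket_matrix (ad x))) = k"
    and "\<And>L. L \<in> Z \<Longrightarrow> \<exists>v. v \<noteq> 0 \<and> L = ppt {0} v"
proof -
  obtain v where v: "v \<noteq> 0" "ad_nilpotent br v" and Z: "Z = {ppt {0} (g v) | g. g \<in> Ad_group br}"
    using assms by (auto simp: nilpotent_orbit_def)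
  obtain m where m: "ad v ^ m = 0"
    by (rule ad_nilpotent_power[OF v(2)])
  have "ad x ^ m = 0 \<and> vec.dim (mat_kernel (bracket_matrix (ad x))) = vec.dim (mat_kernel (bracket_matrix (ad v)))"
    if x: "x \<in> orbit_cone Z" for x
  proof -
    obtain g where g: "g \<in> Ad_group br" "ppt {0} x = ppt {0} (g v)"
      using x Z by (auto simp: orbit_cone_def)
    obtain c where c: "x = c *s g v"
      using in_ppt_0[of x] g(2) by (auto simp: ppt_0)
    have c0: "c \<noteq> 0"
      using x c by (auto simp: orbit_cone_def)
    obtain T S where TS: "T * S = 1" "S * T = 1" "\<And>x. g x = to_mat T *v x" "\<And>x. ad (g x) = T * ad x * S"
      by (rule Ad_group_conj[OF g(1)]) blast
    have "ad x = c *m (T * ad v * S)"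
      by (simp add: c ad_scale TS(4))
    then show ?thesis
      using dim_kernel_conj[OF TS(1,2) c0, of "ad v"] conj_power[OF TS(2,1), of "ad v" m]
      by (simp add: scale_power m)
  qed
  then show "\<exists>m k. \<forall>x\<in>orbit_cone Z. ad x ^ m = 0 \<and> vec.dim (mat_kernel (bracket_matrix (ad x))) = k"
    by blast
  show "\<exists>v. v \<noteq> 0 \<and> L = ppt {0} v" if L: "L \<in> Z" for L
  proof -
    obtain g where g: "g \<in> Ad_group br" "L = ppt {0} (g v)"
      using L Z by blast
    obtain T S where TS: "T * S = 1" "S * T = 1" "\<And>x. g x = to_mat T *v x" "\<And>x. ad (g x) = T * ad x * S"
      by (rule Ad_group_conj[OF g(1)]) blast
    have "to_mat S *v g v = v"
      by (simp add: TS(2,3) matrix_vector_mul_assoc to_mat_1 flip: to_mat_mult)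
    then have "g v \<noteq> 0"
      using v(1) by auto
    then show ?thesis
      using g(2) by blast
  qed
qed

lemma lie_stab_ppt: "lie_stab br (ppt {0} y) = {w. \<exists>c. br w y = c *s y}"
proof -
  have "(\<forall>x\<in>ppt {0} y. br w x \<in> ppt {0} y) \<longleftrightarrow> (\<exists>c. br w y = c *s y)" for w
  proof
    assume "\<forall>x\<in>ppt {0} y. br w x \<in> ppt {0} y"
    then have "br w y \<in> ppt {0} y"
      using in_ppt_0 by blast
    then show "\<exists>c. br w y = c *s y"
      by (auto simp: ppt_0)
  next
    assume "\<exists>c. br w y = c *s y"
    then obtain c where c: "br w y = c *s y" ..
    have "br w (k *s y) = (k * c) *s y" for k
      by (simp add: br_simps c)
    then show "\<forall>x\<in>ppt {0} y. br w x \<in> ppt {0} y"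
      by (auto simp: ppt_0)
  qed
  then show ?thesis
    by (simp add: lie_stab_def)
qed

lemma subspace_lie_stab: "vec.subspace (lie_stab br (ppt {0} y))"
  unfolding lie_stab_ppt
proof (rule vec.subspaceI)
  have "br 0 y = 0 *s y"
    by (simp add: br_more)
  then show "0 \<in> {w. \<exists>c. br w y = c *s y}"
    by blast
next
  fix u v assume "u \<in> {w. \<exists>c. br w y = c *s y}" "v \<in> {w. \<exists>c. br w y = c *s y}"
  then obtain c d where "br u y = c *s y" "br v y = d *s y"
    by blast
  then have "br (u + v) y = (c + d) *s y"
    by (simp add: br_simps vector_sadd_rdistrib)
  then show "u + v \<in> {w. \<exists>c. br w y = c *s y}"
    by blast
next
  fix k u assume "u \<in> {w. \<exists>c. br w y = c *s y}"
  then obtain c where "br u y = c *s y"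
    by blast
  then have "br (k *s u) y = (k * c) *s y"
    by (simp add: br_simps)
  then show "k *s u \<in> {w. \<exists>c. br w y = c *s y}"
    by blast
qed

lemma in_ppt_stab: "w \<in> ppt (lie_stab br (ppt {0} y)) a \<longleftrightarrow> (\<exists>k. w - k *s a \<in> lie_stab br (ppt {0} y))"
proof -
  have "vec.span (lie_stab br (ppt {0} y)) = lie_stab br (ppt {0} y)"
    using subspace_lie_stab by (rule vec.span_eq_iff[THEN iffD2])
  then show ?thesis
    unfolding ppt_def[of "lie_stab br (ppt {0} y)"] vec.span_breakdown_eq by (simp only:)
qed

text \<open>The line through \<open>z\<close> with direction \<open>a\<close> is spanned by \<open>y\<close> and \<open>[a, y]\<close>, so membership in \<open>F\<close>
  amounts to polynomial equations.\<close>

lemma line_directions_iff: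
  assumes Z: "nilpotent_orbit br Z" and y: "y \<in> orbit_cone Z" and a: "a \<notin> lie_stab br (ppt {0} y)"
  shows "ppt (lie_stab br (ppt {0} y)) a \<in> line_directions br (zariski_closure UNIV {0} Z) (ppt {0} y)
    \<longleftrightarrow> (\<forall>s t d p. vanishing_on (orbit_cone Z) d p \<longrightarrow> p (s *s y + t *s br a y) = 0)"
proof
  let ?B = "lie_stab br (ppt {0} y)"
  note Zl = nilpotent_cone(2)[OF Z]
  assume "ppt ?B a \<in> line_directions br (zariski_closure UNIV {0} Z) (ppt {0} y)"
  then obtain P where P: "vec.subspace P" "proj_space P {0} \<subseteq> zariski_closure UNIV {0} Z"
      "ppt {0} y \<in> proj_space P {0}" "ppt ?B a = {w. \<forall>x\<in>ppt {0} y. br w x \<in> P}"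
    by (auto simp: line_directions_def is_line_def)
  have "a \<in> ppt ?B a"
    by (simp add: ppt_def vec.span_base)
  then have ay: "br a y \<in> P"
    using P(4) in_ppt_0 by blast
  obtain b where b: "b \<in> P" "ppt {0} y = ppt {0} b"
    using P(3) by (auto simp: proj_space_def)
  obtain c where "y = c *s b"
    using in_ppt_0[of y] b(2) by (auto simp: ppt_0)
  then have yP: "y \<in> P"
    using b(1) P(1) by (simp add: vec.subspace_scale)
  show "\<forall>s t d p. vanishing_on (orbit_cone Z) d p \<longrightarrow> p (s *s y + t *s br a y) = 0"
  proof (intro allI impI)
    fix s t d p assume p: "vanishing_on (orbit_cone Z) d p"
    have x: "s *s y + t *s br a y \<in> P"
      using yP ay P(1) by (simp add: vec.subspace_add vec.subspace_scale)
    show "p (s *s y + t *s br a y) = 0"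
    proof (cases "s *s y + t *s br a y = 0")
      case True
      have "p (0 *s y) = 0 ^ d * p y"
        using p by (intro hpoly_scale) (simp add: vanishing_on_def)
      then show ?thesis
        using True p y by (simp add: vanishing_on_def)
    next
      case False
      then have "ppt {0} (s *s y + t *s br a y) \<in> zariski_closure UNIV {0} Z"
        using P(2) x by (auto simp: proj_space_def)
      from zariski_closure_vanishing[OF Zl False this p] show ?thesis .
    qed
  qed
next
  let ?B = "lie_stab br (ppt {0} y)"
  note Zl = nilpotent_cone(2)[OF Z]
  assume van: "\<forall>s t d p. vanishing_on (orbit_cone Z) d p \<longrightarrow> p (s *s y + t *s br a y) = 0"
  define P where "P = vec.span {y, br a y}"
  have P: "w \<in> P \<longleftrightarrow> (\<exists>s t. w = s *s y + t *s br a y)" for w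
    unfolding P_def vec.span_breakdown_eq vec.span_empty
    by (auto simp: algebra_simps)
  have y0: "y \<noteq> 0"
    using y by (simp add: orbit_cone_def)
  have "br a y \<notin> vec.span {y}"
    using a by (auto simp: lie_stab_ppt vec.span_singleton)
  then have "vec.dim P = 2"
    unfolding P_def vec.dim_span using y0 by (subst insert_commute) (simp add: vec.dim_insert)
  then have line: "is_line (proj_space P {0}) P"
    by (simp add: is_line_def P_def)
  have sub: "proj_space P {0} \<subseteq> zariski_closure UNIV {0} Z"
  proof
    fix L assume "L \<in> proj_space P {0}"
    then obtain b where b: "b \<in> P" "b \<noteq> 0" "L = ppt {0} b"
      by (auto simp: proj_space_def)
    obtain s t where "b = s *s y + t *s br a y"
      using b(1) P by blast
    then have "p b = 0" if "vanishing_on (orbit_cone Z) d p" for d p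
      using van that by blast
    then show "L \<in> zariski_closure UNIV {0} Z"
      unfolding b(3) by (intro in_zariski_closureI Zl b(2))
  qed
  have yP: "y \<in> P"
    by (simp add: P_def vec.span_base)
  then have z: "ppt {0} y \<in> proj_space P {0}"
    using y0 by (auto simp: proj_space_def)
  have "ppt ?B a = {w. \<forall>x\<in>ppt {0} y. br w x \<in> P}"
  proof (intro equalityI subsetI)
    fix w assume "w \<in> ppt ?B a"
    then obtain k c where "br (w - k *s a) y = c *s y"
      unfolding in_ppt_stab unfolding lie_stab_ppt by blast
    then have "br w y = c *s y + k *s br a y"
      by (simp add: br_simps br_more algebra_simps)
    then have "br w y \<in> P"
      using P by blast
    then have "br w (e *s y) \<in> P" for e
      by (simp add: br_simps P_def vec.span_scale)
    then show "w \<in> {w. \<forall>x\<in>ppt {0} y. br w x \<in> P}"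
      by (auto simp: ppt_0)
  next
    fix w assume "w \<in> {w. \<forall>x\<in>ppt {0} y. br w x \<in> P}"
    then have "br w y \<in> P"
      using in_ppt_0 by blast
    then obtain s t where "br w y = s *s y + t *s br a y"
      using P by blast
    then have "br (w - t *s a) y = s *s y"
      by (simp add: br_simps br_more)
    then show "w \<in> ppt ?B a"
      unfolding in_ppt_stab unfolding lie_stab_ppt by blast
  qed
  then show "ppt ?B a \<in> line_directions br (zariski_closure UNIV {0} Z) (ppt {0} y)"
    unfolding line_directions_def using line sub z a by (auto simp: proj_space_def)
qed

text \<open>If \<open>[b, y] = c y\<close>, then \<open>\<kappa>(b, y) = - tr (H [ad b, Y]) = - c tr (H Y)\<close>, and
  \<open>tr (H Y) = tr (H [H, Y]) = 0\<close>.\<close>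

lemma lie_stab_subset_contact:
  assumes "ad y ^ m = 0"
  shows "lie_stab br (ppt {0} y) \<subseteq> contact_space br (ppt {0} y)"
proof
  fix b assume "b \<in> lie_stab br (ppt {0} y)"
  then obtain c where c: "br b y = c *s y"
    by (auto simp: lie_stab_ppt)
  obtain H where H: "comm H (ad y) = ad y"
    by (rule grading_matrix[OF assms])
  have "- tr (ad b * ad y) = tr (H * comm (ad b) (ad y))"
    by (simp add: tr_grading(2)[OF H])
  also have "\<dots> = c * tr (H * ad y)"
    by (simp add: c ad_scale flip: ad_br)
  also have "\<dots> = 0"
    by (simp add: tr_grading(1)[OF H])
  finally have "killing br b y = 0"
    by (simp add: killing_eq)
  then show "b \<in> contact_space br (ppt {0} y)"
    by (simp add: contact_space_ppt killing_commute[of y])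
qed

theorem line_directions_integral:
  assumes Z: "nilpotent_orbit br Z" and z: "z \<in> Z"
  defines "F \<equiv> line_directions br (zariski_closure UNIV {0} Z) z"
  shows "F \<subseteq> proj_space (contact_space br z) (lie_stab br z)"
    and "integral_subvariety (contact_space br z) (lie_stab br z) (levi_hyperplane br Z z) F"
proof -
  obtain y where y0: "y \<noteq> 0" and zy: "z = ppt {0} y"
    using nilpotent_cone(2)[OF Z z] by blast
  have y: "y \<in> orbit_cone Z"
    using z y0 by (simp add: orbit_cone_def zy)
  obtain m k where mk: "\<And>x. x \<in> orbit_cone Z \<Longrightarrow> ad x ^ m = 0"
      "\<And>x. x \<in> orbit_cone Z \<Longrightarrow> vec.dim (mat_kernel (bracket_matrix (ad x))) = k"
    using nilpotent_cone(1)[OF Z] by blast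
  define A B where "A = contact_space br z" and "B = lie_stab br z"
  have A: "A = {w. killing br y w = 0}"
    by (simp add: A_def zy contact_space_ppt)
  have B: "B = {w. \<exists>c. br w y = c *s y}"
    by (simp add: B_def zy lie_stab_ppt)
  have subB: "vec.subspace B"
    unfolding B_def zy by (rule subspace_lie_stab)
  have BA: "B \<subseteq> A"
    unfolding A_def B_def zy by (rule lie_stab_subset_contact[OF mk(1)[OF y]])
  note inF = line_directions_iff[OF Z y, folded zy, folded B_def F_def]
  have in_ppt: "w \<in> ppt B a \<longleftrightarrow> (\<exists>k. w - k *s a \<in> B)" for w a
    unfolding B_def zy by (rule in_ppt_stab)
  have F_cases: "\<exists>a. a \<notin> B \<and> T = ppt B a" if "T \<in> F" for T
    using that by (auto simp: F_def line_directions_def proj_space_def B_def)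
  have rank: "vec.dim (mat_kernel (bracket_matrix (ad x))) = vec.dim (mat_kernel (bracket_matrix (ad y)))"
    if "x \<in> orbit_cone Z" for x
    using that by (simp add: mk(2) y)
  have isotropic: "killing br (\<alpha> 0) y = 0" "killing br (br (\<alpha> 0) (\<chi> i. deriv (\<lambda>s. \<alpha> s $ i) 0)) y = 0"
    if "r > 0" "\<And>i. (\<lambda>s. \<alpha> s $ i) holomorphic_on ball 0 r"
      "\<And>s. s \<in> ball 0 r \<Longrightarrow> \<alpha> s \<notin> B \<and> ppt B (\<alpha> s) \<in> F" for r \<alpha>
  proof -
    have lines: "p (a *s y + b *s br (\<alpha> s) y) = 0"
      if "s \<in> ball 0 r" "vanishing_on (orbit_cone Z) d p" for s a b d p
      using inF[of "\<alpha> s"] that \<open>\<And>s. s \<in> ball 0 r \<Longrightarrow> \<alpha> s \<notin> B \<and> ppt B (\<alpha> s) \<in> F\<close>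
      by auto
    show "killing br (\<alpha> 0) y = 0" "killing br (br (\<alpha> 0) (\<chi> i. deriv (\<lambda>s. \<alpha> s $ i) 0)) y = 0"
      by (rule isotropic_lines[OF y y0 mk(1) rank that(1,2)], assumption+, rule lines, assumption+)+
  qed
  have contact: "a \<in> A" if "a \<notin> B" "ppt B a \<in> F" for a
    using isotropic(1)[of 1 "\<lambda>_. a"] that by (simp add: A killing_commute[of y])
  show "F \<subseteq> proj_space (contact_space br z) (lie_stab br z)"
    unfolding A_def[symmetric] B_def[symmetric]
  proof
    fix T assume T: "T \<in> F"
    then obtain a where "a \<notin> B" "T = ppt B a"
      using F_cases by blast
    then show "T \<in> proj_space A B"
      using contact T by (auto simp: proj_space_def)
  qed
  obtain i where i: "y $ i \<noteq> 0"
    using y0 by (auto simp: vec_eq_iff)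
  \<comment> \<open>This is \<open>[a, y]\<close> modulo \<open>y\<close>, normalized so that it is invariant under the stabilizer.\<close>
  define f where "f a = br a y - (br a y $ i / y $ i) *s y" for a
  have f: "f (a + b) = f a + f b" "f (c *s a) = c *s f a" for a b c
    using i by (simp_all add: f_def br_simps vec_eq_iff field_simps)
  have fB: "f b = 0 \<longleftrightarrow> b \<in> B" for b
  proof
    assume "f b = 0"
    then show "b \<in> B"
      by (auto simp: f_def B)
  next
    assume "b \<in> B"
    then show "f b = 0"
      using i by (auto simp: f_def B)
  qed
  define \<S> where "\<S> = {\<lambda>a. p (\<psi> a *s y + f a) | p \<psi>. (\<exists>d. vanishing_on (orbit_cone Z) d p) \<and>
        Vector_Spaces.linear (*s) (*) \<psi> \<and> (\<forall>b\<in>B. \<psi> b = 0)}"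
  have "zariski_closed A B F"
    unfolding zariski_closed_def
  proof (intro exI conjI)
    show "\<forall>p\<in>\<S>. homogeneous_poly p \<and> (\<forall>a\<in>A. \<forall>b\<in>B. p (a + b) = p a)"
      unfolding \<S>_def
    proof clarify
      fix p \<psi> d
      assume p: "vanishing_on (orbit_cone Z) d p" and \<psi>: "Vector_Spaces.linear (*s) (*) \<psi>" "\<forall>b\<in>B. \<psi> b = 0"
      have "Vector_Spaces.linear (*s) (*s) (\<lambda>a. \<psi> a *s y + f a)"
        using \<psi>(1) by (auto simp: Vector_Spaces.linear_iff f vec_eq_iff algebra_simps)
      then have "homogeneous_poly (\<lambda>a. p (\<psi> a *s y + f a))"
        unfolding homogeneous_poly_iff using p hpoly_linear by (auto simp: vanishing_on_def)
      moreover have "p (\<psi> (a + b) *s y + f (a + b)) = p (\<psi> a *s y + f a)" if "b \<in> B" for a b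
        using \<psi> that fB[of b] by (simp add: Vector_Spaces.linear_iff f)
      ultimately show "homogeneous_poly (\<lambda>a. p (\<psi> a *s y + f a)) \<and>
          (\<forall>a\<in>A. \<forall>b\<in>B. p (\<psi> (a + b) *s y + f (a + b)) = p (\<psi> a *s y + f a))"
        by blast
    qed
    show "F = {ppt B a | a. a \<in> A - B \<and> (\<forall>p\<in>\<S>. p a = 0)}"
    proof (intro equalityI subsetI)
      fix T assume T: "T \<in> F"
      then obtain a where a: "a \<notin> B" "T = ppt B a"
        using F_cases by blast
      have "p (\<psi> a *s y + f a) = 0" if "vanishing_on (orbit_cone Z) d p" for p \<psi> d
      proof -
        have "\<psi> a *s y + f a = (\<psi> a - br a y $ i / y $ i) *s y + 1 *s br a y"
          by (simp add: f_def vec_eq_iff algebra_simps)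
        then show ?thesis
          using inF[OF a(1)] T a(2) that by metis
      qed
      then show "T \<in> {ppt B a | a. a \<in> A - B \<and> (\<forall>p\<in>\<S>. p a = 0)}"
        using a contact T unfolding \<S>_def by blast
    next
      fix T assume "T \<in> {ppt B a | a. a \<in> A - B \<and> (\<forall>p\<in>\<S>. p a = 0)}"
      then obtain a where a: "T = ppt B a" "a \<notin> B" and S: "\<forall>q\<in>\<S>. q a = 0"
        by blast
      obtain j where j: "f a $ j \<noteq> 0"
        using a(2) fB[of a] by (auto simp: vec_eq_iff)
      have "p (s *s y + t *s br a y) = 0" if p: "vanishing_on (orbit_cone Z) d p" for s t d p
      proof -
        \<comment> \<open>Up to the factor \<open>t\<close>, the vector is \<open>\<sigma> y + f(a)\<close>, and \<open>\<psi>\<close> is chosen with \<open>\<psi>(a) = \<sigma>\<close>.\<close>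
        define \<sigma> where "\<sigma> = s / t + br a y $ i / y $ i"
        define \<psi> where "\<psi> w = \<sigma> / f a $ j * f w $ j" for w
        have \<psi>: "Vector_Spaces.linear (*s) (*) \<psi>"
          by (auto simp: Vector_Spaces.linear_iff vec.vector_space_axioms vector_space_over_itself.vector_space_axioms \<psi>_def f algebra_simps)
        have "\<forall>b\<in>B. \<psi> b = 0"
        proof
          fix b assume "b \<in> B"
          then have "f b = 0"
            using fB by blast
          then show "\<psi> b = 0"
            by (simp add: \<psi>_def)
        qed
        with \<psi> p have "(\<lambda>a. p (\<psi> a *s y + f a)) \<in> \<S>"
          unfolding \<S>_def by blast
        from S[rule_format, OF this] have 0: "p (\<sigma> *s y + f a) = 0"
          using j by (simp add: \<psi>_def)
        have hp: "hpoly d p"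
          using p by (simp add: vanishing_on_def)
        show ?thesis
        proof (cases "t = 0")
          case True
          then show ?thesis
            using hpoly_scale[OF hp, of s y] p y by (simp add: vanishing_on_def)
        next
          case False
          then have "s *s y + t *s br a y = t *s (\<sigma> *s y + f a)"
            by (simp add: \<sigma>_def f_def vec_eq_iff field_simps)
          then show ?thesis
            using hpoly_scale[OF hp, of t "\<sigma> *s y + f a"] 0 by simp
        qed
      qed
      then show "T \<in> F"
        using inF[OF a(2)] a(1) by blast
    qed
  qed
  moreover have "proj_tangent_space A B F L \<subseteq> levi_hyperplane br Z z L" if L: "L \<in> F" for L
  proof
    fix w assume "w \<in> proj_tangent_space A B F L"
    then obtain u l a N where w: "w = u + l" and l: "l \<in> L" and chart: "is_chart A B L a N"
      and u: "u \<in> tangent_space (in_chart B a N F) 0"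
      by (auto simp: proj_tangent_space_def)
    obtain \<gamma> r where u_def: "u = (\<chi> i. deriv (\<lambda>s. \<gamma> s $ i) 0)" and r: "r > 0"
      and holo: "\<And>i. (\<lambda>s. \<gamma> s $ i) holomorphic_on ball 0 r"
      and \<gamma>: "\<gamma> ` ball 0 r \<subseteq> in_chart B a N F" "\<gamma> 0 = 0"
      using u by (auto simp: tangent_space_def)
    obtain a0 where a0: "a0 \<notin> B" "L = ppt B a0"
      using F_cases[OF L] by blast
    have a: "a \<in> L" "a \<notin> B"
      using chart by (auto simp: is_chart_def)
    have L': "L = ppt B a"
      using ppt_eq[of a B a0] a a0 subB by simp
    have "0 \<in> L"
      unfolding L' ppt_def by (rule vec.span_zero)
    have NA: "n \<in> A" if "n \<in> N" for n
      using chart \<open>0 \<in> L\<close> that unfolding is_chart_def by (metis (mono_tags, lifting) CollectI add.right_neutral)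
    have inside: "a + \<gamma> s \<notin> B \<and> ppt B (a + \<gamma> s) \<in> F" "\<gamma> s \<in> A" if "s \<in> ball 0 r" for s
    proof -
      have s: "\<gamma> s \<in> in_chart B a N F"
        using \<gamma>(1) that by blast
      then show "\<gamma> s \<in> A"
        using NA by (simp add: in_chart_def)
      have F: "ppt B (a + \<gamma> s) \<in> F"
        using s by (simp add: in_chart_def)
      moreover have "a + \<gamma> s \<notin> B"
      proof
        assume "a + \<gamma> s \<in> B"
        then have "ppt B (a + \<gamma> s) = B"
          using subB by (simp add: ppt_def insert_absorb vec.span_eq_iff)
        then obtain a' where "a' \<notin> B" "B = ppt B a'"
          using F_cases[OF F] by metis
        then show False
          by (metis insertI1 ppt_def vec.span_base)
      qed
      ultimately show "a + \<gamma> s \<notin> B \<and> ppt B (a + \<gamma> s) \<in> F"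
        by blast
    qed
    have deriv: "deriv (\<lambda>s. (a + \<gamma> s) $ j) 0 = deriv (\<lambda>s. \<gamma> s $ j) 0" for j
    proof -
      have "((\<lambda>s. \<gamma> s $ j) has_field_derivative deriv (\<lambda>s. \<gamma> s $ j) 0) (at 0)"
        using holo r by (intro holomorphic_derivI[of _ "ball 0 r"]) auto
      then have "((\<lambda>s. (a + \<gamma> s) $ j) has_field_derivative deriv (\<lambda>s. \<gamma> s $ j) 0) (at 0)"
        by (auto intro!: derivative_eq_intros)
      then show ?thesis
        by (rule DERIV_imp_deriv)
    qed
    have au: "killing br (br a u) y = 0"
    proof -
      have "(\<lambda>s. (a + \<gamma> s) $ j) holomorphic_on ball 0 r" for j
        using holo by (simp add: holomorphic_intros)
      from isotropic(2)[OF r this inside(1)] show ?thesis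
        unfolding deriv \<gamma>(2) u_def by simp
    qed
    have aA: "a \<in> A"
      using contact[OF a(2)] L L' by simp
    have uA: "u \<in> A"
    proof -
      have lin: "Vector_Spaces.linear (*s) (*) (\<lambda>w. killing br y w)"
        by (simp add: Vector_Spaces.linear_iff killing_simps vec.vector_space_axioms vector_space_over_itself.vector_space_axioms)
      note expand = linear_functional_expand[OF lin]
      have "((\<lambda>s. \<Sum>j\<in>UNIV. \<gamma> s $ j * killing br y (axis j 1)) has_field_derivative
          (\<Sum>j\<in>UNIV. u $ j * killing br y (axis j 1))) (at 0)"
        unfolding u_def vec_lambda_beta
        using holo r by (intro DERIV_sum DERIV_cmult_right holomorphic_derivI[of _ "ball 0 r"]) auto
      moreover have "(\<lambda>s. \<Sum>j\<in>UNIV. \<gamma> s $ j * killing br y (axis j 1)) = (\<lambda>s. killing br y (\<gamma> s))"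
        by (rule ext) (rule expand[symmetric])
      ultimately have d: "((\<lambda>s. killing br y (\<gamma> s)) has_field_derivative killing br y u) (at 0)"
        by (simp only: expand[of u])
      have ev: "eventually (\<lambda>s. killing br y (\<gamma> s) = 0) (nhds 0)"
      proof (rule eventually_mono)
        show "eventually (\<lambda>s. s \<in> ball 0 r) (nhds (0::complex))"
          using r by (intro eventually_nhds_in_open) auto
        show "killing br y (\<gamma> s) = 0" if "s \<in> ball 0 r" for s
          using inside(2)[OF that] by (simp add: A)
      qed
      have "((\<lambda>s. 0) has_field_derivative killing br y u) (at 0)"
        using d DERIV_cong_ev[OF refl ev refl] by blast
      then show ?thesis
        unfolding A using DERIV_const DERIV_unique by blast
    qed
    have L_iff: "c \<in> L \<longleftrightarrow> (\<exists>k. c - k *s a \<in> B)" for c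
      unfolding L' by (rule in_ppt)
    have LA: "c \<in> A" if c: "c \<in> L" for c
    proof -
      obtain k where "c - k *s a \<in> B"
        using c unfolding L_iff by blast
      then have "killing br y (c - k *s a) = 0"
        using BA A by blast
      then show ?thesis
        using aA by (simp add: A killing_simps)
    qed
    have stab: "killing br y (br b e) = 0" if b: "b \<in> B" and e: "e \<in> A" for b e
    proof -
      obtain c where c: "br b y = c *s y"
        using b B by blast
      have "killing br y (br b e) = killing br (br y b) e"
        by (simp add: killing_invariant)
      also have "br y b = (- c) *s y"
        using br_skew[of y b] by (simp add: c vec_eq_iff)
      also have "killing br ((- c) *s y) e = - c * killing br y e"
        by (rule killing_simps(5))
      finally show ?thesis
        using e by (simp add: A)
    qed
    have wA: "w \<in> A"
      using uA LA[OF l] by (simp add: w A killing_simps)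
    have "levi_tensor br Z z a' w = contact_space br z" if a': "a' \<in> L" for a'
    proof -
      obtain k where k: "a' - k *s a \<in> B"
        using a' unfolding L_iff by blast
      obtain k' where k': "l - k' *s a \<in> B"
        using l unfolding L_iff by blast
      have 1: "killing br y (br a u) = 0"
        using au by (simp add: killing_commute)
      have "killing br y (br (l - k' *s a) a) = 0"
        by (rule stab[OF k' aA])
      then have "killing br y (br a (l - k' *s a)) = 0"
        using br_skew[of a "l - k' *s a"] by (simp add: killing_eq ad_uminus)
      then have 2: "killing br y (br a l) = 0"
        by (simp add: br_more br_simps br_self killing_simps)
      have "killing br y (br (a' - k *s a) w) = 0"
        by (rule stab[OF k wA])
      then have "killing br y (br a' w) = 0"
        using 1 2 by (simp add: w br_more br_simps killing_simps)
      then show ?thesis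
        unfolding zy using LA[OF a'] wA z
        by (intro levi_tensor_eq_contact_space[OF Z _ y0 mk(1)[OF y]]) (simp_all add: A zy)
    qed
    then show "w \<in> levi_hyperplane br Z z L"
      using wA by (simp add: levi_hyperplane_def A_def)
  qed
  ultimately show "integral_subvariety (contact_space br z) (lie_stab br z) (levi_hyperplane br Z z) F"
    unfolding integral_subvariety_def A_def[symmetric] B_def[symmetric]
    by (auto simp: smooth_locus_def)
qed

end

theorem theorem1p1:
  fixes br :: "complex^'n \<Rightarrow> complex^'n \<Rightarrow> complex^'n"
    and Z :: "(complex^'n) set set" and z :: "(complex^'n) set"
  assumes "semisimple_lie_algebra br"
    and "nilpotent_orbit br Z"
    and "z \<in> Z"
    and "line_directions br (zariski_closure UNIV {0} Z) z \<noteq> {}"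
  shows "line_directions br (zariski_closure UNIV {0} Z) z
           \<subseteq> proj_space (contact_space br z) (lie_stab br z)
       \<and> integral_subvariety (contact_space br z) (lie_stab br z) (levi_hyperplane br Z z)
           (line_directions br (zariski_closure UNIV {0} Z) z)"
proof -
  interpret complex_lie_algebra br
    using assms(1) by unfold_locales (simp add: semisimple_lie_algebra_def)
  show ?thesis
    using line_directions_integral[OF assms(2,3)] by blast
qed

end
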